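(* Let $Z(t)$, $t\ge0$, be a real-valued Lévy process on a filtered probability space $(\Omega,\mathcal{F},(\mathcal{F}_t),P)$, let $x_n\in\mathbb{R}$ and let $a_n:\mathbb{R}\to\mathbb{R}$ be measurable functions, $n\ge0$. For each $n\ge0$ let $\xi_n$ be an $(\mathcal{F}_t)$-adapted solution of $$\xi_n(t)=x_n+\int_0^t a_n(\xi_n(s))\,ds+Z(t),\qquad t\ge0.$$ Assume that 1) $\lim_{n\to\infty}x_n=x_0$; 2) $\sup_{n\ge0}\sup_{x}|a_n(x)|<\infty$; 3) there exists a finite measure $\mu$ on $\mathcal{B}(\mathbb{R})$ such that for any $n\ge1$ and $\lambda$-almost all $t\ge0$ the distribution of $\xi_n(t)$ has a density $p_n(x,t)$ with respect to $\mu(dx)$; 4) $a_n\to a_0$ as $n\to\infty$ in measure $\mu$; 5) for $\lambda$-almost all $t\ge0$ the sequence $\{p_n(\cdot,t),\ n\ge1\}$ is uniformly integrable with respect to $\mu$; 6) there exists a unique solution to the equation with $n=0$, i.e. the equation $\xi_0(t)=x_0+\int_0^t a_0(\xi_0(s))\,ds+Z(t)$, $t\ge0$ (uniqueness being pathwise uniqueness). Then for any $T>0$ $$\sup_{t\in[0,T]}|\xi_n(t)-\xi_0(t)|\to 0\quad\text{in probability as } n\to\infty.$$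
   Context: $\lambda$ denotes the Lebesgue measure and $\mathcal{B}(\mathbb{R})$ the Borel $\sigma$-algebra. A Lévy process on a filtered probability space $(\Omega,\mathcal{F},(\mathcal{F}_t),P)$ is understood as a càdlàg $(\mathcal{F}_t)$-adapted process with $Z(0)=0$, stationary increments, and $Z(t+s)-Z(t)$ independent of $\mathcal{F}_t$ for all $s,t\ge0$. A solution of an equation $\xi(t)=x+\int_0^t a(\xi(s))\,ds+Z(t)$, $t\ge 0$, is an $(\mathcal{F}_t)$-adapted process $\xi$ such that almost surely $\int_0^T|a(\xi(s))|\,ds<\infty$ for all $T>0$ and the equation holds for all $t\ge0$. Pathwise uniqueness: on every filtered probability space carrying a Lévy process with the law of $Z$, any two solutions with the same initial value driven by that process coincide for all $t\ge0$ almost surely. Convergence in measure $\mu$ means $\mu(\{x:|a_n(x)-a_0(x)|>\varepsilon\})\to0$ for every $\varepsilon>0$. *)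

theory Defs
  imports "HOL-Probability.Probability"
begin

text \<open>A process is a function \<open>X :: real \<Rightarrow> 'a \<Rightarrow> real\<close> of time and sample point, and a filtration
  is a function from times to sub-sigma-algebras. Only times \<open>t \<ge> 0\<close> are ever referred to; the
  values at negative times are irrelevant. The usual conditions (completeness, right-continuity)
  are not imposed.\<close>

definition filtered_prob_space :: "'a measure \<Rightarrow> (real \<Rightarrow> 'a measure) \<Rightarrow> bool" where
  "filtered_prob_space M F \<longleftrightarrow>
     prob_space M \<and> (\<forall>t\<ge>0. subalgebra M (F t)) \<and>
     (\<forall>s t. 0 \<le> s \<longrightarrow> s \<le> t \<longrightarrow> sets (F s) \<subseteq> sets (F t))"

definition adapted_process :: "(real \<Rightarrow> 'a measure) \<Rightarrow> (real \<Rightarrow> 'a \<Rightarrow> real) \<Rightarrow> bool" where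
  "adapted_process F X \<longleftrightarrow> (\<forall>t\<ge>0. X t \<in> borel_measurable (F t))"

definition cadlag_path :: "(real \<Rightarrow> real) \<Rightarrow> bool" where
  "cadlag_path f \<longleftrightarrow>
     (\<forall>t\<ge>0. continuous (at_right t) f) \<and> (\<forall>t>0. \<exists>l. (f \<longlongrightarrow> l) (at_left t))"

definition levy_process :: "'a measure \<Rightarrow> (real \<Rightarrow> 'a measure) \<Rightarrow> (real \<Rightarrow> 'a \<Rightarrow> real) \<Rightarrow> bool" where
  "levy_process M F Z \<longleftrightarrow>
     adapted_process F Z \<and>
     (\<forall>\<omega>\<in>space M. cadlag_path (\<lambda>t. Z t \<omega>) \<and> Z 0 \<omega> = 0) \<and>
     (\<forall>s\<ge>0. \<forall>t\<ge>0. distr M borel (\<lambda>\<omega>. Z (t + s) \<omega> - Z t \<omega>) = distr M borel (\<lambda>\<omega>. Z s \<omega> - Z 0 \<omega>)) \<and>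
     (\<forall>s\<ge>0. \<forall>t\<ge>0. prob_space.indep_set M (sets (F t))
        {(\<lambda>\<omega>. Z (t + s) \<omega> - Z t \<omega>) -` B \<inter> space M | B. B \<in> sets borel})"

text \<open>The law of a process, as a measure on the product sigma-algebra of the space of all functions
  on \<open>[0,\<infinity>)\<close>; two processes have the same law iff their finite-dimensional distributions agree.\<close>

definition process_law :: "'a measure \<Rightarrow> (real \<Rightarrow> 'a \<Rightarrow> real) \<Rightarrow> (real \<Rightarrow> real) measure" where
  "process_law M X = distr M (Pi\<^sub>M {0..} (\<lambda>_. borel)) (\<lambda>\<omega>. \<lambda>t\<in>{0..}. X t \<omega>)"

definition is_solution ::
  "'a measure \<Rightarrow> (real \<Rightarrow> 'a measure) \<Rightarrow> (real \<Rightarrow> 'a \<Rightarrow> real) \<Rightarrow> real \<Rightarrow> (real \<Rightarrow> real) \<Rightarrow> (real \<Rightarrow> 'a \<Rightarrow> real) \<Rightarrow> bool"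
where
  "is_solution M F Z x a \<xi> \<longleftrightarrow>
     adapted_process F \<xi> \<and>
     (AE \<omega> in M.
        (\<forall>T>0. set_integrable lborel {0..T} (\<lambda>s. a (\<xi> s \<omega>))) \<and>
        (\<forall>t\<ge>0. \<xi> t \<omega> = x + (LINT s:{0..t}|lborel. a (\<xi> s \<omega>)) + Z t \<omega>))"

text \<open>Pathwise uniqueness for driving processes with law \<open>L\<close>. HOL cannot quantify over all sample
  space types inside a formula, so the type of the sample points is a parameter. The choice
  \<open>path3\<close>, the type of trajectories of a triple of processes, is universal: by
  \<open>pathwise_unique_path3\<close> below, uniqueness on all filtered probability spaces over that type
  implies uniqueness on all filtered probability spaces over any type.\<close>

definition pathwise_unique ::
  "'b itself \<Rightarrow> (real \<Rightarrow> real) measure \<Rightarrow> real \<Rightarrow> (real \<Rightarrow> real) \<Rightarrow> bool"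
where
  "pathwise_unique (_ :: 'b itself) L x a \<longleftrightarrow>
     (\<forall>(M :: 'b measure) F Z \<xi> \<eta>.
        filtered_prob_space M F \<longrightarrow> levy_process M F Z \<longrightarrow> process_law M Z = L \<longrightarrow>
        is_solution M F Z x a \<xi> \<longrightarrow> is_solution M F Z x a \<eta> \<longrightarrow>
        (AE \<omega> in M. \<forall>t\<ge>0. \<xi> t \<omega> = \<eta> t \<omega>))"

type_synonym path3 = "real \<Rightarrow> real \<times> real \<times> real"

definition uniformly_integrable :: "'a measure \<Rightarrow> 'i set \<Rightarrow> ('i \<Rightarrow> 'a \<Rightarrow> real) \<Rightarrow> bool" where
  "uniformly_integrable \<mu> I f \<longleftrightarrow>
     (\<forall>i\<in>I. f i \<in> borel_measurable \<mu>) \<and>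
     ((\<lambda>c. SUP i\<in>I. \<integral>\<^sup>+y\<in>{y. \<bar>f i y\<bar> > c}. ennreal \<bar>f i y\<bar> \<partial>\<mu>) \<longlongrightarrow> 0) at_top"

definition converges_in_measure :: "'a measure \<Rightarrow> (nat \<Rightarrow> 'a \<Rightarrow> real) \<Rightarrow> ('a \<Rightarrow> real) \<Rightarrow> bool" where
  "converges_in_measure \<mu> f g \<longleftrightarrow>
     (\<forall>\<epsilon>>0. (\<lambda>n. emeasure \<mu> {y \<in> space \<mu>. \<bar>f n y - g y\<bar> > \<epsilon>}) \<longlonglongrightarrow> 0)"

text \<open>Convergence to 0 in probability for \<open>[0,\<infinity>]\<close>-valued functions. The outer measure agrees with
  \<open>emeasure M\<close> on measurable sets. It is used because the supremum of a process over an interval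
  need not be measurable when the paths are regular only almost surely and \<open>M\<close> is not complete,
  and \<open>emeasure M\<close> is by convention 0 on non-measurable sets.\<close>

definition tendsto_0_in_prob :: "'a measure \<Rightarrow> (nat \<Rightarrow> 'a \<Rightarrow> ennreal) \<Rightarrow> bool" where
  "tendsto_0_in_prob M Y \<longleftrightarrow>
     (\<forall>\<epsilon>>0. (\<lambda>n. outer_measure_of M {\<omega> \<in> space M. Y n \<omega> > ennreal \<epsilon>}) \<longlonglongrightarrow> 0)"


subsection \<open>Universality of the path space\<close>

definition final_alg :: "'a measure \<Rightarrow> ('a \<Rightarrow> 'b) \<Rightarrow> 'b measure" where
  "final_alg W \<Phi> = sigma (\<Phi> ` space W) {A. A \<subseteq> \<Phi> ` space W \<and> \<Phi> -` A \<inter> space W \<in> sets W}"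

lemma space_final_alg [simp]: "space (final_alg W \<Phi>) = \<Phi> ` space W"
  unfolding final_alg_def by (subst space_measure_of) auto

lemma sets_final_alg:
  "sets (final_alg W \<Phi>) = {A. A \<subseteq> \<Phi> ` space W \<and> \<Phi> -` A \<inter> space W \<in> sets W}"
proof -
  have "sigma_algebra (\<Phi> ` space W) {A. A \<subseteq> \<Phi> ` space W \<and> \<Phi> -` A \<inter> space W \<in> sets W}"
    unfolding sigma_algebra_iff2
  proof (intro conjI ballI allI impI)
    fix A assume A: "A \<in> {A. A \<subseteq> \<Phi> ` space W \<and> \<Phi> -` A \<inter> space W \<in> sets W}"
    have "\<Phi> -` (\<Phi> ` space W - A) \<inter> space W = space W - (\<Phi> -` A \<inter> space W)" by auto
    with A show "\<Phi> ` space W - A \<in> {A. A \<subseteq> \<Phi> ` space W \<and> \<Phi> -` A \<inter> space W \<in> sets W}"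
      by auto
  next
    fix A :: "nat \<Rightarrow> _" assume A: "range A \<subseteq> {A. A \<subseteq> \<Phi> ` space W \<and> \<Phi> -` A \<inter> space W \<in> sets W}"
    have "\<Phi> -` (\<Union>i. A i) \<inter> space W = (\<Union>i. \<Phi> -` A i \<inter> space W)" by auto
    also have "\<dots> \<in> sets W" using A by (intro sets.countable_UN) blast
    finally show "(\<Union>i. A i) \<in> {A. A \<subseteq> \<Phi> ` space W \<and> \<Phi> -` A \<inter> space W \<in> sets W}"
      using A by auto
  qed auto
  then show ?thesis
    unfolding final_alg_def by (intro sigma_algebra.sets_measure_of_eq)
qed

lemma measurable_to_final_alg: "\<Phi> \<in> measurable W (final_alg W \<Phi>)"
  by (rule measurableI) (auto simp: sets_final_alg)

lemma measurable_from_final_alg: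
  assumes "(\<lambda>\<omega>. g (\<Phi> \<omega>)) \<in> measurable W K"
  shows "g \<in> measurable (final_alg W \<Phi>) K"
proof (rule measurableI)
  fix A assume A: "A \<in> sets K"
  have "\<Phi> -` (g -` A \<inter> \<Phi> ` space W) \<inter> space W = (\<lambda>\<omega>. g (\<Phi> \<omega>)) -` A \<inter> space W" by auto
  also have "\<dots> \<in> sets W" using assms A by (rule measurable_sets)
  finally show "g -` A \<inter> space (final_alg W \<Phi>) \<in> sets (final_alg W \<Phi>)"
    by (auto simp: sets_final_alg)
qed (use measurable_space[OF assms] in auto)

lemma distr_final_alg_eq:
  fixes M :: "'b measure"
  assumes S: "S \<in> sets M" and ae: "AE \<omega> in M. \<omega> \<in> S"
    and h: "h \<in> measurable M K" and gh: "\<And>\<omega>. g (\<Phi> \<omega>) = h \<omega>"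
  shows "distr (distr (restrict_space M S) (final_alg (restrict_space M S) \<Phi>) \<Phi>) K g = distr M K h"
proof -
  let ?W = "restrict_space M S"
  have hW: "h \<in> measurable ?W K" by (intro measurable_restrict_space1 h)
  have g: "g \<in> measurable (final_alg ?W \<Phi>) K"
    by (rule measurable_from_final_alg) (simp add: gh hW)
  have "distr (distr ?W (final_alg ?W \<Phi>) \<Phi>) K g = distr ?W K h"
    by (subst distr_distr[OF g measurable_to_final_alg]) (simp add: comp_def gh)
  also have "\<dots> = distr M K h"
  proof (rule measure_eqI)
    fix A assume "A \<in> sets (distr ?W K h)"
    then have A: "A \<in> sets K" by simp
    have sub: "S \<subseteq> space M" using S by (rule sets.sets_into_space)
    have hA: "h -` A \<inter> space M \<in> sets M" using h A by (rule measurable_sets)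
    have eq: "h -` A \<inter> space ?W = (h -` A \<inter> space M) \<inter> S"
      using sub by (auto simp: space_restrict_space)
    have "emeasure (distr ?W K h) A = emeasure M ((h -` A \<inter> space M) \<inter> S)"
      unfolding emeasure_distr[OF hW A] eq
      by (rule emeasure_restrict_space) (use sub S in \<open>auto simp: Int_absorb1 Int_absorb2\<close>)
    also have "\<dots> = emeasure M (h -` A \<inter> space M)"
      by (rule emeasure_eq_AE) (use ae hA S in auto)
    finally show "emeasure (distr ?W K h) A = emeasure (distr M K h) A"
      by (simp add: emeasure_distr[OF h A])
  qed simp
  finally show ?thesis .
qed

lemma pathwise_unique_path3:
  assumes uniq: "pathwise_unique TYPE(path3) L x a"
  shows "pathwise_unique TYPE('b) L x a"
  unfolding pathwise_unique_def
proof (intro allI impI)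
  fix M :: "'b measure" and F Z \<xi> \<eta>
  assume fps: "filtered_prob_space M F" and levy: "levy_process M F Z" and law: "process_law M Z = L"
    and sol1: "is_solution M F Z x a \<xi>" and sol2: "is_solution M F Z x a \<eta>"
  interpret M: prob_space M using fps by (simp add: filtered_prob_space_def)
  define good :: "(real \<Rightarrow> real) \<Rightarrow> (real \<Rightarrow> real) \<Rightarrow> bool" where "good f z \<longleftrightarrow> (\<forall>T>0. set_integrable lborel {0..T} (\<lambda>s. a (f s))) \<and>
        (\<forall>t\<ge>0. f t = x + (LINT s:{0..t}|lborel. a (f s)) + z t)" for f z
  have "AE \<omega> in M. good (\<lambda>t. \<xi> t \<omega>) (\<lambda>t. Z t \<omega>) \<and> good (\<lambda>t. \<eta> t \<omega>) (\<lambda>t. Z t \<omega>)"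
    using sol1[unfolded is_solution_def, folded good_def]
      sol2[unfolded is_solution_def, folded good_def] by (intro AE_conjI) simp_all
  then obtain N where N: "N \<in> null_sets M"
    "{\<omega>\<in>space M. \<not> (good (\<lambda>t. \<xi> t \<omega>) (\<lambda>t. Z t \<omega>) \<and> good (\<lambda>t. \<eta> t \<omega>) (\<lambda>t. Z t \<omega>))} \<subseteq> N"
    unfolding eventually_ae_filter by blast
  define O' where "O' = space M - N"
  define \<Phi> where "\<Phi> = (\<lambda>\<omega> t. (Z t \<omega>, \<xi> t \<omega>, \<eta> t \<omega>))"
  define W where "W = restrict_space M O'"
  define G where "G t = final_alg (restrict_space (F t) O') \<Phi>" for t
  define M' where "M' = distr W (final_alg W \<Phi>) \<Phi>"
  define Z' where "Z' = (\<lambda>t (w::path3). fst (w t))"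
  define \<xi>' where "\<xi>' = (\<lambda>t (w::path3). fst (snd (w t)))"
  define \<eta>' where "\<eta>' = (\<lambda>t (w::path3). snd (snd (w t)))"
  have O'[measurable]: "O' \<in> sets M" using N by (auto simp: O'_def)
  have O'_sub: "O' \<subseteq> space M" by (auto simp: O'_def)
  have aeO': "AE \<omega> in M. \<omega> \<in> O'" using AE_not_in[OF N(1)] by (auto simp: O'_def)
  have spW: "space W = O'" using O'_sub by (auto simp: W_def space_restrict_space)
  have spM': "space M' = \<Phi> ` O'" by (simp add: M'_def spW)
  have setsM': "sets M' = {A. A \<subseteq> \<Phi> ` O' \<and> \<Phi> -` A \<inter> O' \<in> sets W}"
    by (simp add: M'_def sets_final_alg spW)
  have subF: "subalgebra M (F t)" if "t \<ge> 0" for t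
    using fps that by (simp add: filtered_prob_space_def)
  have spF: "space (F t) = space M" and setsF: "sets (F t) \<subseteq> sets M" if "t \<ge> 0" for t
    using subF[OF that] by (auto simp: subalgebra_def)
  have spFr: "space (restrict_space (F t) O') = O'" if "t \<ge> 0" for t
    using O'_sub by (auto simp: space_restrict_space spF[OF that])
  have Gsets: "sets (G t) = {A. A \<subseteq> \<Phi> ` O' \<and> \<Phi> -` A \<inter> O' \<in> sets (restrict_space (F t) O')}"
    if "t \<ge> 0" for t
    by (simp add: G_def sets_final_alg spFr[OF that])
  have Fr_sub: "sets (restrict_space (F t) O') \<subseteq> sets W" if "t \<ge> 0" for t
    unfolding W_def sets_restrict_space by (rule image_mono[OF setsF[OF that]])
  have Fr_mono: "sets (restrict_space (F s) O') \<subseteq> sets (restrict_space (F t) O')"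
    if "0 \<le> s" "s \<le> t" for s t
  proof -
    have "sets (F s) \<subseteq> sets (F t)" using fps that unfolding filtered_prob_space_def by blast
    then show ?thesis unfolding sets_restrict_space by (rule image_mono)
  qed
  have em_trace: "emeasure M (A \<inter> O') = emeasure M A" if "A \<in> sets M" for A
    by (rule emeasure_eq_AE) (use aeO' that in auto)
  have emW: "emeasure W A = emeasure M A" if "A \<in> sets W" for A
    using that O'_sub by (subst W_def, subst emeasure_restrict_space)
      (auto simp: W_def sets_restrict_space O')
  have emM': "emeasure M' A = emeasure M (\<Phi> -` A \<inter> O')" if "A \<in> sets M'" for A
    using that by (auto simp: M'_def emeasure_distr measurable_to_final_alg spW sets_final_alg emW)
  have probM': "prob_space M'"
  proof
    have "\<Phi> -` space M' \<inter> O' = O'" by (auto simp: spM')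
    then show "emeasure M' (space M') = 1"
      using em_trace[OF sets.top] O'_sub
      by (simp add: emM' M.emeasure_space_1 Int_absorb1)
  qed
  then interpret M': prob_space M' .
  have fps': "filtered_prob_space M' G"
    unfolding filtered_prob_space_def
  proof (intro conjI allI impI)
    show "prob_space M'" by (fact probM')
  next
    fix t :: real assume t: "t \<ge> 0"
    show "subalgebra M' (G t)"
      unfolding subalgebra_def
    proof
      show "space (G t) = space M'" by (simp add: G_def spFr[OF t] spM')
      show "sets (G t) \<subseteq> sets M'"
        unfolding Gsets[OF t] setsM' using Fr_sub[OF t] by blast
    qed
  next
    fix s t :: real assume "0 \<le> s" "s \<le> t"
    then show "sets (G s) \<subseteq> sets (G t)"
      using Fr_mono[of s t] by (auto simp: Gsets)
  qed
  have adZ: "adapted_process F Z" and ad1: "adapted_process F \<xi>" and ad2: "adapted_process F \<eta>"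
    using levy sol1 sol2 by (auto simp: levy_process_def is_solution_def)
  have adapt: "adapted_process G Y'"
    if "adapted_process F Y" and "\<And>t \<omega>. Y' t (\<Phi> \<omega>) = Y t \<omega>" for Y Y'
    unfolding adapted_process_def G_def
    by (intro allI impI measurable_from_final_alg)
       (use that in \<open>auto simp: adapted_process_def intro: measurable_restrict_space1\<close>)
  have ZP: "Z' t (\<Phi> \<omega>) = Z t \<omega>" and P1: "\<xi>' t (\<Phi> \<omega>) = \<xi> t \<omega>" and P2: "\<eta>' t (\<Phi> \<omega>) = \<eta> t \<omega>" for t \<omega>
    by (auto simp: Z'_def \<xi>'_def \<eta>'_def \<Phi>_def)
  have measZ: "Z t \<in> borel_measurable M" if "t \<ge> 0" for t
    using adZ that measurable_from_subalg[OF subF[OF that]] by (auto simp: adapted_process_def)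
  note distr_eq = distr_final_alg_eq[of O' M _ _ _ \<Phi>, OF O' aeO', folded W_def, folded M'_def]
  have levy': "levy_process M' G Z'"
    unfolding levy_process_def
  proof (intro conjI allI impI ballI)
    show "adapted_process G Z'" by (rule adapt[OF adZ ZP])
  next
    fix w assume "w \<in> space M'"
    then obtain \<omega> where w: "\<omega> \<in> space M" "w = \<Phi> \<omega>" using O'_sub by (auto simp: spM')
    show "cadlag_path (\<lambda>t. Z' t w)" and "Z' 0 w = 0"
      using levy w by (auto simp: levy_process_def ZP)
  next
    fix s t :: real assume st: "s \<ge> 0" "t \<ge> 0"
    have m: "(\<lambda>\<omega>. Z (t + s) \<omega> - Z t \<omega>) \<in> borel_measurable M"
      "(\<lambda>\<omega>. Z s \<omega> - Z 0 \<omega>) \<in> borel_measurable M"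
      using st by (auto intro!: borel_measurable_diff measZ)
    show "distr M' borel (\<lambda>\<omega>. Z' (t + s) \<omega> - Z' t \<omega>) = distr M' borel (\<lambda>\<omega>. Z' s \<omega> - Z' 0 \<omega>)"
      using levy st distr_eq[OF m(1), of "\<lambda>\<omega>. Z' (t + s) \<omega> - Z' t \<omega>"]
        distr_eq[OF m(2), of "\<lambda>\<omega>. Z' s \<omega> - Z' 0 \<omega>"]
      by (simp add: ZP levy_process_def)
  next
    fix s t :: real assume st: "s \<ge> 0" "t \<ge> 0"
    let ?D = "\<lambda>\<omega>. Z (t + s) \<omega> - Z t \<omega>" and ?D' = "\<lambda>\<omega>. Z' (t + s) \<omega> - Z' t \<omega>"
    have m: "?D \<in> borel_measurable M" using st by (auto intro!: borel_measurable_diff measZ)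
    have "(\<lambda>\<omega>. ?D' (\<Phi> \<omega>)) \<in> borel_measurable W"
      unfolding W_def ZP by (intro measurable_restrict_space1 m)
    from measurable_from_final_alg[where g = ?D' and \<Phi> = \<Phi>, OF this] have m': "?D' \<in> borel_measurable M'"
      by (simp add: M'_def)
    have ind: "M.indep_set (sets (F t)) {?D -` B \<inter> space M | B. B \<in> sets borel}"
      using levy st by (simp add: levy_process_def)
    show "M'.indep_set (sets (G t)) {?D' -` B \<inter> space M' | B. B \<in> sets borel}"
    proof (rule M'.indep_setI)
      show "sets (G t) \<subseteq> M'.events"
        using fps' st by (simp add: filtered_prob_space_def subalgebra_def)
      show "{?D' -` B \<inter> space M' | B. B \<in> sets borel} \<subseteq> M'.events"
        using measurable_sets[OF m'] by auto
    next
      fix A C assume A: "A \<in> sets (G t)" and "C \<in> {?D' -` B \<inter> space M' | B. B \<in> sets borel}"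
      then obtain B where B: "B \<in> sets borel" "C = ?D' -` B \<inter> space M'" by auto
      have AM: "A \<in> sets M'" using fps' st A by (auto simp: filtered_prob_space_def subalgebra_def)
      have CM: "C \<in> sets M'" using measurable_sets[OF m' B(1)] B(2) by simp
      from A obtain A0 where A0: "A0 \<in> sets (F t)" "\<Phi> -` A \<inter> O' = A0 \<inter> O'"
        using st by (auto simp: Gsets sets_restrict_space)
      define C0 where "C0 = ?D -` B \<inter> space M"
      have C0: "C0 \<in> sets M" unfolding C0_def by (rule measurable_sets[OF m B(1)])
      have A0M: "A0 \<in> sets M" using setsF[OF st(2)] A0 by auto
      have "\<Phi> \<omega> \<in> space M'" "\<omega> \<in> space M" if "\<omega> \<in> O'" for \<omega>
        using that O'_sub by (auto simp: spM')
      then have CP: "\<Phi> -` C \<inter> O' = C0 \<inter> O'" by (auto simp: B(2) ZP C0_def)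
      have ACP: "\<Phi> -` (A \<inter> C) \<inter> O' = (A0 \<inter> C0) \<inter> O'" using A0(2) CP by blast
      have "M'.prob (A \<inter> C) = M.prob (A0 \<inter> C0)"
        using AM CM A0M C0 by (simp add: measure_def emM' ACP em_trace sets.Int del: vimage_Int)
      also have "\<dots> = M.prob A0 * M.prob C0"
        by (rule M.indep_setD[OF ind A0(1)]) (use B(1) in \<open>auto simp: C0_def\<close>)
      also have "\<dots> = M'.prob A * M'.prob C"
        using AM CM A0M C0 by (simp add: measure_def emM' A0(2) CP em_trace)
      finally show "M'.prob (A \<inter> C) = M'.prob A * M'.prob C" .
    qed
  qed
  have law': "process_law M' Z' = L"
    unfolding process_law_def law[symmetric]
    by (intro distr_eq measurable_restrict measZ) (auto simp: ZP)
  have sol': "is_solution M' G Z' x a Y'"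
    if "adapted_process F Y" and Y: "\<And>t \<omega>. Y' t (\<Phi> \<omega>) = Y t \<omega>"
      and good: "\<And>\<omega>. \<omega> \<in> O' \<Longrightarrow> good (\<lambda>t. Y t \<omega>) (\<lambda>t. Z t \<omega>)" for Y Y'
  proof -
    have "good (\<lambda>t. Y' t w) (\<lambda>t. Z' t w)" if "w \<in> space M'" for w
      using that good by (auto simp: spM' Y ZP)
    then have "AE w in M'. good (\<lambda>t. Y' t w) (\<lambda>t. Z' t w)" by (intro AE_I2)
    then show ?thesis
      unfolding is_solution_def good_def using adapt[OF that(1,2)] by auto
  qed
  have good1: "good (\<lambda>t. \<xi> t \<omega>) (\<lambda>t. Z t \<omega>)" and good2: "good (\<lambda>t. \<eta> t \<omega>) (\<lambda>t. Z t \<omega>)"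
    if "\<omega> \<in> O'" for \<omega>
    using that N(2) unfolding O'_def by blast+
  have sol1': "is_solution M' G Z' x a \<xi>'" by (rule sol'[OF ad1 P1 good1])
  have sol2': "is_solution M' G Z' x a \<eta>'" by (rule sol'[OF ad2 P2 good2])
  have "AE w in M'. \<forall>t\<ge>0. \<xi>' t w = \<eta>' t w"
    by (rule uniq[unfolded pathwise_unique_def, rule_format, OF fps' levy' law' sol1' sol2'])
  then have "AE \<omega> in W. \<forall>t\<ge>0. \<xi>' t (\<Phi> \<omega>) = \<eta>' t (\<Phi> \<omega>)"
    unfolding M'_def by (rule AE_distrD[OF measurable_to_final_alg])
  then have "AE \<omega> in M. \<omega> \<in> O' \<longrightarrow> (\<forall>t\<ge>0. \<xi> t \<omega> = \<eta> t \<omega>)"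
    unfolding W_def P1 P2 by (subst (asm) AE_restrict_space_iff) (use O'_sub O' in \<open>simp_all add: Int_absorb1 Int_absorb2\<close>)
  with aeO' show "AE \<omega> in M. \<forall>t\<ge>0. \<xi> t \<omega> = \<eta> t \<omega>" by (rule AE_mp)
qed

end

theory Submission
  imports Defs
begin

text \<open>Write \<open>\<xi>\<^sub>n = \<eta>\<^sub>n + Z\<close>. The drift parts \<open>\<eta>\<^sub>n\<close> have a common Lipschitz constant and bounded initial
  values, so they live in a compact set of paths and only they need a compactness argument. The noise
  \<open>Z\<close> and the solution \<open>\<xi>\<^sub>0\<close> stay where they are, on the original probability space, and convergence
  is understood as stable convergence: along a subsequence \<open>P (A \<inter> {\<eta>\<^sub>n \<in> D})\<close> converges for
  \<^emph>\<open>every\<close> event \<open>A\<close> and every cylinder \<open>D\<close> (\<open>stable_convergent_subsequence\<close>). The limits are the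
  values of a probability measure \<open>Q\<close> on \<open>\<Omega> \<times> K\<close> whose first marginal is \<open>P\<close>. To have
  clopen cylinders, paths are coded by the binary digits of their values at dyadic times, so that \<open>K = {0,1}\<^sup>I\<close> with \<open>I\<close>
  countable; compactness of \<open>K\<close> makes the limit countably additive (\<open>stable_limit_measure\<close>).

  Under \<open>Q\<close> there are \<open>Z\<close>, \<open>\<xi>\<^sub>0\<close> and a random Lipschitz path \<open>\<eta>\<close> on one space. Three facts pass to
  the limit. First, \<open>Z\<close> is still a Levy process for the filtration that also observes \<open>\<eta>\<close>, because
  \<open>P (A \<inter> {\<eta>\<^sub>n \<in> D} \<inter> {Z (t + s) - Z t \<in> S})\<close> factorizes for every \<open>n\<close> when \<open>A\<close> and \<open>D\<close> belong to
  the past of \<open>t\<close> (\<open>extended_levy_process\<close>). Secondly, uniform integrability of the densities makes the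
  laws of \<open>\<xi>\<^sub>n t\<close> uniformly absolutely continuous with respect to \<open>\<mu>\<close>. Weak convergence then improves
  to convergence on every Borel set, which admits a merely measurable drift \<open>a\<^sub>0\<close>, and convergence of
  \<open>a\<^sub>n\<close> in \<open>\<mu>\<close>-measure allows \<open>a\<^sub>n\<close> to be exchanged for \<open>a\<^sub>0\<close>
  (\<open>tendsto_integral_uniformly_continuous\<close>). Thirdly, by dominated convergence in time, the integrated
  equation tested with indicators of rectangles passes to the limit, so \<open>\<eta> + Z\<close> solves the limit
  equation \<open>Q\<close>-almost surely (\<open>limit_equation\<close>).

  Pathwise uniqueness on the enlarged space gives \<open>\<eta> + Z = \<xi>\<^sub>0\<close>. Hence the expectation of
  \<open>min 1 \<bar>\<xi>\<^sub>n t - \<xi>\<^sub>0 t\<bar>\<close> tends to \<open>0\<close> for every \<open>t\<close>, and since the differences \<open>\<xi>\<^sub>n - \<xi>\<^sub>0\<close> are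
  equi-Lipschitz, finitely many times control the supremum over \<open>[0, T]\<close>. The argument applies to a
  further subsequence of any given subsequence, and therefore the whole sequence converges.\<close>

section \<open>Approximation and level sets\<close>

lemma tendsto_by_approximation:
  fixes x :: "nat \<Rightarrow> real"
  assumes "\<And>e. e > 0 \<Longrightarrow> \<exists>y l. y \<longlonglongrightarrow> l \<and> (\<forall>k. \<bar>x k - y k\<bar> \<le> e) \<and> \<bar>x0 - l\<bar> \<le> e"
  shows "x \<longlonglongrightarrow> x0"
proof (rule LIMSEQ_I)
  fix r :: real assume r: "r > 0"
  obtain y l where y: "y \<longlonglongrightarrow> l" "\<And>k. \<bar>x k - y k\<bar> \<le> r / 4" "\<bar>x0 - l\<bar> \<le> r / 4"
    using assms[of "r / 4"] r by auto
  obtain N where N: "\<And>k. k \<ge> N \<Longrightarrow> norm (y k - l) < r / 4"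
    using LIMSEQ_D[OF y(1), of "r / 4"] r by auto
  have "norm (x k - x0) < r" if "k \<ge> N" for k
    using y(2)[of k] y(3) N[OF that] r by (simp add: abs_real_def split: if_splits)
  then show "\<exists>N. \<forall>k\<ge>N. norm (x k - x0) < r" by blast
qed

lemma convergent_by_approximation:
  fixes x :: "nat \<Rightarrow> real"
  assumes "\<And>e. e > 0 \<Longrightarrow> \<exists>y. convergent y \<and> (\<forall>k. \<bar>x k - y k\<bar> \<le> e)"
  shows "convergent x"
  unfolding Cauchy_convergent_iff[symmetric]
proof (rule metric_CauchyI)
  fix r :: real assume r: "r > 0"
  obtain y where y: "convergent y" "\<And>k. \<bar>x k - y k\<bar> \<le> r / 4"
    using assms[of "r / 4"] r by auto
  obtain N where N: "\<And>m n. m \<ge> N \<Longrightarrow> n \<ge> N \<Longrightarrow> dist (y m) (y n) < r / 4"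
    using metric_CauchyD[OF convergent_Cauchy[OF y(1)], of "r / 4"] r by auto
  have "dist (x m) (x n) < r" if "m \<ge> N" "n \<ge> N" for m n
    using y(2)[of m] y(2)[of n] N[OF that] r by (simp add: dist_real_def abs_real_def split: if_splits)
  then show "\<exists>M. \<forall>m\<ge>M. \<forall>n\<ge>M. dist (x m) (x n) < r" by blast
qed

lemma tendsto_0_by_subsequences:
  fixes y :: "nat \<Rightarrow> ennreal"
  assumes sub: "\<And>r :: nat \<Rightarrow> nat. strict_mono r \<Longrightarrow> \<exists>q :: nat \<Rightarrow> nat. strict_mono q \<and> (\<lambda>k. y (r (q k))) \<longlonglongrightarrow> 0"
  shows "y \<longlonglongrightarrow> 0"
proof (rule ccontr)
  assume "\<not> y \<longlonglongrightarrow> 0"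
  then obtain d where d: "0 < d" "\<not> eventually (\<lambda>n. y n < d) sequentially"
    by (auto simp: order_tendsto_iff)
  then have "infinite {n. \<not> y n < d}"
    by (simp add: eventually_sequentially infinite_nat_iff_unbounded_le)
  then obtain r :: "nat \<Rightarrow> nat" where r: "strict_mono r" "\<And>k. r k \<in> {n. \<not> y n < d}"
    using infinite_enumerate by blast
  obtain q :: "nat \<Rightarrow> nat" where "strict_mono q" "(\<lambda>k. y (r (q k))) \<longlonglongrightarrow> 0"
    using sub[OF r(1)] by blast
  then have "eventually (\<lambda>k. y (r (q k)) < d) sequentially"
    using d(1) by (auto simp: order_tendsto_iff)
  then show False using r(2) by auto
qed

text \<open>Diagonal extraction, in the form of sequential compactness of a countable power of the unit
  interval. It serves twice: to extract the stably convergent subsequence, and to see that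
  decreasing nonempty clopen subsets of the Cantor space have a common point.\<close>

lemma bounded_family_convergent_subsequence:
  fixes Y :: "nat \<Rightarrow> 'j::countable \<Rightarrow> real"
  assumes Y: "\<And>n j. Y n j \<in> {0..1}"
  obtains r l where "strict_mono r" "\<And>j. (\<lambda>k. Y (r k) j) \<longlonglongrightarrow> l j"
proof -
  have "compactin (product_topology (\<lambda>_::'j. euclidean) UNIV) (PiE UNIV (\<lambda>_. {0..1::real}))"
    by (subst compactin_PiE) simp
  then have "compact (PiE UNIV (\<lambda>_::'j. {0..1::real}))"
    by (metis compactin_euclidean_iff euclidean_product_topology)
  then have "seq_compact (PiE UNIV (\<lambda>_::'j. {0..1::real}))"
    by (rule compact_imp_seq_compact)
  then obtain l r where "strict_mono r" "(Y \<circ> r) \<longlonglongrightarrow> l"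
    using Y by (metis (no_types, lifting) PiE_UNIV_domain Pi_I seq_compact_def)
  moreover from this(2) have "(\<lambda>k. Y (r k) j) \<longlonglongrightarrow> l j" for j
    using continuous_on_tendsto_compose[OF continuous_on_product_coordinates, of "Y \<circ> r" l sequentially j]
    by (simp add: comp_def)
  ultimately show ?thesis using that by blast
qed

text \<open>Counting the levels of an equidistant grid below \<open>y\<close> recovers \<open>y\<close> up to the mesh. Summing over
  levels thus expresses integrals by measures of superlevel sets, uniformly in the measure.\<close>

lemma level_count_approx:
  fixes y B :: real
  assumes y: "\<bar>y\<bar> \<le> B" and B: "B > 0" and K: "K > (0::nat)"
  defines "d \<equiv> 2 * B / K"
  shows "\<bar>y - (- B + d * (\<Sum>j<K. if y > - B + real j * d then 1 else 0))\<bar> \<le> d"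
proof -
  have d: "d > 0" using B K by (simp add: d_def)
  define u where "u = (y + B) / d"
  have "0 \<le> y + B" "y + B \<le> K * d" using y B K by (auto simp: d_def abs_le_iff)
  then have u: "0 \<le> u" "u \<le> K" using d by (auto simp: u_def divide_le_eq)
  have lev: "y > - B + real j * d \<longleftrightarrow> real j < u" for j :: nat
    using d by (auto simp: u_def field_simps)
  have "{j\<in>{..<K}. real j < u} = {..<nat \<lceil>u\<rceil>}"
  proof (intro set_eqI)
    fix j
    have "real j < u \<longleftrightarrow> j < nat \<lceil>u\<rceil>" using u by linarith
    moreover have "nat \<lceil>u\<rceil> \<le> K" using u by linarith
    ultimately show "j \<in> {j\<in>{..<K}. real j < u} \<longleftrightarrow> j \<in> {..<nat \<lceil>u\<rceil>}" by auto
  qed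
  then have "(\<Sum>j<K. if y > - B + real j * d then 1 else 0 :: real) = real (nat \<lceil>u\<rceil>)"
    unfolding lev by (subst sum.inter_filter[symmetric]) simp_all
  moreover have "\<bar>u - real (nat \<lceil>u\<rceil>)\<bar> \<le> 1" using u by linarith
  moreover have "y = - B + d * u" using d by (simp add: u_def)
  then have "y - (- B + d * real (nat \<lceil>u\<rceil>)) = d * (u - real (nat \<lceil>u\<rceil>))" by (simp add: algebra_simps)
  ultimately show ?thesis using d by (simp add: abs_mult)
qed

lemma integral_level_approx:
  assumes N: "finite_measure N" and g[measurable]: "g \<in> borel_measurable N"
    and gB: "\<And>y. y \<in> space N \<Longrightarrow> \<bar>g y\<bar> \<le> B" and B: "B > 0" and K: "K > (0::nat)"
  defines "d \<equiv> 2 * B / K"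
  shows "\<bar>(\<integral>y. g y \<partial>N) - (- B * measure N (space N) + d * (\<Sum>j<K. measure N {y\<in>space N. g y > - B + real j * d}))\<bar>
     \<le> d * measure N (space N)"
proof -
  interpret finite_measure N by fact
  define s where "s y = - B + d * (\<Sum>j<K. indicator {y\<in>space N. g y > - B + real j * d} y)" for y
  have [measurable]: "s \<in> borel_measurable N" unfolding s_def by measurable
  have gs: "\<bar>g y - s y\<bar> \<le> d" if "y \<in> space N" for y
  proof -
    have "indicator {y\<in>space N. g y > - B + real j * d} y = (if g y > - B + real j * d then 1 else 0 :: real)" for j
      using that by simp
    then show ?thesis
      unfolding s_def using level_count_approx[OF gB[OF that] B K] by (simp only: d_def)
  qed
  have ig: "integrable N g" using gB by (intro integrable_const_bound[where B = B]) auto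
  have is': "integrable N (\<lambda>y. indicator {y\<in>space N. g y > - B + real j * d} y :: real)" for j :: nat
    by (intro integrable_const_bound[where B = 1]) (auto simp: indicator_def)
  have iss: "integrable N s" unfolding s_def using is' by auto
  have "(\<integral>y. s y \<partial>N) = - B * measure N (space N) + d * (\<Sum>j<K. measure N {y\<in>space N. g y > - B + real j * d})"
    unfolding s_def using is' by (simp add: Collect_conj_eq Int_absorb1)
  moreover have "\<bar>(\<integral>y. g y \<partial>N) - (\<integral>y. s y \<partial>N)\<bar> \<le> (\<integral>y. \<bar>g y - s y\<bar> \<partial>N)"
    using ig iss integral_norm_bound[of N "\<lambda>y. g y - s y"] by simp
  moreover have "\<dots> \<le> (\<integral>y. d \<partial>N)"
    using gs ig iss by (intro integral_mono) auto
  ultimately show ?thesis by (simp add: mult.commute)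
qed

text \<open>This is the layer-cake formula with a finite grid of levels. The measures may live on different
  spaces: on one side the sample space, on the other side the limit space.\<close>

lemma tendsto_integral_of_levels:
  fixes g :: "nat \<Rightarrow> 'b \<Rightarrow> real" and h :: "'c \<Rightarrow> real"
  assumes N: "\<And>k. finite_measure (N k)" "\<And>k. measure (N k) (space (N k)) \<le> 1"
    and L: "finite_measure L" "measure L (space L) \<le> 1"
    and g: "\<And>k. g k \<in> borel_measurable (N k)" "\<And>k y. y \<in> space (N k) \<Longrightarrow> \<bar>g k y\<bar> \<le> B"
    and h: "h \<in> borel_measurable L" "\<And>y. y \<in> space L \<Longrightarrow> \<bar>h y\<bar> \<le> B"
    and lev: "\<And>r. (\<lambda>k. measure (N k) {y\<in>space (N k). g k y > r}) \<longlonglongrightarrow> measure L {y\<in>space L. h y > r}"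
  shows "(\<lambda>k. \<integral>y. g k y \<partial>N k) \<longlonglongrightarrow> (\<integral>y. h y \<partial>L)"
proof (rule tendsto_by_approximation)
  fix e :: real assume e: "e > 0"
  define B' where "B' = max B 1"
  have B': "B' > 0" "\<And>k y. y \<in> space (N k) \<Longrightarrow> \<bar>g k y\<bar> \<le> B'" "\<And>y. y \<in> space L \<Longrightarrow> \<bar>h y\<bar> \<le> B'"
    using g(2) h(2) by (auto simp: B'_def le_max_iff_disj)
  \<comment> \<open>A level below the range of the functions yields convergence of the total masses.\<close>
  have "{y\<in>space (N k). g k y > - B' - 1} = space (N k)" for k using B'(2)[of _ k] by force
  moreover have "{y\<in>space L. h y > - B' - 1} = space L" using B'(3) by force
  ultimately have mass: "(\<lambda>k. measure (N k) (space (N k))) \<longlonglongrightarrow> measure L (space L)"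
    using lev[of "- B' - 1"] by simp
  obtain K :: nat where K: "2 * B' / e < K" using reals_Archimedean2 by blast
  have "0 < 2 * B' / e" using B' e by simp
  then have K0: "K > 0" using K by linarith
  define d where "d = 2 * B' / K"
  have d: "d \<le> e" "d \<ge> 0" using K K0 e B'(1) by (auto simp: d_def field_simps)
  define Sk where "Sk k = - B' * measure (N k) (space (N k)) + d * (\<Sum>j<K. measure (N k) {y\<in>space (N k). g k y > - B' + real j * d})" for k
  define Sl where "Sl = - B' * measure L (space L) + d * (\<Sum>j<K. measure L {y\<in>space L. h y > - B' + real j * d})"
  have "Sk \<longlonglongrightarrow> Sl" unfolding Sk_def Sl_def by (intro tendsto_intros mass lev)
  moreover have "\<bar>(\<integral>y. g k y \<partial>N k) - Sk k\<bar> \<le> e" for k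
  proof -
    have "\<bar>(\<integral>y. g k y \<partial>N k) - Sk k\<bar> \<le> d * measure (N k) (space (N k))"
      unfolding Sk_def d_def by (rule integral_level_approx[OF N(1) g(1) B'(2) B'(1) K0])
    also have "\<dots> \<le> d * 1" using d N(2) by (intro mult_left_mono)
    finally show ?thesis using d by simp
  qed
  moreover have "\<bar>(\<integral>y. h y \<partial>L) - Sl\<bar> \<le> e"
  proof -
    have "\<bar>(\<integral>y. h y \<partial>L) - Sl\<bar> \<le> d * measure L (space L)"
      unfolding Sl_def d_def by (rule integral_level_approx[OF L(1) h(1) B'(3) B'(1) K0])
    also have "\<dots> \<le> d * 1" using d L(2) by (intro mult_left_mono)
    finally show ?thesis using d by simp
  qed
  ultimately show "\<exists>y l. y \<longlonglongrightarrow> l \<and> (\<forall>k. \<bar>(\<integral>y. g k y \<partial>N k) - y k\<bar> \<le> e) \<and> \<bar>(\<integral>y. h y \<partial>L) - l\<bar> \<le> e"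
    by blast
qed

lemma (in prob_space) integral_AE_close:
  fixes f g :: "'a \<Rightarrow> real"
  assumes m: "f \<in> borel_measurable M" "g \<in> borel_measurable M"
    and b: "AE x in M. \<bar>f x\<bar> \<le> B" "AE x in M. \<bar>g x\<bar> \<le> B"
    and e: "AE x in M. \<bar>f x - g x\<bar> \<le> e"
  shows "\<bar>(\<integral>x. f x \<partial>M) - (\<integral>x. g x \<partial>M)\<bar> \<le> e"
proof -
  have i: "integrable M f" "integrable M g"
    by (rule integrable_const_bound[where B = B]; use m b in simp)+
  have "\<bar>(\<integral>x. f x \<partial>M) - (\<integral>x. g x \<partial>M)\<bar> \<le> (\<integral>x. \<bar>f x - g x\<bar> \<partial>M)"
    using i integral_norm_bound[of M "\<lambda>x. f x - g x"] by simp
  also have "\<dots> \<le> (\<integral>x. e \<partial>M)" using i e by (intro integral_mono_AE) auto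
  finally show ?thesis by (simp add: prob_space)
qed

lemma (in prob_space) integrable_weighted:
  fixes g h :: "'a \<Rightarrow> real"
  assumes "g \<in> borel_measurable M" "h \<in> borel_measurable M"
    and g: "\<And>x. \<bar>g x\<bar> \<le> 1" and h: "\<And>x. x \<in> space M \<Longrightarrow> \<bar>h x\<bar> \<le> K"
  shows "integrable M (\<lambda>x. g x * h x)"
proof (rule integrable_const_bound[where B = K])
  show "AE x in M. norm (g x * h x) \<le> K"
    using mult_mono[OF g h] by (intro AE_I2) (simp add: abs_mult)
qed (use assms in simp)

section \<open>Stable convergence along a subsequence\<close>

text \<open>Convergence of \<open>P (A \<inter> E)\<close> on the countable \<open>\<pi>\<close>-system generated by the events \<open>E\<close> follows from
  diagonal extraction; it extends to the generated \<open>\<sigma>\<close>-algebra by a Dynkin argument, since the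
  tail of a disjoint union is small uniformly in \<open>k\<close>. An arbitrary event \<open>A\<close> enters only through its
  conditional probability given that \<open>\<sigma>\<close>-algebra, which is a uniform limit of step functions.\<close>

lemma stable_convergent_subsequence:
  fixes E :: "'j::countable \<Rightarrow> nat \<Rightarrow> 'a set"
  assumes "prob_space M" and E: "\<And>j n. E j n \<in> sets M"
  obtains r :: "nat \<Rightarrow> nat" where "strict_mono r"
    "\<And>j A. A \<in> sets M \<Longrightarrow> convergent (\<lambda>k. measure M (A \<inter> E j (r k)))"
proof -
  interpret prob_space M by fact
  define G where "G xs = space M \<inter> (\<Inter>(j, n)\<in>set xs. E j n)" for xs :: "('j \<times> nat) list"
  have G_eq: "G xs = space M \<inter> (\<Inter>z\<in>set xs. E (fst z) (snd z))" for xs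
    by (auto simp: G_def case_prod_unfold)
  have G: "G xs \<in> sets M" for xs
  proof -
    have "G xs = {w \<in> space M. \<forall>z\<in>set xs. w \<in> E (fst z) (snd z)}" by (auto simp: G_eq)
    moreover have "{w \<in> space M. w \<in> E j n} \<in> sets M" for j n
      using sets.sets_into_space[OF E[of j n]] E[of j n] by (simp add: Collect_conj_eq Int_absorb1)
    then have "{w \<in> space M. \<forall>z\<in>set xs. w \<in> E (fst z) (snd z)} \<in> sets M"
      by (intro sets.sets_Collect_finite_All) simp_all
    ultimately show ?thesis by simp
  qed
  obtain r l where r: "strict_mono r"
    and l: "\<And>z. (\<lambda>k. (\<lambda>(xs, j). prob (G xs \<inter> E j (r k))) z) \<longlonglongrightarrow> (l z :: real)"
    using bounded_family_convergent_subsequence[of "\<lambda>n (xs, j). prob (G xs \<inter> E j n)"]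
    by (auto simp: case_prod_unfold)
  define \<A> where "\<A> = sigma (space M) (range G)"
  have setsA: "sets \<A> = sigma_sets (space M) (range G)" and spA: "space \<A> = space M"
    unfolding \<A>_def using G sets.sets_into_space by (auto intro!: sets_measure_of space_measure_of)
  have subA: "subalgebra M \<A>"
    unfolding subalgebra_def setsA spA using G by (auto intro!: sets.sigma_sets_subset)
  have stable: "Int_stable (range G)"
  proof (rule Int_stableI_image)
    fix xs ys :: "('j \<times> nat) list"
    have "G xs \<inter> G ys = G (xs @ ys)" by (auto simp: G_eq)
    then show "\<exists>zs\<in>UNIV. G xs \<inter> G ys = G zs" by blast
  qed
  have GP: "range G \<subseteq> Pow (space M)" using G sets.sets_into_space by blast
  have conv1: "convergent (\<lambda>k. prob (A \<inter> E j (r k)))" if "A \<in> sets \<A>" for A j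
    using stable GP that[unfolded setsA]
  proof (induction rule: sigma_sets_induct_disjoint)
    case (basic A)
    then obtain xs where "A = G xs" by auto
    then show ?case using l[of "(xs, j)"] by (auto intro: convergentI)
  next
    case empty
    then show ?case by (simp add: convergent_const)
  next
    case (compl A)
    have A: "A \<in> sets M" using compl(1) subA by (auto simp: subalgebra_def setsA)
    have sp: "G [] = space M" by (simp add: G_eq)
    have "prob ((space M - A) \<inter> E j (r k)) = prob (G [] \<inter> E j (r k)) - prob (A \<inter> E j (r k))" for k
    proof -
      have "(space M - A) \<inter> E j (r k) = (G [] \<inter> E j (r k)) - (A \<inter> E j (r k))" by (auto simp: sp)
      also have "prob \<dots> = prob (G [] \<inter> E j (r k)) - prob (A \<inter> E j (r k))"
      proof (rule finite_measure_Diff)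
        show "G [] \<inter> E j (r k) \<in> events" "A \<inter> E j (r k) \<in> events" using A E G by auto
        show "A \<inter> E j (r k) \<subseteq> G [] \<inter> E j (r k)" using sets.sets_into_space[OF A] sp by blast
      qed
      finally show ?thesis .
    qed
    then show ?case
      using compl(2) l[of "([], j)"] by (simp add: convergent_diff convergentI)
  next
    case (union A)
    have A: "A i \<in> sets M" for i using union(2) subA by (auto simp: subalgebra_def setsA)
    show ?case
    proof (rule convergent_by_approximation)
      fix e :: real assume e: "e > 0"
      have "(\<lambda>n. prob (\<Union>i<n. A i)) \<longlonglongrightarrow> prob (\<Union>n. \<Union>i<n. A i)"
      proof (rule finite_Lim_measure_incseq)
        show "incseq (\<lambda>n. \<Union>i<n. A i)" unfolding incseq_def by (intro allI impI UN_mono) auto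
      qed (use A in auto)
      moreover have "(\<Union>n. \<Union>i<n. A i) = (\<Union>i. A i)" by auto
      ultimately have "(\<lambda>n. prob (\<Union>i<n. A i)) \<longlonglongrightarrow> prob (\<Union>i. A i)" by simp
      from LIMSEQ_D[OF this e] obtain n where "norm (prob (\<Union>i<n. A i) - prob (\<Union>i. A i)) < e"
        by blast
      then have n: "\<bar>prob (\<Union>i<n. A i) - prob (\<Union>i. A i)\<bar> < e" by simp
      define y where "y k = prob ((\<Union>i<n. A i) \<inter> E j (r k))" for k
      have "y k = (\<Sum>i<n. prob (A i \<inter> E j (r k)))" for k
      proof -
        have "(\<Union>i<n. A i) \<inter> E j (r k) = (\<Union>i\<in>{..<n}. A i \<inter> E j (r k))" by auto
        moreover have "prob (\<Union>i\<in>{..<n}. A i \<inter> E j (r k)) = (\<Sum>i<n. prob (A i \<inter> E j (r k)))"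
        proof (rule finite_measure_finite_Union)
          have "A i \<inter> A i' = {}" if "i \<noteq> i'" for i i'
            using union(1) that by (simp add: disjoint_family_on_def)
          then show "disjoint_family_on (\<lambda>i. A i \<inter> E j (r k)) {..<n}"
            unfolding disjoint_family_on_def by blast
          show "(\<lambda>i. A i \<inter> E j (r k)) ` {..<n} \<subseteq> events" using A E by blast
        qed simp
        ultimately show ?thesis unfolding y_def by simp
      qed
      then have "y = (\<lambda>k. \<Sum>i<n. prob (A i \<inter> E j (r k)))" by blast
      moreover have "convergent (\<lambda>k. \<Sum>i<n. prob (A i \<inter> E j (r k)))"
        by (intro convergent_sum union(3))
      ultimately have "convergent y" by simp
      moreover have "\<bar>prob ((\<Union>i. A i) \<inter> E j (r k)) - y k\<bar> \<le> e" for k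
      proof -
        have "prob ((\<Union>i. A i) \<inter> E j (r k)) - y k = prob (((\<Union>i. A i) \<inter> E j (r k)) - ((\<Union>i<n. A i) \<inter> E j (r k)))"
          unfolding y_def by (rule finite_measure_Diff[symmetric]) (use A E in auto)
        moreover have "prob (((\<Union>i. A i) \<inter> E j (r k)) - ((\<Union>i<n. A i) \<inter> E j (r k))) \<le> prob ((\<Union>i. A i) - (\<Union>i<n. A i))"
          by (rule finite_measure_mono) (use A in auto)
        moreover have "prob ((\<Union>i. A i) - (\<Union>i<n. A i)) = prob (\<Union>i. A i) - prob (\<Union>i<n. A i)"
          by (rule finite_measure_Diff) (use A in auto)
        ultimately show ?thesis using n measure_nonneg[of M "((\<Union>i. A i) \<inter> E j (r k)) - ((\<Union>i<n. A i) \<inter> E j (r k))"]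
          by linarith
      qed
      ultimately show "\<exists>y. convergent y \<and> (\<forall>k. \<bar>prob (\<Union> (range A) \<inter> E j (r k)) - y k\<bar> \<le> e)" by blast
    qed
  qed
  interpret sub: finite_measure_subalgebra M \<A> by unfold_locales (rule subA)
  have conv: "convergent (\<lambda>k. prob (A \<inter> E j (r k)))" if A: "A \<in> sets M" for A j
  proof -
    define g where "g = real_cond_exp M \<A> (indicator A)"
    have gm[measurable]: "g \<in> borel_measurable \<A>" unfolding g_def by simp
    \<comment> \<open>Truncation turns the almost sure bounds of the conditional probability into pointwise ones.\<close>
    define g' where "g' w = max 0 (min 1 (g w))" for w
    have g'm[measurable]: "g' \<in> borel_measurable \<A>" unfolding g'_def by measurable
    note g'M[measurable] = measurable_from_subalg[OF subA g'm]
    have intA: "integrable M (indicator A :: 'a \<Rightarrow> real)"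
      using A by (intro integrable_const_bound[where B = 1]) auto
    have "AE w in M. g w \<ge> 0" unfolding g_def
      by (rule sub.real_cond_exp_pos) (use A in auto)
    moreover have "AE w in M. g w \<le> 1" unfolding g_def
      by (rule sub.real_cond_exp_le_c[OF intA]) (auto simp: indicator_def)
    ultimately have gg': "AE w in M. g w = g' w" by eventually_elim (auto simp: g'_def)
    have EA: "E j n \<in> sets \<A>" for j n
    proof -
      have "E j n = G [(j, n)]" using sets.sets_into_space[OF E] by (auto simp: G_eq)
      then show ?thesis unfolding setsA by auto
    qed
    have eq: "prob (A \<inter> E j (r k)) = (\<integral>w. indicator (E j (r k)) w * g' w \<partial>M)" for k
    proof -
      have "prob (A \<inter> E j (r k)) = (\<integral>w\<in>E j (r k). indicator A w \<partial>M)"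
        using A E by (simp add: set_lebesgue_integral_def indicator_inter_arith[symmetric] Int_commute)
      also have "\<dots> = (\<integral>w\<in>E j (r k). g w \<partial>M)" unfolding g_def by (rule sub.real_cond_exp_intA[OF intA EA])
      also have "\<dots> = (\<integral>w. indicator (E j (r k)) w * g' w \<partial>M)"
        unfolding set_lebesgue_integral_def real_scaleR_def
      proof (rule integral_cong_AE)
        show "(\<lambda>w. indicator (E j (r k)) w * g w) \<in> borel_measurable M"
          using E[of j "r k"] measurable_from_subalg[OF subA gm] by measurable
        show "(\<lambda>w. indicator (E j (r k)) w * g' w) \<in> borel_measurable M"
          using E[of j "r k"] by measurable
      qed (use gg' in auto)
      finally show ?thesis .
    qed
    show ?thesis
    proof (rule convergent_by_approximation)
      fix e :: real assume e: "e > 0"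
      obtain K :: nat where K: "2 / e < K" using reals_Archimedean2 by blast
      have "0 < 2 / e" using e by simp
      then have K0: "K > 0" using K by linarith
      define d where "d = 2 * (1::real) / K"
      have d: "d \<le> e" "d \<ge> 0" using K K0 e by (auto simp: d_def field_simps)
      define f where "f k w = indicator (E j (r k)) w * g' w" for k w
      have f01: "0 \<le> f k w" "f k w \<le> 1" for k w by (auto simp: f_def g'_def indicator_def)
      have fm: "f k \<in> borel_measurable M" for k
        unfolding f_def using E[of j "r k"] by measurable
      define y where "y k = - 1 * prob (space M) + d * (\<Sum>i<K. prob {w\<in>space M. f k w > - 1 + real i * d})" for k
      have "\<bar>prob (A \<inter> E j (r k)) - y k\<bar> \<le> e" for k
      proof -
        have "\<bar>(\<integral>w. f k w \<partial>M) - y k\<bar> \<le> d * prob (space M)"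
          unfolding y_def d_def
          by (rule integral_level_approx[OF finite_measure_axioms fm _ _ K0])
            (use f01 in \<open>auto simp: abs_le_iff intro: order_trans[of _ 0]\<close>)
        then show ?thesis using d prob_space unfolding eq f_def by simp
      qed
      moreover have "convergent (\<lambda>k. prob {w\<in>space M. f k w > c})" for c
      proof (cases "c \<ge> 0")
        case True
        have "{w\<in>space M. f k w > c} = {w\<in>space M. g' w > c} \<inter> E j (r k)" for k
          using True by (auto simp: f_def indicator_def split: if_splits)
        moreover have "{w\<in>space M. g' w > c} \<in> sets \<A>"
          using measurable_sets[OF g'm, of "{c<..}"] spA by (simp add: vimage_def Int_def conj_commute)
        ultimately show ?thesis using conv1 by simp
      next
        case False
        then have "{w\<in>space M. f k w > c} = space M" for k
          using f01(1) by (auto intro: less_le_trans[of c 0])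
        then show ?thesis by (simp add: convergent_const)
      qed
      then have "convergent y"
        unfolding y_def[abs_def] by (intro convergent_add convergent_mult convergent_sum convergent_const)
      ultimately show "\<exists>y. convergent y \<and> (\<forall>k. \<bar>prob (A \<inter> E j (r k)) - y k\<bar> \<le> e)"
        by blast
    qed
  qed
  show ?thesis using that r conv by blast
qed

section \<open>The limit measure on a product with the Cantor space\<close>

definition depends_only_on :: "'i set \<Rightarrow> ('a \<times> ('i \<Rightarrow> bool)) set \<Rightarrow> bool" where
  "depends_only_on J D \<longleftrightarrow> (\<forall>w c c'. (\<forall>i\<in>J. c i = c' i) \<longrightarrow> (w, c) \<in> D \<longrightarrow> (w, c') \<in> D)"

lemma depends_only_onI:
  assumes "\<And>w c c'. (\<And>i. i \<in> J \<Longrightarrow> c i = c' i) \<Longrightarrow> (w, c) \<in> D \<Longrightarrow> (w, c') \<in> D"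
  shows "depends_only_on J D"
  unfolding depends_only_on_def by (intro allI impI) (rule assms, auto)

lemma depends_only_onD:
  assumes "depends_only_on J D" "\<And>i. i \<in> J \<Longrightarrow> c i = c' i" "(w, c) \<in> D"
  shows "(w, c') \<in> D"
  by (rule assms(1)[unfolded depends_only_on_def, THEN spec, THEN spec, THEN spec, THEN mp, THEN mp])
    (use assms(2,3) in auto)

lemma depends_only_on_iff:
  assumes "depends_only_on J D" "\<And>i. i \<in> J \<Longrightarrow> c i = c' i"
  shows "(w, c) \<in> D \<longleftrightarrow> (w, c') \<in> D"
  using depends_only_onD[OF assms(1), of c c' w] depends_only_onD[OF assms(1), of c' c w] assms(2)
  by auto

definition cylinder_algebra :: "'a measure \<Rightarrow> ('a \<times> ('i \<Rightarrow> bool)) set set" where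
  "cylinder_algebra M = {D. D \<subseteq> space M \<times> UNIV \<and> (\<forall>c. {w. (w, c) \<in> D} \<in> sets M) \<and>
     (\<exists>J. finite J \<and> depends_only_on J D)}"

lemma cylinder_algebraI:
  assumes "D \<subseteq> space M \<times> UNIV" "\<And>c. {w. (w, c) \<in> D} \<in> sets M" "finite J" "depends_only_on J D"
  shows "D \<in> cylinder_algebra M"
  using assms unfolding cylinder_algebra_def by auto

lemma cylinder_algebraE:
  assumes "D \<in> cylinder_algebra M"
  obtains J where "D \<subseteq> space M \<times> UNIV" "\<forall>c. {w. (w, c) \<in> D} \<in> sets M" "finite J" "depends_only_on J D"
  using assms unfolding cylinder_algebra_def by auto

lemma cylinder_algebra_algebra: "algebra (space M \<times> UNIV) (cylinder_algebra M)"
  unfolding algebra_iff_Un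
proof (intro conjI ballI)
  show "cylinder_algebra M \<subseteq> Pow (space M \<times> UNIV)" by (auto simp: cylinder_algebra_def)
  show "{} \<in> cylinder_algebra M" by (auto simp: cylinder_algebra_def depends_only_on_def)
next
  fix D :: "('a \<times> ('b \<Rightarrow> bool)) set" assume "D \<in> cylinder_algebra M"
  then obtain J where J: "D \<subseteq> space M \<times> UNIV" "\<forall>c. {w. (w, c) \<in> D} \<in> sets M" "finite J"
    "depends_only_on J D" by (rule cylinder_algebraE)
  show "space M \<times> UNIV - D \<in> cylinder_algebra M"
  proof (rule cylinder_algebraI[OF _ _ J(3)])
    fix c
    have "{w. (w, c) \<in> space M \<times> UNIV - D} = space M - {w. (w, c) \<in> D}" by auto
    then show "{w. (w, c) \<in> space M \<times> UNIV - D} \<in> sets M" using J(2) by simp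
  next
    show "depends_only_on J (space M \<times> UNIV - D)"
    proof (rule depends_only_onI)
      fix w and c c' :: "'b \<Rightarrow> bool" assume "\<And>i. i \<in> J \<Longrightarrow> c i = c' i" "(w, c) \<in> space M \<times> UNIV - D"
      then show "(w, c') \<in> space M \<times> UNIV - D" using depends_only_on_iff[OF J(4), of c c' w] by simp
    qed
  qed auto
next
  fix D D' :: "('a \<times> ('b \<Rightarrow> bool)) set" assume D: "D \<in> cylinder_algebra M" "D' \<in> cylinder_algebra M"
  from D(1) obtain J where J: "D \<subseteq> space M \<times> UNIV" "\<forall>c. {w. (w, c) \<in> D} \<in> sets M" "finite J"
    "depends_only_on J D" by (rule cylinder_algebraE)
  from D(2) obtain J' where J': "D' \<subseteq> space M \<times> UNIV" "\<forall>c. {w. (w, c) \<in> D'} \<in> sets M" "finite J'"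
    "depends_only_on J' D'" by (rule cylinder_algebraE)
  show "D \<union> D' \<in> cylinder_algebra M"
  proof (rule cylinder_algebraI[where J = "J \<union> J'"])
    fix c
    have "{w. (w, c) \<in> D \<union> D'} = {w. (w, c) \<in> D} \<union> {w. (w, c) \<in> D'}" by auto
    then show "{w. (w, c) \<in> D \<union> D'} \<in> sets M" using J(2) J'(2) by simp
  next
    show "depends_only_on (J \<union> J') (D \<union> D')"
    proof (rule depends_only_onI)
      fix w and c c' :: "'b \<Rightarrow> bool" assume "\<And>i. i \<in> J \<union> J' \<Longrightarrow> c i = c' i" "(w, c) \<in> D \<union> D'"
      then show "(w, c') \<in> D \<union> D'"
        using depends_only_on_iff[OF J(4), of c c' w] depends_only_on_iff[OF J'(4), of c c' w] by simp
    qed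
  qed (use J J' in auto)
qed

lemma pattern_sets:
  assumes Y: "\<And>i. {w\<in>space M. Y w i} \<in> sets M" and J: "finite J"
  shows "{w\<in>space M. \<forall>i\<in>J. Y w i \<longleftrightarrow> i \<in> S} \<in> sets M"
proof -
  have "{w\<in>space M. Y w i \<longleftrightarrow> i \<in> S} \<in> sets M" for i
  proof (cases "i \<in> S")
    case True
    then show ?thesis using Y[of i] by simp
  next
    case False
    then show ?thesis using sets.sets_Collect_neg[OF Y[of i]] by simp
  qed
  then show ?thesis using J by (intro sets.sets_Collect_finite_All)
qed

text \<open>A set that looks only at the coordinates in \<open>J\<close> splits according to the finitely many patterns
  on \<open>J\<close>. This reduces the convergence on general cylinders to that on events \<open>A \<inter> {pattern}\<close>.\<close>

lemma cylinder_pullback: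
  fixes Y :: "'a \<Rightarrow> 'i \<Rightarrow> bool"
  assumes "finite_measure M" and Y: "\<And>i. {w\<in>space M. Y w i} \<in> sets M"
    and D: "D \<subseteq> space M \<times> UNIV" "\<forall>c. {w. (w, c) \<in> D} \<in> sets M" and J: "finite J"
      "depends_only_on J D"
  shows "{w\<in>space M. (w, Y w) \<in> D} \<in> sets M"
    and "measure M {w\<in>space M. (w, Y w) \<in> D} =
      (\<Sum>S\<in>Pow J. measure M ({w. (w, \<lambda>i. i \<in> S) \<in> D} \<inter> {w\<in>space M. \<forall>i\<in>J. Y w i \<longleftrightarrow> i \<in> S}))"
proof -
  interpret finite_measure M by fact
  let ?B = "\<lambda>S. {w. (w, \<lambda>i. i \<in> S) \<in> D} \<inter> {w\<in>space M. \<forall>i\<in>J. Y w i \<longleftrightarrow> i \<in> S}"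
  have Bm: "?B S \<in> sets M" for S
    using pattern_sets[OF Y J(1), where S = S] D(2) by (intro sets.Int) simp_all
  have eq: "{w\<in>space M. (w, Y w) \<in> D} = (\<Union>S\<in>Pow J. ?B S)"
  proof -
    have *: "(w, Y w) \<in> D \<longleftrightarrow> (w, \<lambda>i. i \<in> S) \<in> D" if "\<forall>i\<in>J. Y w i \<longleftrightarrow> i \<in> S" for w S
      by (rule depends_only_on_iff[OF J(2)]) (use that in simp)
    show ?thesis
    proof (intro set_eqI iffI)
      fix w assume w: "w \<in> {w\<in>space M. (w, Y w) \<in> D}"
      then have "w \<in> ?B {i\<in>J. Y w i}" using *[of w "{i\<in>J. Y w i}"] by simp
      then show "w \<in> (\<Union>S\<in>Pow J. ?B S)" by (intro UN_I[of "{i\<in>J. Y w i}"]) auto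
    next
      fix w assume "w \<in> (\<Union>S\<in>Pow J. ?B S)"
      then obtain S where "w \<in> ?B S" by (rule UN_E)
      then show "w \<in> {w\<in>space M. (w, Y w) \<in> D}" using *[of w S] by simp
    qed
  qed
  show "{w\<in>space M. (w, Y w) \<in> D} \<in> sets M"
    unfolding eq using Bm J(1) by (intro sets.finite_UN) auto
  show "measure M {w\<in>space M. (w, Y w) \<in> D} = (\<Sum>S\<in>Pow J. measure M (?B S))"
    unfolding eq
  proof (rule finite_measure_finite_Union)
    show "disjoint_family_on ?B (Pow J)" unfolding disjoint_family_on_def by blast
  qed (use Bm J(1) in auto)
qed

lemma cylinder_pullback_sets:
  fixes Y :: "'a \<Rightarrow> 'i \<Rightarrow> bool"
  assumes "finite_measure M" "\<And>i. {w\<in>space M. Y w i} \<in> sets M" "D \<in> cylinder_algebra M"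
  shows "{w\<in>space M. (w, Y w) \<in> D} \<in> sets M"
proof -
  obtain J where J: "D \<subseteq> space M \<times> UNIV" "\<forall>c. {w. (w, c) \<in> D} \<in> sets M" "finite J"
    "depends_only_on J D" by (rule cylinder_algebraE[OF assms(3)])
  show ?thesis by (rule cylinder_pullback(1)[OF assms(1,2) J])
qed

text \<open>The section of a cylinder over a fixed sample point is clopen in a compact space, so a decreasing
  sequence of cylinders with empty intersection has eventually empty sections over every point.
  Its projections therefore decrease to the empty set, and there the original measure is already
  known to be continuous.\<close>

lemma decreasing_cylinder_projections:
  fixes A :: "nat \<Rightarrow> ('a \<times> ('i::countable \<Rightarrow> bool)) set"
  assumes M: "prob_space M" and A: "range A \<subseteq> cylinder_algebra M" "decseq A" "(\<Inter>n. A n) = {}"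
  shows "\<And>n. fst ` A n \<in> sets M" "(\<lambda>n. measure M (fst ` A n)) \<longlonglongrightarrow> 0"
proof -
  interpret prob_space M by fact
  have "\<exists>J. (\<forall>c. {w. (w, c) \<in> A n} \<in> sets M) \<and> finite J \<and> depends_only_on J (A n)" for n
    using A(1) cylinder_algebraE[of "A n" M] by (metis image_subset_iff UNIV_I)
  then obtain J where J: "\<And>n c. {w. (w, c) \<in> A n} \<in> sets M" "\<And>n. finite (J n)"
      "\<And>n. depends_only_on (J n) (A n)"
    by metis
  show pm: "fst ` A n \<in> sets M" for n
  proof -
    have "fst ` A n = (\<Union>S\<in>Pow (J n). {w. (w, \<lambda>i. i \<in> S) \<in> A n})"
    proof (intro set_eqI iffI)
      fix w assume "w \<in> fst ` A n"
      then obtain c where "(w, c) \<in> A n" by auto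
      then have "(w, \<lambda>i. i \<in> {i\<in>J n. c i}) \<in> A n" by (rule depends_only_onD[OF J(3), rotated]) auto
      then show "w \<in> (\<Union>S\<in>Pow (J n). {w. (w, \<lambda>i. i \<in> S) \<in> A n})" by (intro UN_I[of "{i\<in>J n. c i}"]) auto
    qed force
    also have "\<dots> \<in> sets M" using J(1,2) by (intro sets.finite_UN) auto
    finally show ?thesis .
  qed
  have "(\<Inter>n. fst ` A n) = {}"
  proof (rule ccontr)
    assume "(\<Inter>n. fst ` A n) \<noteq> {}"
    then obtain w where "\<And>n. w \<in> fst ` A n" by blast
    then have "\<forall>n. \<exists>c. (w, c) \<in> A n" by force
    then obtain C where C: "\<And>n. (w, C n) \<in> A n" by metis
    obtain r l where r: "strict_mono r" and l: "\<And>i. (\<lambda>k. of_bool (C (r k) i)) \<longlonglongrightarrow> (l i :: real)"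
      using bounded_family_convergent_subsequence[of "\<lambda>n i. of_bool (C n i)"] by auto
    \<comment> \<open>The limits of 0-1 sequences are 0 or 1; the threshold reads them as booleans.\<close>
    define c where "c i \<longleftrightarrow> l i > 1 / 2" for i
    have ev: "eventually (\<lambda>k. C (r k) i = c i) sequentially" for i
    proof -
      have ev': "eventually (\<lambda>k. dist (of_bool (C (r k) i)) (l i) < 1 / 4) sequentially"
        by (rule tendstoD[OF l]) simp
      have "l i = 0 \<or> l i = 1"
        using Lim_in_closed_set[of "{0, 1::real}", OF _ _ _ l[of i]] by auto
      then have "C (r k) i = c i" if "dist (of_bool (C (r k) i)) (l i) < 1 / 4" for k
        using that by (cases "C (r k) i") (auto simp: c_def dist_real_def)
      with ev' show ?thesis by (rule eventually_mono)
    qed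
    have "(w, c) \<in> A n" for n
    proof -
      have "eventually (\<lambda>k. \<forall>i\<in>J n. C (r k) i = c i) sequentially"
        by (rule eventually_ball_finite) (use J(2) ev in auto)
      moreover have "eventually (\<lambda>k. r k \<ge> n) sequentially"
        using filterlim_subseq[OF r] by (auto simp: filterlim_at_top)
      ultimately obtain k where k: "\<forall>i\<in>J n. C (r k) i = c i" "r k \<ge> n"
        using eventually_happens[OF eventually_conj] by force
      have "(w, C (r k)) \<in> A n" using C[of "r k"] decseqD[OF A(2) k(2)] by blast
      then show ?thesis by (rule depends_only_onD[OF J(3), rotated]) (use k(1) in simp)
    qed
    then show False using A(3) by blast
  qed
  moreover have "decseq (\<lambda>n. fst ` A n)"
    using A(2) unfolding decseq_def by (intro allI impI image_mono) blast
  ultimately show "(\<lambda>n. measure M (fst ` A n)) \<longlonglongrightarrow> 0"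
    using finite_Lim_measure_decseq[of "\<lambda>n. fst ` A n"] pm by (auto simp: image_subset_iff)
qed

text \<open>The limit of \<open>P {(w, X w) \<in> D}\<close> is finitely additive in the cylinder \<open>D\<close> and bounded by the
  probability of the projection of \<open>D\<close>, hence continuous at the empty set, and Caratheodory's
  theorem applies.\<close>

lemma stable_limit_measure:
  fixes X :: "nat \<Rightarrow> 'a \<Rightarrow> 'i::countable \<Rightarrow> bool"
  assumes M: "prob_space M" and X: "\<And>n i. {w\<in>space M. X n w i} \<in> sets M"
  obtains r :: "nat \<Rightarrow> nat" and Q where "strict_mono r" "prob_space Q" "space Q = space M \<times> UNIV"
    "sets Q = sigma_sets (space M \<times> UNIV) (cylinder_algebra M)"
    "\<And>D. D \<in> cylinder_algebra M \<Longrightarrow> (\<lambda>k. measure M {w\<in>space M. (w, X (r k) w) \<in> D}) \<longlonglongrightarrow> measure Q D"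
proof -
  interpret prob_space M by fact
  define \<Omega> :: "('a \<times> ('i \<Rightarrow> bool)) set" where "\<Omega> = space M \<times> UNIV"
  \<comment> \<open>A pattern on finitely many coordinates is a pair of lists, which makes the family of patterns countable: the second list contains the coordinates inspected, the first one those required to be true.\<close>
  define E where "E z n = {w\<in>space M. \<forall>i\<in>set (snd z). X n w i \<longleftrightarrow> i \<in> set (fst z)}" for z :: "'i list \<times> 'i list" and n
  have E: "E z n \<in> sets M" for z n
    unfolding E_def by (rule pattern_sets[OF X]) simp
  obtain r :: "nat \<Rightarrow> nat" where r: "strict_mono r"
    and cv: "\<And>z A. A \<in> sets M \<Longrightarrow> convergent (\<lambda>k. prob (A \<inter> E z (r k)))"
    using stable_convergent_subsequence[where E = E, OF M E] by blast
  define R where "R k D = {w\<in>space M. (w, X (r k) w) \<in> D}" for k D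
  have R: "R k D \<in> sets M" if "D \<in> cylinder_algebra M" for k D
    unfolding R_def by (rule cylinder_pullback_sets[OF finite_measure_axioms X that])
  have conv: "convergent (\<lambda>k. prob (R k D))" if D: "D \<in> cylinder_algebra M" for D
  proof -
    obtain J where J: "D \<subseteq> space M \<times> UNIV" "\<forall>c. {w. (w, c) \<in> D} \<in> sets M" "finite J"
      "depends_only_on J D" by (rule cylinder_algebraE[OF D])
    have "convergent (\<lambda>k. prob ({w. (w, \<lambda>i. i \<in> S) \<in> D} \<inter> {w\<in>space M. \<forall>i\<in>J. X (r k) w i \<longleftrightarrow> i \<in> S}))"
      if "S \<in> Pow J" for S
    proof -
      have "finite S" using that J(3) finite_subset by auto
      then obtain xs ys where "S = set xs" "J = set ys" using J(3) finite_list by metis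
      then show ?thesis using cv[OF J(2)[THEN spec], of "\<lambda>i. i \<in> S" "(xs, ys)"] by (simp add: E_def)
    qed
    then show ?thesis
      unfolding R_def cylinder_pullback(2)[OF finite_measure_axioms X J]
      by (intro convergent_sum) auto
  qed
  define f where "f D = lim (\<lambda>k. prob (R k D))" for D
  have f: "(\<lambda>k. prob (R k D)) \<longlonglongrightarrow> f D" if "D \<in> cylinder_algebra M" for D
    unfolding f_def using conv[OF that] by (simp add: convergent_LIMSEQ_iff)
  have f0: "f D \<ge> 0" if "D \<in> cylinder_algebra M" for D
    by (rule LIMSEQ_le_const[OF f[OF that]]) auto
  interpret cyl: algebra \<Omega> "cylinder_algebra M" unfolding \<Omega>_def by (rule cylinder_algebra_algebra)
  have "\<exists>\<mu>. (\<forall>D\<in>cylinder_algebra M. \<mu> D = ennreal (f D)) \<and> measure_space \<Omega> (sigma_sets \<Omega> (cylinder_algebra M)) \<mu>"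
  proof (rule cyl.caratheodory_empty_continuous)
    have "f {} = 0" unfolding f_def R_def by simp
    then show "positive (cylinder_algebra M) (\<lambda>D. ennreal (f D))" by (simp add: positive_def)
    show "additive (cylinder_algebra M) (\<lambda>D. ennreal (f D))"
      unfolding additive_def
    proof (intro ballI impI)
      fix D D' :: "('a \<times> ('i \<Rightarrow> bool)) set"
      assume D: "D \<in> cylinder_algebra M" "D' \<in> cylinder_algebra M" "D \<inter> D' = {}"
      have "prob (R k (D \<union> D')) = prob (R k D) + prob (R k D')" for k
      proof -
        have "R k (D \<union> D') = R k D \<union> R k D'" "R k D \<inter> R k D' = {}" using D(3) by (auto simp: R_def)
        then show ?thesis using R[OF D(1)] R[OF D(2)] by (simp add: finite_measure_Union)
      qed
      then have "(\<lambda>k. prob (R k (D \<union> D'))) \<longlonglongrightarrow> f D + f D'"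
        using tendsto_add[OF f[OF D(1)] f[OF D(2)]] by simp
      then have "f (D \<union> D') = f D + f D'"
        using LIMSEQ_unique f[OF cyl.Un[OF D(1,2)]] by blast
      then show "ennreal (f (D \<union> D')) = ennreal (f D) + ennreal (f D')"
        using f0[OF D(1)] f0[OF D(2)] by simp
    qed
  next
    fix A :: "nat \<Rightarrow> ('a \<times> ('i \<Rightarrow> bool)) set"
    assume A: "range A \<subseteq> cylinder_algebra M" "decseq A" "(\<Inter>i. A i) = {}"
    have le: "f (A n) \<le> prob (fst ` A n)" for n
    proof (rule LIMSEQ_le_const2[OF f])
      have "prob (R k (A n)) \<le> prob (fst ` A n)" for k
        by (rule finite_measure_mono) (auto simp: R_def decreasing_cylinder_projections(1)[OF M A] intro: rev_image_eqI)
      then show "\<exists>N. \<forall>k\<ge>N. prob (R k (A n)) \<le> prob (fst ` A n)" by blast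
    qed (use A in auto)
    have "(\<lambda>n. f (A n)) \<longlonglongrightarrow> 0"
      by (rule tendsto_sandwich[OF _ _ tendsto_const decreasing_cylinder_projections(2)[OF M A]])
        (use le f0 A in \<open>auto simp: image_subset_iff\<close>)
    then show "(\<lambda>n. ennreal (f (A n))) \<longlonglongrightarrow> 0"
      by (metis ennreal_0 tendsto_ennrealI)
  qed auto
  then obtain \<mu> where \<mu>: "\<And>D. D \<in> cylinder_algebra M \<Longrightarrow> \<mu> D = ennreal (f D)"
    "measure_space \<Omega> (sigma_sets \<Omega> (cylinder_algebra M)) \<mu>" by blast
  define Q where "Q = measure_of \<Omega> (cylinder_algebra M) \<mu>"
  have sub: "cylinder_algebra M \<subseteq> Pow \<Omega>" by (rule cyl.space_closed)
  have sp: "space Q = \<Omega>" and st: "sets Q = sigma_sets \<Omega> (cylinder_algebra M)"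
    unfolding Q_def using sub by (auto intro: space_measure_of sets_measure_of)
  have em: "emeasure Q D = ennreal (f D)" if "D \<in> cylinder_algebra M" for D
  proof -
    have "emeasure Q D = \<mu> D"
    proof (rule emeasure_measure_of[OF Q_def sub])
      show "positive (sets Q) \<mu>" "countably_additive (sets Q) \<mu>"
        using \<mu>(2) unfolding st measure_space_def by auto
      show "D \<in> sets Q" unfolding st using that by (rule sigma_sets.Basic)
    qed
    then show ?thesis using \<mu>(1)[OF that] by simp
  qed
  have top: "\<Omega> \<in> cylinder_algebra M" by (rule cyl.top)
  have "R k \<Omega> = space M" for k by (auto simp: R_def \<Omega>_def)
  then have "f \<Omega> = 1" using LIMSEQ_unique[OF f[OF top]] prob_space by (simp add: tendsto_const_iff)
  then have "prob_space Q" by (intro prob_spaceI) (simp add: sp em[OF top])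
  moreover have "(\<lambda>k. measure M {w\<in>space M. (w, X (r k) w) \<in> D}) \<longlonglongrightarrow> measure Q D"
    if "D \<in> cylinder_algebra M" for D
    using f[OF that] f0[OF that] em[OF that] by (simp add: R_def measure_def)
  ultimately show ?thesis using that r sp st unfolding \<Omega>_def by blast
qed

section \<open>Integrals under a stable limit\<close>

text \<open>This is continuity on the Cantor space, written as uniform dependence on finitely many coordinates.\<close>

definition cylinder_continuous :: "(('i \<Rightarrow> bool) \<Rightarrow> real) \<Rightarrow> bool" where
  "cylinder_continuous d \<longleftrightarrow>
     (\<forall>e>0. \<exists>J. finite J \<and> (\<forall>c c'. (\<forall>i\<in>J. c i = c' i) \<longrightarrow> \<bar>d c - d c'\<bar> \<le> e))"

abbreviation rectangle :: "'a set \<Rightarrow> 'i set \<Rightarrow> ('a \<times> ('i \<Rightarrow> bool)) set" where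
  "rectangle A I \<equiv> {z. fst z \<in> A \<and> (\<forall>i\<in>I. snd z i)}"

locale stable_limit =
  fixes M :: "'a measure" and X :: "nat \<Rightarrow> 'a \<Rightarrow> 'i::countable \<Rightarrow> bool" and Q :: "('a \<times> ('i \<Rightarrow> bool)) measure"
  assumes prob_M: "prob_space M"
    and X: "\<And>k i. {w\<in>space M. X k w i} \<in> sets M"
    and prob_Q: "prob_space Q"
    and space_Q: "space Q = space M \<times> UNIV"
    and sets_Q: "sets Q = sigma_sets (space M \<times> UNIV) (cylinder_algebra M)"
    and cylinder_conv: "\<And>D. D \<in> cylinder_algebra M \<Longrightarrow>
      (\<lambda>k. measure M {w\<in>space M. (w, X k w) \<in> D}) \<longlonglongrightarrow> measure Q D"
begin

sublocale M: prob_space M by (rule prob_M)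
sublocale Q: prob_space Q by (rule prob_Q)

lemma cylinder_sets: "D \<in> cylinder_algebra M \<Longrightarrow> D \<in> sets Q"
  by (simp add: sets_Q sigma_sets.Basic)

lemma rectangle_cylinder:
  fixes I :: "'i set"
  assumes A: "A \<in> sets M" and I: "finite I"
  shows "rectangle A I \<in> cylinder_algebra M"
proof (rule cylinder_algebraI)
  fix c :: "'i \<Rightarrow> bool"
  have "{w. (w, c) \<in> rectangle A I} = (if \<forall>i\<in>I. c i then A else {})" by auto
  then show "{w. (w, c) \<in> rectangle A I} \<in> sets M" using A by simp
next
  show "depends_only_on I (rectangle A I)"
    by (rule depends_only_onI) auto
  show "rectangle A I \<subseteq> space M \<times> UNIV"
    using sets.sets_into_space[OF A] by auto
qed (rule I)

lemma measurable_fst_Q [measurable]: "fst \<in> measurable Q M"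
proof (rule measurableI)
  fix A assume A: "A \<in> sets M"
  have "fst -` A \<inter> space Q = rectangle A {}"
    using sets.sets_into_space[OF A] by (auto simp: space_Q)
  then show "fst -` A \<inter> space Q \<in> sets Q"
    using cylinder_sets[OF rectangle_cylinder[OF A, of "{}"]] by simp
qed (auto simp: space_Q)

lemma coordinate_sets: "{z\<in>space Q. snd z i} \<in> sets Q"
proof -
  have "{z\<in>space Q. snd z i} = rectangle (space M) {i}" by (auto simp: space_Q)
  then show ?thesis using cylinder_sets[OF rectangle_cylinder[OF sets.top, of "{i}"]] by simp
qed

lemma rectangle_conv:
  assumes A: "A \<in> sets M" and I: "finite I"
  shows "(\<lambda>k. M.prob {w\<in>A. \<forall>i\<in>I. X k w i}) \<longlonglongrightarrow> Q.prob (rectangle A I)"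
proof -
  have "{w\<in>space M. (w, X k w) \<in> rectangle A I} = {w\<in>A. \<forall>i\<in>I. X k w i}" for k
    using sets.sets_into_space[OF A] by auto
  then show ?thesis using cylinder_conv[OF rectangle_cylinder[OF A I]] by (simp only:)
qed

text \<open>The sample point keeps its law, because the events \<open>A\<close> are tested exactly and not approximately.
  This is what makes the noise and the given solution survive the passage to the limit.\<close>

lemma distr_fst: "distr Q M fst = M"
proof (rule measure_eqI)
  fix A assume "A \<in> sets (distr Q M fst)"
  then have A: "A \<in> sets M" by simp
  have eq: "fst -` A \<inter> space Q = rectangle A {}"
    using sets.sets_into_space[OF A] by (auto simp: space_Q)
  have "(\<lambda>k::nat. M.prob A) \<longlonglongrightarrow> Q.prob (fst -` A \<inter> space Q)"
    using rectangle_conv[OF A, of "{}"] by (simp add: eq)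
  then have "Q.prob (fst -` A \<inter> space Q) = M.prob A" by (simp add: tendsto_const_iff)
  then show "emeasure (distr Q M fst) A = emeasure M A"
    using A by (simp add: emeasure_distr M.emeasure_eq_measure Q.emeasure_eq_measure)
qed simp

lemma AE_fst: "AE w in M. P w \<Longrightarrow> AE z in Q. P (fst z)"
  by (rule AE_distrD[OF measurable_fst_Q]) (simp only: distr_fst)

lemma uniform_approx_measurable:
  fixes f :: "'b \<Rightarrow> real"
  assumes "\<And>e. e > 0 \<Longrightarrow> \<exists>g\<in>borel_measurable N. \<forall>x\<in>space N. \<bar>f x - g x\<bar> \<le> e"
  shows "f \<in> borel_measurable N"
proof -
  have "\<forall>n::nat. \<exists>g. g \<in> borel_measurable N \<and> (\<forall>x\<in>space N. \<bar>f x - g x\<bar> \<le> 1 / (n + 1))"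
    using assms by (simp add: Bex_def)
  then obtain g where g: "\<And>n::nat. g n \<in> borel_measurable N" "\<And>n x. x \<in> space N \<Longrightarrow> \<bar>f x - g n x\<bar> \<le> 1 / (n + 1)"
    by metis
  show ?thesis
  proof (rule borel_measurable_LIMSEQ_real[OF _ g(1)])
    fix x assume x: "x \<in> space N"
    have "(\<lambda>n. f x - g n x) \<longlonglongrightarrow> 0"
      by (rule Lim_null_comparison[OF _ LIMSEQ_inverse_real_of_nat])
        (use g(2)[OF x] in \<open>auto simp: inverse_eq_divide add.commute\<close>)
    from tendsto_diff[OF tendsto_const[of "f x"] this] show "(\<lambda>n. g n x) \<longlonglongrightarrow> f x" by simp
  qed
qed

text \<open>Stable convergence tests functions that are merely measurable in the sample point and continuous
  in the code. Freezing all but finitely many coordinates at \<open>False\<close> changes such a function by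
  little, and the superlevel sets of the frozen function are cylinders.\<close>

lemma stable_integral:
  fixes \<Phi> :: "'a \<times> ('i \<Rightarrow> bool) \<Rightarrow> real"
  assumes B: "\<And>w c. w \<in> space M \<Longrightarrow> \<bar>\<Phi> (w, c)\<bar> \<le> B"
    and meas: "\<And>c. (\<lambda>w. \<Phi> (w, c)) \<in> borel_measurable M"
    and mod: "\<And>e. e > 0 \<Longrightarrow> \<exists>J. finite J \<and>
      (\<forall>w\<in>space M. \<forall>c c'. (\<forall>i\<in>J. c i = c' i) \<longrightarrow> \<bar>\<Phi> (w, c) - \<Phi> (w, c')\<bar> \<le> e)"
  shows "\<Phi> \<in> borel_measurable Q"
    and "\<And>k. (\<lambda>w. \<Phi> (w, X k w)) \<in> borel_measurable M"
    and "(\<lambda>k. \<integral>w. \<Phi> (w, X k w) \<partial>M) \<longlonglongrightarrow> (\<integral>z. \<Phi> z \<partial>Q)"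
proof -
  define T where "T J c = (\<lambda>i. i \<in> J \<and> c i)" for J :: "'i set" and c :: "'i \<Rightarrow> bool"
  have lev: "{z\<in>space Q. \<Phi> (fst z, T J (snd z)) > r} \<in> cylinder_algebra M" if J: "finite J" for J r
  proof (rule cylinder_algebraI[OF _ _ J])
    fix c :: "'i \<Rightarrow> bool"
    have "{w. (w, c) \<in> {z\<in>space Q. \<Phi> (fst z, T J (snd z)) > r}} = {w\<in>space M. \<Phi> (w, T J c) > r}"
      by (auto simp: space_Q)
    then show "{w. (w, c) \<in> {z\<in>space Q. \<Phi> (fst z, T J (snd z)) > r}} \<in> sets M"
      using borel_measurable_less[OF borel_measurable_const meas] by simp
  next
    show "depends_only_on J {z\<in>space Q. \<Phi> (fst z, T J (snd z)) > r}"
    proof (rule depends_only_onI)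
      fix w and c c' :: "'i \<Rightarrow> bool" assume "\<And>i. i \<in> J \<Longrightarrow> c i = c' i"
      then have "T J c = T J c'" by (auto simp: T_def)
      then show "(w, c) \<in> {z\<in>space Q. \<Phi> (fst z, T J (snd z)) > r} \<Longrightarrow> (w, c') \<in> {z\<in>space Q. \<Phi> (fst z, T J (snd z)) > r}"
        by (simp add: space_Q)
    qed
  qed (auto simp: space_Q)
  have mQ: "(\<lambda>z. \<Phi> (fst z, T J (snd z))) \<in> borel_measurable Q" if "finite J" for J
    unfolding borel_measurable_iff_greater using cylinder_sets[OF lev[OF that]] by simp
  have pull: "{w\<in>space M. (w, X k w) \<in> {z\<in>space Q. \<Phi> (fst z, T J (snd z)) > r}} = {w\<in>space M. \<Phi> (w, T J (X k w)) > r}" for J r k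
    by (auto simp: space_Q)
  have mM: "(\<lambda>w. \<Phi> (w, T J (X k w))) \<in> borel_measurable M" if "finite J" for J k
    unfolding borel_measurable_iff_greater
  proof
    fix r
    show "{w\<in>space M. \<Phi> (w, T J (X k w)) > r} \<in> sets M"
      using cylinder_pullback_sets[where Y = "X k", OF M.finite_measure_axioms X lev[OF that]] unfolding pull .
  qed
  have conv: "(\<lambda>k. \<integral>w. \<Phi> (w, T J (X k w)) \<partial>M) \<longlonglongrightarrow> (\<integral>z. \<Phi> (fst z, T J (snd z)) \<partial>Q)" if J: "finite J" for J
  proof (rule tendsto_integral_of_levels)
    show "(\<lambda>k. M.prob {w\<in>space M. \<Phi> (w, T J (X k w)) > r}) \<longlonglongrightarrow> Q.prob {z\<in>space Q. \<Phi> (fst z, T J (snd z)) > r}" for r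
      using cylinder_conv[OF lev[OF J], of r] unfolding pull .
  qed (use B mM[OF J] mQ[OF J] in \<open>auto simp: space_Q M.finite_measure_axioms Q.finite_measure_axioms\<close>)
  have appr: "\<exists>J. finite J \<and> (\<forall>w\<in>space M. \<forall>c. \<bar>\<Phi> (w, c) - \<Phi> (w, T J c)\<bar> \<le> e)" if e: "e > 0" for e
  proof -
    obtain J where J: "finite J" "\<forall>w\<in>space M. \<forall>c c'. (\<forall>i\<in>J. c i = c' i) \<longrightarrow> \<bar>\<Phi> (w, c) - \<Phi> (w, c')\<bar> \<le> e"
      using mod[OF e] by (elim exE conjE) (rule that)
    have "\<bar>\<Phi> (w, c) - \<Phi> (w, T J c)\<bar> \<le> e" if "w \<in> space M" for w c
      by (rule J(2)[THEN bspec, THEN spec, THEN spec, THEN mp, OF that]) (simp add: T_def)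
    then show ?thesis using J(1) by blast
  qed
  show mQ': "\<Phi> \<in> borel_measurable Q"
  proof (rule uniform_approx_measurable)
    fix e :: real assume e: "e > 0"
    obtain J where J: "finite J" "\<forall>w\<in>space M. \<forall>c. \<bar>\<Phi> (w, c) - \<Phi> (w, T J c)\<bar> \<le> e"
      using appr[OF e] by auto
    then show "\<exists>g\<in>borel_measurable Q. \<forall>z\<in>space Q. \<bar>\<Phi> z - g z\<bar> \<le> e"
      using mQ[OF J(1)] by (intro bexI[of _ "\<lambda>z. \<Phi> (fst z, T J (snd z))"]) (auto simp: space_Q)
  qed
  show mM': "(\<lambda>w. \<Phi> (w, X k w)) \<in> borel_measurable M" for k
  proof (rule uniform_approx_measurable)
    fix e :: real assume e: "e > 0"
    obtain J where J: "finite J" "\<forall>w\<in>space M. \<forall>c. \<bar>\<Phi> (w, c) - \<Phi> (w, T J c)\<bar> \<le> e"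
      using appr[OF e] by auto
    then show "\<exists>g\<in>borel_measurable M. \<forall>w\<in>space M. \<bar>\<Phi> (w, X k w) - g w\<bar> \<le> e"
      using mM[OF J(1)] by (intro bexI[of _ "\<lambda>w. \<Phi> (w, T J (X k w))"]) auto
  qed
  show "(\<lambda>k. \<integral>w. \<Phi> (w, X k w) \<partial>M) \<longlonglongrightarrow> (\<integral>z. \<Phi> z \<partial>Q)"
  proof (rule tendsto_by_approximation)
    fix e :: real assume e: "e > 0"
    obtain J where J: "finite J" "\<forall>w\<in>space M. \<forall>c. \<bar>\<Phi> (w, c) - \<Phi> (w, T J c)\<bar> \<le> e"
      using appr[OF e] by auto
    have "\<bar>(\<integral>w. \<Phi> (w, X k w) \<partial>M) - (\<integral>w. \<Phi> (w, T J (X k w)) \<partial>M)\<bar> \<le> e" for k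
      by (rule M.integral_AE_close[OF mM' mM[OF J(1)], where B = B]) (use B J(2) in \<open>auto intro!: AE_I2\<close>)
    moreover have "\<bar>(\<integral>z. \<Phi> z \<partial>Q) - (\<integral>z. \<Phi> (fst z, T J (snd z)) \<partial>Q)\<bar> \<le> e"
      by (rule Q.integral_AE_close[OF mQ' mQ[OF J(1)], where B = B]) (use B J(2) in \<open>auto simp: space_Q intro!: AE_I2\<close>)
    ultimately show "\<exists>y l. y \<longlonglongrightarrow> l \<and> (\<forall>k. \<bar>(\<integral>w. \<Phi> (w, X k w) \<partial>M) - y k\<bar> \<le> e) \<and> \<bar>(\<integral>z. \<Phi> z \<partial>Q) - l\<bar> \<le> e"
      using conv[OF J(1)] by blast
  qed
qed

text \<open>The form in which the preceding lemma is used: an indicator of a rectangle times a Lipschitz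
  function of two decoded values, with the noise as a parameter.\<close>

lemma stable_test_function:
  fixes H :: "'a \<Rightarrow> real \<Rightarrow> real \<Rightarrow> real"
  assumes A: "A \<in> sets M" and I: "finite I"
    and d: "cylinder_continuous d" "cylinder_continuous d'"
    and Hm: "\<And>u v. (\<lambda>w. H w u v) \<in> borel_measurable M"
    and HB: "\<And>w c. w \<in> space M \<Longrightarrow> \<bar>H w (d c) (d' c)\<bar> \<le> B"
    and HL: "\<And>w u v u' v'. w \<in> space M \<Longrightarrow> \<bar>H w u v - H w u' v'\<bar> \<le> L * (\<bar>u - u'\<bar> + \<bar>v - v'\<bar>)"
  defines "\<Phi> \<equiv> \<lambda>z. indicator A (fst z) * of_bool (\<forall>i\<in>I. snd z i) * H (fst z) (d (snd z)) (d' (snd z))"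
  shows "\<Phi> \<in> borel_measurable Q"
    and "\<And>k. (\<lambda>w. \<Phi> (w, X k w)) \<in> borel_measurable M"
    and "(\<lambda>k. \<integral>w. \<Phi> (w, X k w) \<partial>M) \<longlonglongrightarrow> (\<integral>z. \<Phi> z \<partial>Q)"
proof -
  have B: "\<bar>\<Phi> (w, c)\<bar> \<le> B" if "w \<in> space M" for w c
    using HB[OF that, of c] by (auto simp: \<Phi>_def abs_mult indicator_def of_bool_def)
  have m: "(\<lambda>w. \<Phi> (w, c)) \<in> borel_measurable M" for c
    unfolding \<Phi>_def using A Hm by simp
  have mod: "\<exists>J. finite J \<and> (\<forall>w\<in>space M. \<forall>c c'. (\<forall>i\<in>J. c i = c' i) \<longrightarrow> \<bar>\<Phi> (w, c) - \<Phi> (w, c')\<bar> \<le> e)"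
    if e: "e > 0" for e
  proof -
    define e' where "e' = e / (2 * (\<bar>L\<bar> + 1))"
    have e': "e' > 0" using e by (simp add: e'_def add_nonneg_pos)
    obtain J where J: "finite J" "\<forall>c c'. (\<forall>i\<in>J. c i = c' i) \<longrightarrow> \<bar>d c - d c'\<bar> \<le> e'"
      using d(1)[unfolded cylinder_continuous_def, THEN spec, THEN mp, OF e'] by (elim exE conjE) (rule that)
    obtain J' where J': "finite J'" "\<forall>c c'. (\<forall>i\<in>J'. c i = c' i) \<longrightarrow> \<bar>d' c - d' c'\<bar> \<le> e'"
      using d(2)[unfolded cylinder_continuous_def, THEN spec, THEN mp, OF e'] by (elim exE conjE) (rule that)
    show ?thesis
    proof (intro exI[of _ "I \<union> J \<union> J'"] conjI ballI allI impI)
      fix w and c c' :: "'i \<Rightarrow> bool" assume w: "w \<in> space M" and c: "\<forall>i\<in>I \<union> J \<union> J'. c i = c' i"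
      have dd: "\<bar>d c - d c'\<bar> \<le> e'" "\<bar>d' c - d' c'\<bar> \<le> e'"
        using J(2)[THEN spec, THEN spec, THEN mp, of c c'] J'(2)[THEN spec, THEN spec, THEN mp, of c c'] c by auto
      have "(\<forall>i\<in>I. c i) = (\<forall>i\<in>I. c' i)" using c by auto
      then have "\<bar>\<Phi> (w, c) - \<Phi> (w, c')\<bar> \<le> \<bar>H w (d c) (d' c) - H w (d c') (d' c')\<bar>"
        by (auto simp: \<Phi>_def indicator_def of_bool_def)
      also have "\<dots> \<le> L * (\<bar>d c - d c'\<bar> + \<bar>d' c - d' c'\<bar>)" by (rule HL[OF w])
      also have "\<dots> \<le> (\<bar>L\<bar> + 1) * (\<bar>d c - d c'\<bar> + \<bar>d' c - d' c'\<bar>)"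
        by (intro mult_right_mono) auto
      also have "\<dots> \<le> (\<bar>L\<bar> + 1) * (2 * e')"
        using dd by (intro mult_left_mono) auto
      also have "\<dots> = e" by (simp add: e'_def field_simps)
      finally show "\<bar>\<Phi> (w, c) - \<Phi> (w, c')\<bar> \<le> e" .
    qed (use I J J' in auto)
  qed
  show "\<Phi> \<in> borel_measurable Q" "\<And>k. (\<lambda>w. \<Phi> (w, X k w)) \<in> borel_measurable M"
    "(\<lambda>k. \<integral>w. \<Phi> (w, X k w) \<partial>M) \<longlonglongrightarrow> (\<integral>z. \<Phi> z \<partial>Q)"
    by (rule stable_integral[OF B m mod]; assumption)+
qed

end

section \<open>Coding real numbers and paths\<close>

text \<open>The decoded number is \<open>L\<close> times the affine image in \<open>[-1, 1]\<close> of a binary expansion. Decoding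
  is continuous on the whole Cantor space, whereas reading off the digits is only measurable; so
  the limit is taken on the side of the codes.\<close>

definition decode :: "real \<Rightarrow> (nat \<Rightarrow> bool) \<Rightarrow> real" where
  "decode L b = L * (2 * (\<Sum>n. of_bool (b n) * (1/2) ^ Suc n) - 1)"

definition digit :: "real \<Rightarrow> real \<Rightarrow> nat \<Rightarrow> bool" where
  "digit L y n \<longleftrightarrow> odd \<lfloor>2 ^ Suc n * ((y / L + 1) / 2)\<rfloor>"

lemma summable_digits: "summable (\<lambda>n. of_bool (b n) * (1/2 :: real) ^ Suc n)"
  by (rule summable_comparison_test'[OF sums_summable[OF power_half_series]]) auto

lemma decode_bound:
  assumes "L \<ge> 0"
  shows "\<bar>decode L b\<bar> \<le> L"
proof -
  let ?s = "\<Sum>n. of_bool (b n) * (1/2 :: real) ^ Suc n"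
  have "0 \<le> ?s" by (rule suminf_nonneg[OF summable_digits]) simp
  moreover have "?s \<le> (\<Sum>n. (1/2) ^ Suc n)"
    by (rule suminf_le[OF _ summable_digits sums_summable[OF power_half_series]]) simp
  then have "?s \<le> 1" using sums_unique[OF power_half_series] by simp
  ultimately have "\<bar>2 * ?s - 1\<bar> \<le> 1" by auto
  then show ?thesis using assms unfolding decode_def abs_mult by (simp add: mult_left_le)
qed

lemma decode_close:
  assumes L: "L \<ge> 0" and b: "\<And>n. n < N \<Longrightarrow> b n = b' n"
  shows "\<bar>decode L b - decode L b'\<bar> \<le> 2 * L * (1/2) ^ N"
proof -
  define a where "a n = of_bool (b n) * (1/2 :: real) ^ Suc n - of_bool (b' n) * (1/2) ^ Suc n" for n
  have sa: "summable a" unfolding a_def by (intro summable_diff summable_digits)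
  have a0: "(\<Sum>i<N. a i) = 0" using b by (intro sum.neutral) (simp add: a_def)
  have geo: "(\<lambda>n. (1/2 :: real) ^ Suc (n + N)) sums ((1/2) ^ N)"
    using sums_mult[OF power_half_series, of "(1/2) ^ N"] by (simp add: power_add mult.assoc mult.left_commute mult.commute)
  have le: "\<bar>a (n + N)\<bar> \<le> (1/2) ^ Suc (n + N)" for n
    by (auto simp: a_def of_bool_def)
  have sab: "summable (\<lambda>n. \<bar>a (n + N)\<bar>)"
    by (rule summable_comparison_test'[OF sums_summable[OF geo]]) (use le in simp)
  have "suminf a = (\<Sum>n. a (n + N))"
    using suminf_split_initial_segment[OF sa, of N] a0 by simp
  then have "\<bar>suminf a\<bar> \<le> (\<Sum>n. \<bar>a (n + N)\<bar>)" using summable_rabs[OF sab] by simp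
  also have "\<dots> \<le> (\<Sum>n. (1/2) ^ Suc (n + N))"
    by (rule suminf_le[OF le sab sums_summable[OF geo]])
  also have "\<dots> = (1/2) ^ N" using sums_unique[OF geo] by simp
  finally have "\<bar>suminf a\<bar> \<le> (1/2) ^ N" .
  moreover have suma: "suminf a = (\<Sum>n. of_bool (b n) * (1/2) ^ Suc n) - (\<Sum>n. of_bool (b' n) * (1/2) ^ Suc n)"
    unfolding a_def by (rule suminf_diff[OF summable_digits summable_digits, symmetric])
  have "decode L b - decode L b' = 2 * L * suminf a" unfolding decode_def suma by (simp add: algebra_simps)
  ultimately show ?thesis using L by (simp add: abs_mult mult_left_mono)
qed

text \<open>The inequality has to be strict, since the endpoint \<open>L\<close> would need the expansion all of whose
  digits are 1, which the floor function does not produce.\<close>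

lemma decode_digit:
  assumes y: "\<bar>y\<bar> < L"
  shows "decode L (digit L y) = y"
proof -
  define u where "u = (y / L + 1) / 2"
  have L: "L > 0" using y by linarith
  have "- 1 < y / L" "y / L < 1" using y L by (auto simp: field_simps abs_less_iff)
  then have u: "0 \<le> u" "u < 1" by (auto simp: u_def)
  have sum: "(\<Sum>n<N. of_bool (digit L y n) * (1/2 :: real) ^ Suc n) = of_int \<lfloor>2 ^ N * u\<rfloor> / 2 ^ N" for N
  proof (induction N)
    case 0
    have "\<lfloor>u\<rfloor> = 0" using u by linarith
    then show ?case by simp
  next
    case (Suc N)
    have "\<lfloor>2 ^ Suc N * u\<rfloor> div 2 = \<lfloor>2 ^ N * u\<rfloor>"
    proof -
      have "\<lfloor>2 ^ Suc N * u\<rfloor> div 2 = \<lfloor>(2 ^ Suc N * u) / of_int 2\<rfloor>"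
        by (rule floor_divide_real_eq_div[symmetric]) simp
      then show ?thesis by simp
    qed
    moreover have "\<lfloor>2 ^ Suc N * u\<rfloor> = 2 * (\<lfloor>2 ^ Suc N * u\<rfloor> div 2) + of_bool (odd \<lfloor>2 ^ Suc N * u\<rfloor>)"
      using mult_div_mod_eq[of 2 "\<lfloor>2 ^ Suc N * u\<rfloor>"] unfolding mod_2_eq_odd by (rule sym)
    ultimately have "\<lfloor>2 ^ Suc N * u\<rfloor> = 2 * \<lfloor>2 ^ N * u\<rfloor> + of_bool (digit L y N)"
      unfolding digit_def u_def[symmetric] by simp
    then have "real_of_int \<lfloor>2 ^ Suc N * u\<rfloor> / 2 ^ Suc N = of_int \<lfloor>2 ^ N * u\<rfloor> / 2 ^ N + of_bool (digit L y N) * (1/2) ^ Suc N"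
      by (simp add: field_simps power_one_over)
    then show ?case using Suc by simp
  qed
  have "(\<lambda>N. real_of_int \<lfloor>2 ^ N * u\<rfloor> / 2 ^ N - u) \<longlonglongrightarrow> 0"
  proof (rule Lim_null_comparison[OF _ LIMSEQ_power_zero[of "1/2 :: real"]])
    have "\<bar>of_int \<lfloor>2 ^ N * u\<rfloor> / 2 ^ N - u\<bar> \<le> (1/2) ^ N" for N
    proof -
      have "\<bar>of_int \<lfloor>2 ^ N * u\<rfloor> - 2 ^ N * u\<bar> \<le> 1" by linarith
      then have "\<bar>of_int \<lfloor>2 ^ N * u\<rfloor> - 2 ^ N * u\<bar> / 2 ^ N \<le> 1 / 2 ^ N" by (intro divide_right_mono) auto
      moreover have "of_int \<lfloor>2 ^ N * u\<rfloor> / 2 ^ N - u = (of_int \<lfloor>2 ^ N * u\<rfloor> - 2 ^ N * u) / 2 ^ N"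
        by (simp add: field_simps)
      ultimately show ?thesis by (simp add: power_one_over)
    qed
    then show "\<forall>\<^sub>F N in sequentially. norm (of_int \<lfloor>2 ^ N * u\<rfloor> / 2 ^ N - u) \<le> (1/2) ^ N" by simp
  qed simp
  then have "(\<lambda>N. real_of_int \<lfloor>2 ^ N * u\<rfloor> / 2 ^ N) \<longlonglongrightarrow> u" by (simp add: LIM_zero_iff)
  moreover have "(\<lambda>N. real_of_int \<lfloor>2 ^ N * u\<rfloor> / 2 ^ N) \<longlonglongrightarrow> (\<Sum>n. of_bool (digit L y n) * (1/2) ^ Suc n)"
    using summable_LIMSEQ[OF summable_digits[of "digit L y"]] unfolding sum .
  ultimately have "(\<Sum>n. of_bool (digit L y n) * (1/2) ^ Suc n) = u" using LIMSEQ_unique by blast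
  then have "decode L (digit L y) = L * (2 * u - 1)" unfolding decode_def by simp
  also have "\<dots> = y" using L by (simp add: u_def field_simps)
  finally show ?thesis .
qed

lemma digit_sets:
  assumes "f \<in> borel_measurable N"
  shows "{w\<in>space N. digit L (f w) n} \<in> sets N"
  unfolding digit_def using assms by measurable

lemma cylinder_continuous_decode:
  fixes i :: 'b and j :: 'c
  assumes L: "L \<ge> 0"
  shows "cylinder_continuous (\<lambda>c. decode L (\<lambda>n. c (i, j, n)))"
  unfolding cylinder_continuous_def
proof (intro allI impI)
  fix e :: real assume e: "e > 0"
  have "(\<lambda>N. 2 * L * (1/2) ^ N) \<longlonglongrightarrow> 2 * L * 0" by (intro tendsto_mult_left LIMSEQ_power_zero) simp
  then have "eventually (\<lambda>N. 2 * L * (1/2) ^ N < e) sequentially"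
    using e by (intro order_tendstoD(2)) auto
  then obtain N where N: "2 * L * (1/2) ^ N < e" by (auto simp: eventually_sequentially)
  have "\<bar>decode L (\<lambda>n. c (i, j, n)) - decode L (\<lambda>n. c' (i, j, n))\<bar> \<le> e"
    if "\<forall>z\<in>(\<lambda>n. (i, j, n)) ` {..<N}. c z = c' z" for c c' :: "'b \<times> 'c \<times> nat \<Rightarrow> bool"
    using decode_close[OF L, of N "\<lambda>n. c (i, j, n)" "\<lambda>n. c' (i, j, n)"] that N by auto
  then show "\<exists>J. finite J \<and> (\<forall>c c' :: 'b \<times> 'c \<times> nat \<Rightarrow> bool. (\<forall>z\<in>J. c z = c' z) \<longrightarrow>
      \<bar>decode L (\<lambda>n. c (i, j, n)) - decode L (\<lambda>n. c' (i, j, n))\<bar> \<le> e)"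
    by (intro exI[of _ "(\<lambda>n. (i, j, n)) ` {..<N}"]) auto
qed

lemma dyadic_below:
  assumes "t \<ge> 0"
  shows "real (nat \<lfloor>2 ^ m * t\<rfloor>) / 2 ^ m \<le> t" "t - (1/2) ^ m \<le> real (nat \<lfloor>2 ^ m * t\<rfloor>) / 2 ^ m"
proof -
  have "0 \<le> 2 ^ m * t" using assms by simp
  then have *: "real (nat \<lfloor>2 ^ m * t\<rfloor>) \<le> 2 ^ m * t" "2 ^ m * t - 1 \<le> real (nat \<lfloor>2 ^ m * t\<rfloor>)" by linarith+
  show "real (nat \<lfloor>2 ^ m * t\<rfloor>) / 2 ^ m \<le> t" using *(1) by (simp add: field_simps)
  have "t - (1/2) ^ m = (2 ^ m * t - 1) / 2 ^ m" by (simp add: field_simps power_one_over)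
  also have "\<dots> \<le> real (nat \<lfloor>2 ^ m * t\<rfloor>) / 2 ^ m" using *(2) by (intro divide_right_mono) auto
  finally show "t - (1/2) ^ m \<le> real (nat \<lfloor>2 ^ m * t\<rfloor>) / 2 ^ m" .
qed

lemma dyadic_below_tendsto:
  assumes "t \<ge> 0"
  shows "(\<lambda>m. real (nat \<lfloor>2 ^ m * t\<rfloor>) / 2 ^ m) \<longlonglongrightarrow> t"
proof (rule tendsto_sandwich)
  have "(\<lambda>m. t - (1/2) ^ m) \<longlonglongrightarrow> t - 0" by (intro tendsto_intros LIMSEQ_power_zero) simp
  then show "(\<lambda>m. t - (1/2) ^ m) \<longlonglongrightarrow> t" by simp
qed (use dyadic_below[OF assms] in auto)

lemma lipschitz_dyadic_limit:
  fixes f :: "real \<Rightarrow> real"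
  assumes lip: "\<And>s t. s \<ge> 0 \<Longrightarrow> t \<ge> 0 \<Longrightarrow> \<bar>f t - f s\<bar> \<le> C * \<bar>t - s\<bar>" and t: "t \<ge> 0"
  shows "(\<lambda>m. f (real (nat \<lfloor>2 ^ m * t\<rfloor>) / 2 ^ m)) \<longlonglongrightarrow> f t"
proof -
  let ?g = "\<lambda>m. real (nat \<lfloor>2 ^ m * t\<rfloor>) / 2 ^ m"
  have "(\<lambda>m. f (?g m) - f t) \<longlonglongrightarrow> 0"
  proof (rule Lim_null_comparison)
    show "\<forall>\<^sub>F m in sequentially. norm (f (?g m) - f t) \<le> C * \<bar>?g m - t\<bar>"
      using lip t by (intro always_eventually) simp
    have "(\<lambda>m. C * \<bar>?g m - t\<bar>) \<longlonglongrightarrow> C * \<bar>t - t\<bar>"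
      by (intro tendsto_intros dyadic_below_tendsto t)
    then show "(\<lambda>m. C * \<bar>?g m - t\<bar>) \<longlonglongrightarrow> 0" by simp
  qed
  then show ?thesis by (simp add: LIM_zero_iff)
qed

text \<open>Approximating the time from the right on dyadic grids exhibits a right-continuous process as a
  limit of processes that take countably many random variables as values.\<close>

lemma right_continuous_jointly_measurable:
  fixes Y :: "real \<Rightarrow> 'a \<Rightarrow> real"
  assumes m: "\<And>t. t \<ge> 0 \<Longrightarrow> Y t \<in> borel_measurable M"
    and rc: "\<And>w t. w \<in> space M \<Longrightarrow> t \<ge> 0 \<Longrightarrow> continuous (at_right t) (\<lambda>s. Y s w)"
  shows "(\<lambda>z. if fst z \<ge> 0 then Y (fst z) (snd z) else 0) \<in> borel_measurable (borel \<Otimes>\<^sub>M M)"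
proof (rule borel_measurable_LIMSEQ_real)
  define s where "s i t = (real (nat \<lfloor>2 ^ i * t\<rfloor>) + 1) / 2 ^ i" for i :: nat and t :: real
  show "(\<lambda>z. if fst z \<ge> 0 then Y (s i (fst z)) (snd z) else 0) \<in> borel_measurable (borel \<Otimes>\<^sub>M M)" for i
  proof -
    let ?f = "\<lambda>(j::nat) (z::real \<times> 'a). if fst z \<ge> 0 then Y ((real j + 1) / 2 ^ i) (snd z) else 0"
    have "(\<lambda>z. ?f (nat \<lfloor>2 ^ i * fst z\<rfloor>) z) \<in> borel_measurable (borel \<Otimes>\<^sub>M M)"
    proof (rule measurable_compose_countable[where f = ?f and g = "\<lambda>z :: real \<times> 'a. nat \<lfloor>2 ^ i * fst z\<rfloor>"])
      fix j :: nat
      have [measurable]: "Y ((real j + 1) / 2 ^ i) \<in> borel_measurable M" by (rule m) simp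
      have "{z \<in> space (borel \<Otimes>\<^sub>M M). (0::real) \<le> fst z} \<in> sets (borel \<Otimes>\<^sub>M M)"
        by (rule borel_measurable_le) simp_all
      then show "?f j \<in> borel_measurable (borel \<Otimes>\<^sub>M M)"
        by (intro measurable_If) measurable
    qed measurable
    then show ?thesis unfolding s_def .
  qed
  fix z :: "real \<times> 'a" assume z: "z \<in> space (borel \<Otimes>\<^sub>M M)"
  then have w: "snd z \<in> space M" by (auto simp: space_pair_measure)
  show "(\<lambda>i. if fst z \<ge> 0 then Y (s i (fst z)) (snd z) else 0) \<longlonglongrightarrow> (if fst z \<ge> 0 then Y (fst z) (snd z) else 0)"
  proof (cases "fst z \<ge> 0")
    case True
    have gt: "s i (fst z) > fst z" for i
    proof -
      have "2 ^ i * fst z < real (nat \<lfloor>2 ^ i * fst z\<rfloor>) + 1" by linarith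
      then show ?thesis by (simp add: s_def field_simps)
    qed
    have "(\<lambda>i. real (nat \<lfloor>2 ^ i * fst z\<rfloor>) / 2 ^ i + (1/2) ^ i) \<longlonglongrightarrow> fst z + 0"
      by (intro tendsto_add dyadic_below_tendsto True LIMSEQ_power_zero) simp
    moreover have "s i (fst z) = real (nat \<lfloor>2 ^ i * fst z\<rfloor>) / 2 ^ i + (1/2) ^ i" for i
      by (simp add: s_def add_divide_distrib power_one_over)
    ultimately have "(\<lambda>i. s i (fst z)) \<longlonglongrightarrow> fst z" by simp
    then have "filterlim (\<lambda>i. s i (fst z)) (at_right (fst z)) sequentially"
      using gt unfolding filterlim_at by (auto intro!: always_eventually simp: less_imp_neq[symmetric])
    moreover have "((\<lambda>t. Y t (snd z)) \<longlongrightarrow> Y (fst z) (snd z)) (at_right (fst z))"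
      using rc[OF w True] by (simp add: continuous_within)
    ultimately have "(\<lambda>i. Y (s i (fst z)) (snd z)) \<longlonglongrightarrow> Y (fst z) (snd z)"
      by (rule filterlim_compose[rotated])
    then show ?thesis using True by simp
  qed simp
qed

section \<open>Drifts converging in measure\<close>

text \<open>Uniform absolute continuity upgrades weak convergence to convergence on half-lines, since the error of replacing an
  indicator by a ramp sits on a small interval that shrinks to the empty set, and then by Dynkin's
  lemma to all Borel sets: the tail of a disjoint union is small for all measures at once. With
  setwise convergence the bounded measurable function \<open>a0\<close> may be integrated, and the sets
  where \<open>a n\<close> differs from \<open>a0\<close> are negligible uniformly.\<close>

lemma tendsto_integral_uniformly_continuous:
  fixes \<nu> :: "nat \<Rightarrow> real measure" and \<nu>0 \<mu> :: "real measure" and a :: "nat \<Rightarrow> real \<Rightarrow> real"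
  assumes nu: "\<And>n. finite_measure (\<nu> n)" "\<And>n. sets (\<nu> n) = sets borel" "\<And>n. measure (\<nu> n) UNIV \<le> 1"
    and nu0: "finite_measure \<nu>0" "sets \<nu>0 = sets borel" "measure \<nu>0 UNIV \<le> 1"
    and mu: "finite_measure \<mu>" "sets \<mu> = sets borel"
    and weak: "\<And>f L B. (\<And>x y. \<bar>f x - f y\<bar> \<le> L * \<bar>x - y\<bar>) \<Longrightarrow> (\<And>x. \<bar>f x\<bar> \<le> B) \<Longrightarrow>
      (\<lambda>n. \<integral>x. f x \<partial>\<nu> n) \<longlonglongrightarrow> (\<integral>x. f x \<partial>\<nu>0)"
    and uac: "\<And>e. e > 0 \<Longrightarrow> \<exists>d>0. \<forall>B\<in>sets borel. measure \<mu> B < d \<longrightarrow> (\<forall>n. measure (\<nu> n) B \<le> e)"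
    and a: "\<And>n. a n \<in> borel_measurable borel" "\<And>n y. \<bar>a n y\<bar> \<le> C"
    and a0: "a0 \<in> borel_measurable borel" "\<And>y. \<bar>a0 y\<bar> \<le> C"
    and conv: "\<And>e. e > 0 \<Longrightarrow> (\<lambda>n. measure \<mu> {y. \<bar>a n y - a0 y\<bar> > e}) \<longlonglongrightarrow> 0"
  shows "(\<lambda>n. \<integral>y. a n y \<partial>\<nu> n) \<longlonglongrightarrow> (\<integral>y. a0 y \<partial>\<nu>0)"
proof -
  interpret \<mu>: finite_measure \<mu> by fact
  interpret \<nu>0: finite_measure \<nu>0 by fact
  interpret \<nu>: finite_measure "\<nu> n" for n by (rule nu)
  have sp[simp]: "space (\<nu> n) = UNIV" "space \<nu>0 = UNIV" "space \<mu> = UNIV" for n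
    using sets_eq_imp_space_eq[OF nu(2)] sets_eq_imp_space_eq[OF nu0(2)] sets_eq_imp_space_eq[OF mu(2)] by simp_all
  have mb: "f \<in> borel_measurable (\<nu> n)" "f \<in> borel_measurable \<nu>0" if "f \<in> borel_measurable borel" for f :: "real \<Rightarrow> real" and n
    using that by (simp_all only: measurable_cong_sets[OF nu(2) refl] measurable_cong_sets[OF nu0(2) refl])
  \<comment> \<open>Smallness along a decreasing sequence, simultaneously for all measures.\<close>
  have small: "\<exists>k. (\<forall>n. measure (\<nu> n) (D k) \<le> e) \<and> measure \<nu>0 (D k) \<le> e"
    if D: "\<And>k. D k \<in> sets borel" "decseq D" "(\<Inter>k. D k) = {}" and e: "e > 0" for D :: "nat \<Rightarrow> real set" and e
  proof -
    obtain d where d: "d > 0" "\<And>B. B \<in> sets borel \<Longrightarrow> measure \<mu> B < d \<Longrightarrow> \<forall>n. measure (\<nu> n) B \<le> e"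
      using uac[OF e] by auto
    have "(\<lambda>k. measure \<mu> (D k)) \<longlonglongrightarrow> 0"
      using \<mu>.finite_Lim_measure_decseq[of D] D by (simp add: mu(2) image_subset_iff)
    then have "eventually (\<lambda>k. measure \<mu> (D k) < d) sequentially" using d(1) by (rule order_tendstoD(2))
    moreover have "(\<lambda>k. measure \<nu>0 (D k)) \<longlonglongrightarrow> 0"
      using \<nu>0.finite_Lim_measure_decseq[of D] D by (simp add: nu0(2) image_subset_iff)
    then have "eventually (\<lambda>k. measure \<nu>0 (D k) < e) sequentially" using e by (rule order_tendstoD(2))
    ultimately have "eventually (\<lambda>k. measure \<mu> (D k) < d \<and> measure \<nu>0 (D k) < e) sequentially"
      by (rule eventually_conj)
    then obtain k where "measure \<mu> (D k) < d" "measure \<nu>0 (D k) < e" by (auto simp: eventually_sequentially)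
    then show ?thesis using d(2)[OF D(1)] by (intro exI[of _ k]) auto
  qed
  have setwise: "(\<lambda>n. measure (\<nu> n) A) \<longlonglongrightarrow> measure \<nu>0 A" if "A \<in> sets borel" for A
  proof -
    have st: "Int_stable (range (atMost :: real \<Rightarrow> real set))"
    proof (rule Int_stableI_image)
      fix x y :: real
      have "{..x} \<inter> {..y} = {..min x y}" by auto
      then show "\<exists>k\<in>UNIV. {..x} \<inter> {..y} = {..k}" by blast
    qed
    have "A \<in> sigma_sets UNIV (range (atMost :: real \<Rightarrow> real set))"
      using that by (simp add: borel_eq_atMost)
    from st subset_UNIV[of "range (atMost :: real \<Rightarrow> real set)", folded Pow_UNIV] this show ?thesis
    proof (induction rule: sigma_sets_induct_disjoint)
      case (basic A)
      then obtain x where A: "A = {..x}" by auto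
      show ?case
      proof (rule tendsto_by_approximation)
        fix e :: real assume e: "e > 0"
        define D where "D k = {x<..<x + 1 / (real k + 1)}" for k
        have "(\<Inter>k. D k) = {}"
        proof (rule ccontr)
          assume "(\<Inter>k. D k) \<noteq> {}"
          then obtain y where "\<forall>k. y \<in> D k" by blast
          then have y: "y > x" "\<And>k. y < x + 1 / (real k + 1)" by (auto simp: D_def)
          obtain k where "inverse (real (Suc k)) < y - x" using reals_Archimedean[of "y - x"] y(1) by auto
          then show False using y(2)[of k] by (simp add: inverse_eq_divide add.commute)
        qed
        moreover have "decseq D" unfolding D_def decseq_def
        proof (intro allI impI subsetI)
          fix m n y assume "m \<le> (n::nat)" "y \<in> {x<..<x + 1 / (real n + 1)}"
          moreover from this(1) have "1 / (real n + 1) \<le> 1 / (real m + 1)" by (intro frac_le) auto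
          ultimately show "y \<in> {x<..<x + 1 / (real m + 1)}" by auto
        qed
        ultimately obtain k where k: "\<And>n. measure (\<nu> n) (D k) \<le> e" "measure \<nu>0 (D k) \<le> e"
          using small[of D e] e by (auto simp: D_def)
        define f where "f y = max 0 (min 1 (1 - (real k + 1) * (y - x)))" for y
        have f1: "\<bar>f y - f z\<bar> \<le> (real k + 1) * \<bar>y - z\<bar>" for y z
        proof -
          have "\<bar>f y - f z\<bar> \<le> \<bar>(1 - (real k + 1) * (y - x)) - (1 - (real k + 1) * (z - x))\<bar>"
            unfolding f_def by linarith
          also have "\<dots> = \<bar>(real k + 1) * (z - y)\<bar>" by (simp add: algebra_simps)
          also have "\<dots> = (real k + 1) * \<bar>y - z\<bar>" by (simp add: abs_mult abs_minus_commute)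
          finally show ?thesis .
        qed
        have f2: "\<bar>f y\<bar> \<le> 1" for y by (auto simp: f_def)
        have fm: "f \<in> borel_measurable borel" unfolding f_def by measurable
        have f3: "\<bar>indicator {..x} y - f y\<bar> \<le> indicator (D k) y" for y
        proof -
          have "f y = 1" if "y \<le> x"
          proof -
            have "(real k + 1) * (y - x) \<le> 0" using that by (simp add: mult_le_0_iff)
            then show ?thesis by (simp add: f_def)
          qed
          moreover have "f y = 0" if "y \<ge> x + 1 / (real k + 1)"
          proof -
            have "(real k + 1) * (y - x) \<ge> 1" using that by (simp add: field_simps)
            then show ?thesis by (simp add: f_def)
          qed
          ultimately show ?thesis using f2[of y] by (auto simp: indicator_def D_def f_def)
        qed
        have near: "\<bar>measure N {..x} - (\<integral>y. f y \<partial>N)\<bar> \<le> e"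
          if N: "finite_measure N" "sets N = sets borel" "measure N (D k) \<le> e" for N
        proof -
          interpret N: finite_measure N by fact
          have [measurable]: "f \<in> borel_measurable N" using fm measurable_cong_sets[OF N(2) refl] by auto
          have sN: "space N = UNIV" using sets_eq_imp_space_eq[OF N(2)] by simp
          have i: "integrable N f" using f2 by (intro N.integrable_const_bound[where B = 1]) auto
          have j: "integrable N (\<lambda>y. indicator B y :: real)" if "B \<in> sets borel" for B
            using that by (intro N.integrable_const_bound[where B = 1] borel_measurable_indicator) (auto simp: N(2))
          have "measure N {..x} - (\<integral>y. f y \<partial>N) = (\<integral>y. indicator {..x} y - f y \<partial>N)"
            using i j[of "{..x}"] by (simp add: sN)
          also have "\<bar>\<dots>\<bar> \<le> (\<integral>y. \<bar>indicator {..x} y - f y\<bar> \<partial>N)"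
            using integral_norm_bound[of N "\<lambda>y. indicator {..x} y - f y"] by simp
          also have "\<dots> \<le> (\<integral>y. indicator (D k) y \<partial>N)"
            using i j[of "{..x}"] j[of "D k"] f3 by (intro integral_mono) (auto simp: D_def)
          also have "\<dots> = measure N (D k)" by (simp add: sN)
          finally show ?thesis using N(3) by simp
        qed
        have n1: "\<bar>measure (\<nu> n) {..x} - (\<integral>y. f y \<partial>\<nu> n)\<bar> \<le> e" for n by (rule near[OF nu(1,2) k(1)])
        have n2: "\<bar>measure \<nu>0 {..x} - (\<integral>y. f y \<partial>\<nu>0)\<bar> \<le> e" by (rule near[OF nu0(1,2) k(2)])
        show "\<exists>y l. y \<longlonglongrightarrow> l \<and> (\<forall>n. \<bar>measure (\<nu> n) A - y n\<bar> \<le> e) \<and> \<bar>measure \<nu>0 A - l\<bar> \<le> e"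
          unfolding A
          by (intro exI[of _ "\<lambda>n. \<integral>y. f y \<partial>\<nu> n"] exI[of _ "\<integral>y. f y \<partial>\<nu>0"] conjI allI
              weak[of f "real k + 1" 1] f1 f2 n1 n2)
      qed
    next
      case empty
      then show ?case by simp
    next
      case (compl A)
      have "\<bar>1 - (1::real)\<bar> \<le> 0 * \<bar>x - y\<bar>" for x y :: real by simp
      then have top: "(\<lambda>n. measure (\<nu> n) UNIV) \<longlonglongrightarrow> measure \<nu>0 UNIV"
        using weak[of "\<lambda>_. 1" 0 1] by simp
      have A: "A \<in> sets borel" using compl(1) by (simp add: borel_eq_atMost)
      have "measure (\<nu> n) (UNIV - A) = measure (\<nu> n) UNIV - measure (\<nu> n) A" for n
        using \<nu>.finite_measure_compl[of A n] A by (simp add: nu(2))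
      moreover have "measure \<nu>0 (UNIV - A) = measure \<nu>0 UNIV - measure \<nu>0 A"
        using \<nu>0.finite_measure_compl[of A] A by (simp add: nu0(2))
      ultimately show ?case using tendsto_diff[OF top compl(2)] by simp
    next
      case (union A)
      have A: "A i \<in> sets borel" for i using union(2) by (auto simp: borel_eq_atMost)
      show ?case
      proof (rule tendsto_by_approximation)
        fix e :: real assume e: "e > 0"
        define D where "D k = (\<Union>i. A i) - (\<Union>i<k. A i)" for k
        have "D k \<in> sets borel" for k unfolding D_def using A by (intro sets.Diff sets.countable_UN sets.finite_UN) auto
        moreover have "decseq D" unfolding D_def decseq_def by (intro allI impI Diff_mono UN_mono) auto
        moreover have "(\<Inter>k. D k) = {}" unfolding D_def by auto
        ultimately obtain k where k: "\<And>n. measure (\<nu> n) (D k) \<le> e" "measure \<nu>0 (D k) \<le> e"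
          using small[of D e] e by auto
        have near: "\<bar>measure N (\<Union>i. A i) - (\<Sum>i<k. measure N (A i))\<bar> \<le> e"
          if N: "finite_measure N" "sets N = sets borel" "measure N (D k) \<le> e" for N
        proof -
          interpret N: finite_measure N by fact
          have "measure N (D k) = measure N (\<Union>i. A i) - measure N (\<Union>i<k. A i)"
            unfolding D_def by (rule N.finite_measure_Diff) (use A N(2) in auto)
          moreover have "measure N (\<Union>i<k. A i) = (\<Sum>i<k. measure N (A i))"
            by (rule N.finite_measure_finite_Union)
              (use A N(2) disjoint_family_on_mono[OF subset_UNIV union(1)] in auto)
          ultimately show ?thesis using N(3) measure_nonneg[of N "D k"] by simp
        qed
        have n1: "\<bar>measure (\<nu> n) (\<Union>i. A i) - (\<Sum>i<k. measure (\<nu> n) (A i))\<bar> \<le> e" for n by (rule near[OF nu(1,2) k(1)])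
        have n2: "\<bar>measure \<nu>0 (\<Union>i. A i) - (\<Sum>i<k. measure \<nu>0 (A i))\<bar> \<le> e" by (rule near[OF nu0(1,2) k(2)])
        have n3: "(\<lambda>n. \<Sum>i<k. measure (\<nu> n) (A i)) \<longlonglongrightarrow> (\<Sum>i<k. measure \<nu>0 (A i))"
          by (intro tendsto_sum union(3))
        show "\<exists>y l. y \<longlonglongrightarrow> l \<and> (\<forall>n. \<bar>measure (\<nu> n) (\<Union> (range A)) - y n\<bar> \<le> e) \<and> \<bar>measure \<nu>0 (\<Union> (range A)) - l\<bar> \<le> e"
          by (intro exI[of _ "\<lambda>n. \<Sum>i<k. measure (\<nu> n) (A i)"] exI[of _ "\<Sum>i<k. measure \<nu>0 (A i)"] conjI allI n1 n2 n3)
      qed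
    qed
  qed
  have limit0: "(\<lambda>n. \<integral>y. a0 y \<partial>\<nu> n) \<longlonglongrightarrow> (\<integral>y. a0 y \<partial>\<nu>0)"
  proof (rule tendsto_integral_of_levels)
    have "{y. a0 y > r} \<in> sets borel" for r
      using borel_measurable_less[OF borel_measurable_const a0(1), of r] by simp
    then show "(\<lambda>n. measure (\<nu> n) {y\<in>space (\<nu> n). a0 y > r}) \<longlonglongrightarrow> measure \<nu>0 {y\<in>space \<nu>0. a0 y > r}" for r
      using setwise by simp
    show "measure (\<nu> n) (space (\<nu> n)) \<le> 1" "measure \<nu>0 (space \<nu>0) \<le> 1" for n
      using nu(3) nu0(3) by simp_all
  qed (rule nu nu0 a0 mb)+
  have C: "C \<ge> 0" using a0(2)[of 0] by linarith
  have "(\<lambda>n. (\<integral>y. a n y \<partial>\<nu> n) - (\<integral>y. a0 y \<partial>\<nu> n)) \<longlonglongrightarrow> 0"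
  proof (rule LIMSEQ_I)
    fix r :: real assume r: "r > 0"
    define e where "e = r / (4 * (C + 1))"
    have e: "e > 0" using r C by (simp add: e_def)
    obtain d where d: "d > 0" "\<And>B. B \<in> sets borel \<Longrightarrow> measure \<mu> B < d \<Longrightarrow> \<forall>n. measure (\<nu> n) B \<le> e"
      using uac[OF e] by auto
    define S where "S n = {y. \<bar>a n y - a0 y\<bar> > e}" for n
    have S: "S n \<in> sets borel" for n unfolding S_def using a(1)[of n] a0(1) by measurable
    have "eventually (\<lambda>n. measure \<mu> (S n) < d) sequentially"
      using conv[OF e] d(1) unfolding S_def by (rule order_tendstoD(2))
    then obtain n0 where n0: "\<And>n. n \<ge> n0 \<Longrightarrow> measure \<mu> (S n) < d" by (auto simp: eventually_sequentially)
    have "\<bar>(\<integral>y. a n y \<partial>\<nu> n) - (\<integral>y. a0 y \<partial>\<nu> n)\<bar> < r" if n: "n \<ge> n0" for n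
    proof -
      have i: "integrable (\<nu> n) (a n)" "integrable (\<nu> n) a0"
        by (rule \<nu>.integrable_const_bound[where B = C]; use a a0 in \<open>simp add: mb\<close>)+
      have j: "integrable (\<nu> n) (\<lambda>y. indicator (S n) y :: real)"
        using S[of n] by (intro \<nu>.integrable_const_bound[where B = 1] borel_measurable_indicator) (auto simp: nu(2))
      have "\<bar>(\<integral>y. a n y \<partial>\<nu> n) - (\<integral>y. a0 y \<partial>\<nu> n)\<bar> \<le> (\<integral>y. \<bar>a n y - a0 y\<bar> \<partial>\<nu> n)"
        using i integral_norm_bound[of "\<nu> n" "\<lambda>y. a n y - a0 y"] by simp
      also have "\<dots> \<le> (\<integral>y. e + 2 * C * indicator (S n) y \<partial>\<nu> n)"
      proof (rule integral_mono)
        fix y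
        show "\<bar>a n y - a0 y\<bar> \<le> e + 2 * C * indicator (S n) y"
          using a(2)[of n y] a0(2)[of y] e by (auto simp: S_def indicator_def)
      qed (use i j in auto)
      also have "\<dots> = e * measure (\<nu> n) UNIV + 2 * C * measure (\<nu> n) (S n)"
        using j by (simp add: mult.commute)
      also have "\<dots> \<le> e * 1 + 2 * C * e"
        using nu(3)[of n] d(2)[OF S n0[OF n]] e C by (intro add_mono mult_left_mono) auto
      also have "\<dots> < 4 * (C + 1) * e"
        using e C by (simp add: algebra_simps add_pos_nonneg)
      also have "\<dots> = r" using C by (simp add: e_def)
      finally show ?thesis .
    qed
    then show "\<exists>n0. \<forall>n\<ge>n0. norm ((\<integral>y. a n y \<partial>\<nu> n) - (\<integral>y. a0 y \<partial>\<nu> n) - 0) < r" by auto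
  qed
  from tendsto_add[OF this limit0] show ?thesis by simp
qed

text \<open>The image under \<open>Y\<close> of the probability weighted by \<open>g\<close>. Taking indicators of rectangles for \<open>g\<close>
  turns expectations over events into integrals against measures on the line.\<close>

lemma (in prob_space) weighted_law:
  fixes g :: "'a \<Rightarrow> real" and Y :: "'a \<Rightarrow> real"
  assumes g[measurable]: "g \<in> borel_measurable M" and g01: "\<And>x. 0 \<le> g x" "\<And>x. g x \<le> 1"
    and Y[measurable]: "Y \<in> borel_measurable M"
  defines "\<nu> \<equiv> distr (density M (\<lambda>x. ennreal (g x))) borel Y"
  shows "finite_measure \<nu>" "sets \<nu> = sets borel" "measure \<nu> UNIV \<le> 1"
    and "\<And>B. B \<in> sets borel \<Longrightarrow> measure \<nu> B \<le> prob {x\<in>space M. Y x \<in> B}"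
    and "\<And>f. f \<in> borel_measurable borel \<Longrightarrow> (\<integral>y. f y \<partial>\<nu>) = (\<integral>x. g x * f (Y x) \<partial>M)"
proof -
  show s: "sets \<nu> = sets borel" by (simp add: \<nu>_def)
  have em: "emeasure \<nu> B \<le> emeasure M {x\<in>space M. Y x \<in> B}" if B[measurable]: "B \<in> sets borel" for B
  proof -
    have B': "Y -` B \<inter> space M \<in> sets M" by measurable
    have "emeasure \<nu> B = (\<integral>\<^sup>+x. ennreal (g x) * indicator (Y -` B \<inter> space M) x \<partial>M)"
      unfolding \<nu>_def using B' by (subst emeasure_distr) (auto simp: emeasure_density)
    also have "\<dots> \<le> (\<integral>\<^sup>+x. indicator (Y -` B \<inter> space M) x \<partial>M)"
      using g01 by (intro nn_integral_mono) (auto simp: indicator_def ennreal_le_1)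
    also have "\<dots> = emeasure M (Y -` B \<inter> space M)" by (rule nn_integral_indicator[OF B'])
    also have "Y -` B \<inter> space M = {x\<in>space M. Y x \<in> B}" by auto
    finally show ?thesis .
  qed
  have sp: "space \<nu> = UNIV" by (simp add: \<nu>_def)
  have "emeasure \<nu> UNIV \<le> 1" using em[of UNIV] emeasure_space_1 by simp
  then show fin: "finite_measure \<nu>"
    by (intro finite_measureI) (auto simp: sp top_unique)
  show "measure \<nu> B \<le> prob {x\<in>space M. Y x \<in> B}" if "B \<in> sets borel" for B
    using em[OF that] finite_measure.emeasure_eq_measure[OF fin, of B] by (simp add: emeasure_eq_measure)
  from this[of UNIV] show "measure \<nu> UNIV \<le> 1" using prob_space by simp
  show "(\<integral>y. f y \<partial>\<nu>) = (\<integral>x. g x * f (Y x) \<partial>M)" if [measurable]: "f \<in> borel_measurable borel" for f :: "real \<Rightarrow> real"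
  proof -
    have "(\<integral>y. f y \<partial>\<nu>) = (\<integral>x. f (Y x) \<partial>density M (\<lambda>x. ennreal (g x)))"
      unfolding \<nu>_def by (rule integral_distr) simp_all
    also have "\<dots> = (\<integral>x. g x * f (Y x) \<partial>M)"
      by (rule integral_real_density) (use g01 in simp_all)
    finally show ?thesis .
  qed
qed

text \<open>Where the density is at most \<open>c\<close> the probability is at most \<open>c\<close> times the measure of the set;
  the remaining mass is small uniformly in the index.\<close>

lemma uniformly_integrable_densities_small:
  fixes p :: "'i \<Rightarrow> real \<Rightarrow> real" and Y :: "'i \<Rightarrow> 'a \<Rightarrow> real"
  assumes "prob_space M" and mu: "finite_measure \<mu>" "sets \<mu> = sets borel"
    and ui: "uniformly_integrable \<mu> I p"
    and p: "\<And>n y. n \<in> I \<Longrightarrow> 0 \<le> p n y" "\<And>n. n \<in> I \<Longrightarrow> distributed M \<mu> (Y n) (\<lambda>y. ennreal (p n y))"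
    and e: "e > 0"
  shows "\<exists>d>0. \<forall>B\<in>sets borel. measure \<mu> B < d \<longrightarrow> (\<forall>n\<in>I. measure M {w\<in>space M. Y n w \<in> B} \<le> e)"
proof -
  interpret prob_space M by fact
  interpret \<mu>: finite_measure \<mu> by fact
  define T where "T c = (SUP n\<in>I. \<integral>\<^sup>+y\<in>{y. \<bar>p n y\<bar> > c}. ennreal \<bar>p n y\<bar> \<partial>\<mu>)" for c
  have "(T \<longlongrightarrow> 0) at_top" using ui unfolding uniformly_integrable_def T_def by simp
  then have "eventually (\<lambda>c. T c < ennreal (e / 2)) at_top" using e by (intro order_tendstoD(2)) auto
  then have "eventually (\<lambda>c. T c < ennreal (e / 2) \<and> c \<ge> 1) at_top"
    by (intro eventually_conj eventually_ge_at_top)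
  then obtain c where c: "T c < ennreal (e / 2)" "c \<ge> 1" by (auto simp: eventually_at_top_linorder)
  have "prob {w\<in>space M. Y n w \<in> B} \<le> e"
    if B: "B \<in> sets borel" "measure \<mu> B < e / (2 * c)" and n: "n \<in> I" for B n
  proof -
    have pm[measurable]: "p n \<in> borel_measurable \<mu>" using ui n by (simp add: uniformly_integrable_def)
    have [measurable]: "B \<in> sets \<mu>" using B mu(2) by simp
    have S[measurable]: "{y. \<bar>p n y\<bar> > c} \<in> sets \<mu>"
    proof -
      have "{y\<in>space \<mu>. \<bar>p n y\<bar> > c} \<in> sets \<mu>" by measurable
      moreover have "space \<mu> = UNIV" using sets_eq_imp_space_eq[OF mu(2)] by simp
      ultimately show ?thesis by simp
    qed
    have "emeasure M {w\<in>space M. Y n w \<in> B} = emeasure M (Y n -` B \<inter> space M)"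
      by (rule arg_cong[where f = "emeasure M"]) auto
    also have "\<dots> = (\<integral>\<^sup>+y. ennreal (p n y) * indicator B y \<partial>\<mu>)"
      by (rule distributed_emeasure[OF p(2)[OF n]]) simp
    also have "\<dots> \<le> (\<integral>\<^sup>+y. ennreal c * indicator B y + ennreal \<bar>p n y\<bar> * indicator {y. \<bar>p n y\<bar> > c} y \<partial>\<mu>)"
    proof (rule nn_integral_mono)
      fix y
      show "ennreal (p n y) * indicator B y \<le> ennreal c * indicator B y + ennreal \<bar>p n y\<bar> * indicator {y. \<bar>p n y\<bar> > c} y"
        using p(1)[OF n, of y] c(2) by (auto simp: indicator_def intro!: ennreal_leI add_increasing)
    qed
    also have "\<dots> = ennreal c * emeasure \<mu> B + (\<integral>\<^sup>+y\<in>{y. \<bar>p n y\<bar> > c}. ennreal \<bar>p n y\<bar> \<partial>\<mu>)"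
      by (subst nn_integral_add) (auto simp: nn_integral_cmult_indicator)
    also have "\<dots> \<le> ennreal (e / 2) + ennreal (e / 2)"
    proof (rule add_mono)
      have "c * measure \<mu> B \<le> e / 2" using B(2) c(2) by (simp add: field_simps)
      then show "ennreal c * emeasure \<mu> B \<le> ennreal (e / 2)"
        using c(2) by (simp add: \<mu>.emeasure_eq_measure ennreal_mult[symmetric] ennreal_leI)
      show "(\<integral>\<^sup>+y\<in>{y. \<bar>p n y\<bar> > c}. ennreal \<bar>p n y\<bar> \<partial>\<mu>) \<le> ennreal (e / 2)"
        using c(1) n by (auto simp: T_def intro: SUP_upper order_trans less_imp_le)
    qed
    also have "\<dots> = ennreal e" using e by (simp add: ennreal_plus[symmetric] del: ennreal_plus)
    finally show ?thesis using e by (simp add: emeasure_eq_measure)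
  qed
  then show ?thesis using e c(2) by (intro exI[of _ "e / (2 * c)"]) auto
qed

context stable_limit
begin

section \<open>Rectangles and the enlarged filtration\<close>

lemma pattern_rectangle_generate:
  "sets Q = sigma_sets (space Q) {rectangle A I | A I. A \<in> sets M \<and> finite I}"
proof (rule antisym)
  let ?R = "{rectangle A I | A (I :: 'i set). A \<in> sets M \<and> finite I}"
  show "sigma_sets (space Q) ?R \<subseteq> sets Q"
    by (rule sets.sigma_sets_subset) (auto intro: cylinder_sets[OF rectangle_cylinder])
  have RP: "?R \<subseteq> Pow (space Q)" using sets.sets_into_space by (fastforce simp: space_Q)
  define K where "K = sigma (space Q) ?R"
  have K: "space K = space Q" "sets K = sigma_sets (space Q) ?R"
    unfolding K_def using RP by (auto intro: space_measure_of sets_measure_of)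
  have rect: "rectangle A I \<in> sets K" if "A \<in> sets M" "finite I" for A and I :: "'i set"
    unfolding K(2) using that by (intro sigma_sets.Basic) auto
  have fstK: "{z\<in>space K. fst z \<in> A} \<in> sets K" if A: "A \<in> sets M" for A
  proof -
    have "{z\<in>space K. fst z \<in> A} = rectangle A {}"
      using sets.sets_into_space[OF A] by (auto simp: K(1) space_Q)
    then show ?thesis using rect[OF A, of "{}"] by simp
  qed
  have sndK: "{z\<in>space K. snd z i} \<in> sets K" for i
  proof -
    have "{z\<in>space K. snd z i} = rectangle (space M) {i}" by (auto simp: K(1) space_Q)
    then show ?thesis using rect[OF sets.top, of "{i}"] by simp
  qed
  have "D \<in> sets K" if D: "D \<in> cylinder_algebra M" for D :: "('a \<times> ('i \<Rightarrow> bool)) set"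
  proof -
    obtain J where J: "D \<subseteq> space M \<times> UNIV" "\<forall>c. {w. (w, c) \<in> D} \<in> sets M" "finite J"
      "depends_only_on J D" using D by (rule cylinder_algebraE)
    let ?P = "\<lambda>S z. fst z \<in> {w. (w, \<lambda>i. i \<in> S) \<in> D} \<and> (\<forall>i\<in>J. snd z i \<longleftrightarrow> i \<in> S)"
    have "D = {z\<in>space K. \<exists>S\<in>Pow J. ?P S z}"
    proof (intro set_eqI iffI)
      fix z assume z: "z \<in> D"
      have "(fst z, snd z) \<in> D \<longleftrightarrow> (fst z, \<lambda>i. i \<in> {i\<in>J. snd z i}) \<in> D"
        by (rule depends_only_on_iff[OF J(4)]) simp
      then show "z \<in> {z\<in>space K. \<exists>S\<in>Pow J. ?P S z}"
        using z J(1) by (auto simp: K(1) space_Q intro!: bexI[of _ "{i\<in>J. snd z i}"])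
    next
      fix z assume "z \<in> {z\<in>space K. \<exists>S\<in>Pow J. ?P S z}"
      then obtain S where S: "?P S z" by blast
      have "(fst z, snd z) \<in> D \<longleftrightarrow> (fst z, \<lambda>i. i \<in> S) \<in> D"
        by (rule depends_only_on_iff[OF J(4)]) (use S in simp)
      then show "z \<in> D" using S by simp
    qed
    also have "\<dots> \<in> sets K"
    proof (rule sets.sets_Collect_finite_Ex)
      fix S
      have A: "{z\<in>space K. fst z \<in> {w. (w, \<lambda>i. i \<in> S) \<in> D}} \<in> sets K" by (rule fstK) (use J(2) in blast)
      have B: "{z\<in>space K. \<forall>i\<in>J. snd z i \<longleftrightarrow> i \<in> S} \<in> sets K"
        by (rule pattern_sets[OF sndK J(3)])
      show "{z\<in>space K. ?P S z} \<in> sets K" by (rule sets.sets_Collect_conj[OF B A])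
    qed (use J(3) in simp)
    finally show ?thesis .
  qed
  then have "cylinder_algebra M \<subseteq> sets K" by blast
  then have "sigma_sets (space K) (cylinder_algebra M) \<subseteq> sets K" by (rule sets.sigma_sets_subset)
  then show "sets Q \<subseteq> sigma_sets (space Q) ?R" unfolding sets_Q K(1) space_Q K(2)[unfolded space_Q] .
qed

text \<open>Rectangles form a \<open>\<pi>\<close>-system that generates the \<open>\<sigma>\<close>-algebra, so equations for random variables
  on the limit space may be verified in the weak sense in which they arise as limits.\<close>

lemma AE_zero_by_rectangles:
  fixes f :: "'a \<times> ('i \<Rightarrow> bool) \<Rightarrow> real"
  assumes f[measurable]: "f \<in> borel_measurable Q" and B: "AE z in Q. \<bar>f z\<bar> \<le> B"
    and zero: "\<And>A I. A \<in> sets M \<Longrightarrow> finite I \<Longrightarrow> (\<integral>z. indicator A (fst z) * of_bool (\<forall>i\<in>I. snd z i) * f z \<partial>Q) = 0"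
  shows "AE z in Q. f z = 0"
proof -
  let ?R = "{rectangle A I | A (I :: 'i set). A \<in> sets M \<and> finite I}"
  have fi: "integrable Q f" by (rule Q.integrable_const_bound[where B = B]) (use B in simp_all)
  have ind: "indicator (rectangle A I) z = (indicator A (fst z) * of_bool (\<forall>i\<in>I. snd z i) :: real)"
    for A z and I :: "'i set" by (auto simp: indicator_def)
  have st: "Int_stable ?R"
  proof (rule Int_stableI)
    fix D D' assume "D \<in> ?R" "D' \<in> ?R"
    then obtain A I A' I' where D: "D = rectangle A I" "A \<in> sets M" "finite I"
      and D': "D' = rectangle A' I'" "A' \<in> sets M" "finite I'" by auto
    have "D \<inter> D' = rectangle (A \<inter> A') (I \<union> I')" unfolding D(1) D'(1) by auto
    then show "D \<inter> D' \<in> ?R" using D D' by blast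
  qed
  have RQ: "?R \<subseteq> sets Q" by (auto intro: cylinder_sets[OF rectangle_cylinder])
  then have RP: "?R \<subseteq> Pow (space Q)" using sets.sets_into_space by blast
  have top: "(\<integral>z. f z \<partial>Q) = 0"
  proof -
    have "(\<integral>z. f z \<partial>Q) = (\<integral>z. indicator (space M) (fst z) * of_bool (\<forall>i\<in>{}. snd z i) * f z \<partial>Q)"
      by (rule Bochner_Integration.integral_cong) (auto simp: space_Q)
    then show ?thesis using zero[OF sets.top, of "{}"] by simp
  qed
  have "(\<integral>z. indicator D z * f z \<partial>Q) = 0" if "D \<in> sets Q" for D
    using st RP that[unfolded pattern_rectangle_generate]
  proof (induction rule: sigma_sets_induct_disjoint)
    case (basic D)
    then obtain A I where D: "D = rectangle A I" "A \<in> sets M" "finite I" by auto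
    show ?case unfolding D(1) ind by (rule zero[OF D(2,3)])
  next
    case empty
    then show ?case by simp
  next
    case (compl D)
    have D[measurable]: "D \<in> sets Q" using compl(1) unfolding pattern_rectangle_generate[symmetric] .
    have "(\<integral>z. indicator (space Q - D) z * f z \<partial>Q) = (\<integral>z. f z - indicator D z * f z \<partial>Q)"
      by (rule Bochner_Integration.integral_cong) (auto simp: indicator_def)
    also have "\<dots> = 0"
      using fi compl(2) top integrable_mult_indicator[OF D fi] by simp
    finally show ?case .
  next
    case (union D)
    have D: "D i \<in> sets Q" for i using union(2) unfolding pattern_rectangle_generate[symmetric] by blast
    have "(\<integral>z\<in>(\<Union>i. D i). f z \<partial>Q) = (\<Sum>i. \<integral>z\<in>D i. f z \<partial>Q)"
    proof (rule lebesgue_integral_countable_add)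
      show "set_integrable Q (\<Union>i. D i) f"
        unfolding set_integrable_def using D by (intro integrable_mult_indicator fi) auto
      show "D i \<inter> D j = {}" if "i \<noteq> j" for i j
        using union(1) that by (simp add: disjoint_family_on_def)
    qed (rule D)
    then show ?case using union(3) by (simp add: set_lebesgue_integral_def)
  qed
  note z = this
  have "{z\<in>space Q. f z > 0} \<in> sets Q" "{z\<in>space Q. f z < 0} \<in> sets Q" by measurable
  from z[OF this(1)] z[OF this(2)] have "(\<integral>z. indicator {z\<in>space Q. f z > 0} z * f z - indicator {z\<in>space Q. f z < 0} z * f z \<partial>Q) = 0"
    using integrable_mult_indicator[OF _ fi] by (subst Bochner_Integration.integral_diff) auto
  moreover have "(\<integral>z. indicator {z\<in>space Q. f z > 0} z * f z - indicator {z\<in>space Q. f z < 0} z * f z \<partial>Q) = (\<integral>z. \<bar>f z\<bar> \<partial>Q)"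
    by (rule Bochner_Integration.integral_cong) (auto simp: indicator_def)
  ultimately have "(\<integral>z. \<bar>f z\<bar> \<partial>Q) = 0" by simp
  then have "AE z in Q. \<bar>f z\<bar> = 0"
    using integral_nonneg_eq_0_iff_AE[of Q "\<lambda>z. \<bar>f z\<bar>"] fi by simp
  then show ?thesis by simp
qed

text \<open>The function \<open>\<tau>\<close> dates the coordinates of the code; at time \<open>t\<close> the original past is known
  together with all coordinates dated up to \<open>t\<close>.\<close>

definition extended_filtration :: "(real \<Rightarrow> 'a measure) \<Rightarrow> ('i \<Rightarrow> real) \<Rightarrow> real \<Rightarrow> ('a \<times> ('i \<Rightarrow> bool)) measure" where
  "extended_filtration F \<tau> t = sigma (space Q)
     {rectangle A I | A I. A \<in> sets (F t) \<and> finite I \<and> (\<forall>i\<in>I. \<tau> i \<le> t)}"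

lemma extended_filtration:
  assumes fps: "filtered_prob_space M F"
  shows extended_filtration_space: "t \<ge> 0 \<Longrightarrow> space (extended_filtration F \<tau> t) = space Q"
    and extended_filtration_sets: "t \<ge> 0 \<Longrightarrow> sets (extended_filtration F \<tau> t) = sigma_sets (space Q)
      {rectangle A I | A I. A \<in> sets (F t) \<and> finite I \<and> (\<forall>i\<in>I. \<tau> i \<le> t)}"
    and extended_filtered_prob_space: "filtered_prob_space Q (extended_filtration F \<tau>)"
    and extended_filtration_fst: "t \<ge> 0 \<Longrightarrow> fst \<in> measurable (extended_filtration F \<tau> t) (F t)"
    and extended_filtration_snd: "t \<ge> 0 \<Longrightarrow> \<tau> i \<le> t \<Longrightarrow>
      {z\<in>space (extended_filtration F \<tau> t). snd z i} \<in> sets (extended_filtration F \<tau> t)"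
proof -
  let ?R = "\<lambda>t. {rectangle A I | A I. A \<in> sets (F t) \<and> finite I \<and> (\<forall>i\<in>I. \<tau> i \<le> t)}"
  have F: "space (F t) = space M" "sets (F t) \<subseteq> sets M" if "t \<ge> 0" for t
    using fps that by (auto simp: filtered_prob_space_def subalgebra_def)
  have RQ: "?R t \<subseteq> sets Q" if "t \<ge> 0" for t
    using F(2)[OF that] by (auto intro!: cylinder_sets[OF rectangle_cylinder])
  then have RP: "?R t \<subseteq> Pow (space Q)" if "t \<ge> 0" for t
    using that sets.sets_into_space by blast
  show sp: "space (extended_filtration F \<tau> t) = space Q" if "t \<ge> 0" for t
    unfolding extended_filtration_def by (rule space_measure_of[OF RP[OF that]])
  show st: "sets (extended_filtration F \<tau> t) = sigma_sets (space Q) (?R t)" if "t \<ge> 0" for t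
    unfolding extended_filtration_def by (rule sets_measure_of[OF RP[OF that]])
  have basic: "rectangle A I \<in> sets (extended_filtration F \<tau> t)"
    if "t \<ge> 0" "A \<in> sets (F t)" "finite I" "\<forall>i\<in>I. \<tau> i \<le> t" for t A I
    unfolding st[OF that(1)] using that(2-) by (intro sigma_sets.Basic) auto
  show "filtered_prob_space Q (extended_filtration F \<tau>)"
    unfolding filtered_prob_space_def
  proof (intro conjI allI impI)
    show "prob_space Q" by (rule prob_Q)
    fix t :: real assume t: "t \<ge> 0"
    show "subalgebra Q (extended_filtration F \<tau> t)"
      unfolding subalgebra_def sp[OF t] st[OF t] using sets.sigma_sets_subset[OF RQ[OF t]] by simp
  next
    fix s t :: real assume s: "0 \<le> s" "s \<le> t"
    then have t: "0 \<le> t" by simp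
    have "sets (F s) \<subseteq> sets (F t)" using fps s unfolding filtered_prob_space_def by blast
    then have "?R s \<subseteq> ?R t" using s(2) by (fastforce intro: order_trans)
    then show "sets (extended_filtration F \<tau> s) \<subseteq> sets (extended_filtration F \<tau> t)"
      unfolding st[OF s(1)] st[OF t] by (rule sigma_sets_mono')
  qed
  show "fst \<in> measurable (extended_filtration F \<tau> t) (F t)" if t: "t \<ge> 0" for t
  proof (rule measurableI)
    fix A assume A: "A \<in> sets (F t)"
    have "fst -` A \<inter> space (extended_filtration F \<tau> t) = rectangle A {}"
      using sets.sets_into_space[OF A] by (auto simp: sp[OF t] space_Q F(1)[OF t])
    then show "fst -` A \<inter> space (extended_filtration F \<tau> t) \<in> sets (extended_filtration F \<tau> t)"
      using basic[OF t A, of "{}"] by simp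
  qed (auto simp: sp[OF t] space_Q F(1)[OF t])
  show "{z\<in>space (extended_filtration F \<tau> t). snd z i} \<in> sets (extended_filtration F \<tau> t)"
    if t: "t \<ge> 0" "\<tau> i \<le> t" for t i
  proof -
    have "{z\<in>space (extended_filtration F \<tau> t). snd z i} = rectangle (space (F t)) {i}"
      by (auto simp: sp[OF t(1)] space_Q F(1)[OF t(1)])
    then show ?thesis using basic[OF t(1) sets.top, of "{i}"] t(2) by simp
  qed
qed

text \<open>Independence of the increments from the enlarged past is an identity between probabilities of
  rectangles. It holds before the limit because the codes are adapted, and the
  probabilities of rectangles converge.\<close>

lemma extended_levy_process:
  assumes fps: "filtered_prob_space M F" and levy: "levy_process M F Z"
    and adapted: "\<And>k i t. t \<ge> 0 \<Longrightarrow> \<tau> i \<le> t \<Longrightarrow> {w\<in>space M. X k w i} \<in> sets (F t)"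
  shows "levy_process Q (extended_filtration F \<tau>) (\<lambda>t z. Z t (fst z))"
    and "process_law Q (\<lambda>t z. Z t (fst z)) = process_law M Z"
proof -
  note efl = extended_filtration[OF fps, where \<tau> = \<tau>]
  have F: "space (F t) = space M" "sets (F t) \<subseteq> sets M" if "t \<ge> 0" for t
    using fps that by (auto simp: filtered_prob_space_def subalgebra_def)
  have ZF: "Z t \<in> borel_measurable (F t)" if "t \<ge> 0" for t
    using levy that by (auto simp: levy_process_def adapted_process_def)
  have Z[measurable]: "Z t \<in> borel_measurable M" if "t \<ge> 0" for t
    by (rule measurable_from_subalg[OF _ ZF[OF that]]) (use fps that in \<open>auto simp: filtered_prob_space_def\<close>)
  have law: "distr Q borel (\<lambda>z. f (fst z)) = distr M borel f" if "f \<in> borel_measurable M" for f :: "'a \<Rightarrow> real"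
    using distr_distr[OF that measurable_fst_Q] by (simp add: distr_fst comp_def)
  have law': "distr Q K (\<lambda>z. f (fst z)) = distr M K f" if "f \<in> measurable M K" for f and K :: "(real \<Rightarrow> real) measure"
    using distr_distr[OF that measurable_fst_Q] by (simp add: distr_fst comp_def)
  show "process_law Q (\<lambda>t z. Z t (fst z)) = process_law M Z"
    unfolding process_law_def by (rule law') (intro measurable_restrict Z, simp)
  show "levy_process Q (extended_filtration F \<tau>) (\<lambda>t z. Z t (fst z))"
    unfolding levy_process_def
  proof (intro conjI allI impI ballI)
    show "adapted_process (extended_filtration F \<tau>) (\<lambda>t z. Z t (fst z))"
      unfolding adapted_process_def
      using measurable_compose[OF efl(4) ZF] by blast
  next
    fix z assume "z \<in> space Q"
    then have "fst z \<in> space M" by (auto simp: space_Q)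
    then show "cadlag_path (\<lambda>t. Z t (fst z))" "Z 0 (fst z) = 0" using levy by (auto simp: levy_process_def)
  next
    fix s t :: real assume st: "s \<ge> 0" "t \<ge> 0"
    have "distr M borel (\<lambda>w. Z (t + s) w - Z t w) = distr M borel (\<lambda>w. Z s w - Z 0 w)"
      using levy st by (simp add: levy_process_def)
    moreover have "distr Q borel (\<lambda>z. Z (t + s) (fst z) - Z t (fst z)) = distr M borel (\<lambda>w. Z (t + s) w - Z t w)"
      by (rule law[of "\<lambda>w. Z (t + s) w - Z t w"]) (use st in \<open>intro borel_measurable_diff Z; simp\<close>)
    moreover have "distr Q borel (\<lambda>z. Z s (fst z) - Z 0 (fst z)) = distr M borel (\<lambda>w. Z s w - Z 0 w)"
      by (rule law[of "\<lambda>w. Z s w - Z 0 w"]) (use st in \<open>intro borel_measurable_diff Z; simp\<close>)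
    ultimately show "distr Q borel (\<lambda>z. Z (t + s) (fst z) - Z t (fst z)) = distr Q borel (\<lambda>z. Z s (fst z) - Z 0 (fst z))"
      by simp
  next
    fix s t :: real assume st: "s \<ge> 0" "t \<ge> 0"
    let ?R = "{rectangle A I | A I. A \<in> sets (F t) \<and> finite I \<and> (\<forall>i\<in>I. \<tau> i \<le> t)}"
    let ?D = "\<lambda>w. Z (t + s) w - Z t w"
    let ?S = "{(\<lambda>z. ?D (fst z)) -` B \<inter> space Q | B. B \<in> sets borel}"
    have Dm: "?D \<in> borel_measurable M" using st by (intro borel_measurable_diff Z) auto
    have DmQ: "(\<lambda>z. ?D (fst z)) \<in> borel_measurable Q" by (rule measurable_compose[OF measurable_fst_Q Dm])
    have RQ: "?R \<subseteq> sets Q"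
      using F(2)[OF st(2)] by (auto intro!: cylinder_sets[OF rectangle_cylinder])
    have ind: "M.indep_set (sets (F t)) {?D -` B \<inter> space M | B. B \<in> sets borel}"
      using levy st by (simp add: levy_process_def)
    have "Q.indep_set ?R ?S"
    proof (rule Q.indep_setI)
      show "?S \<subseteq> Q.events" using measurable_sets[OF DmQ] by auto
      fix a b assume "a \<in> ?R" "b \<in> ?S"
      then obtain A I B where a: "a = rectangle A I" "A \<in> sets (F t)" "finite I" "\<forall>i\<in>I. \<tau> i \<le> t"
        and b: "b = (\<lambda>z. ?D (fst z)) -` B \<inter> space Q" "B \<in> sets borel" by auto
      define E where "E = ?D -` B \<inter> space M"
      have E: "E \<in> sets M" unfolding E_def by (rule measurable_sets[OF Dm b(2)])
      have A: "A \<in> sets M" using a(2) F(2)[OF st(2)] by auto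
      have ab: "a \<inter> b = rectangle (A \<inter> E) I"
        using sets.sets_into_space[OF A] unfolding a(1) b(1) E_def by (auto simp: space_Q)
      have bE: "b = rectangle E {}"
        unfolding b(1) E_def by (auto simp: space_Q)
      have AI: "{w\<in>A. \<forall>i\<in>I. X k w i} \<in> sets (F t)" for k
      proof -
        have "{w\<in>space (F t). X k w i} \<in> sets (F t)" if "i \<in> I" for i
          using adapted[OF st(2), of i k] a(4) that F(1)[OF st(2)] by simp
        then have "{w\<in>space (F t). \<forall>i\<in>I. X k w i} \<in> sets (F t)"
          by (rule sets.sets_Collect_finite_All[OF _ a(3)])
        then have "A \<inter> {w\<in>space (F t). \<forall>i\<in>I. X k w i} \<in> sets (F t)" using a(2) by blast
        moreover have "A \<inter> {w\<in>space (F t). \<forall>i\<in>I. X k w i} = {w\<in>A. \<forall>i\<in>I. X k w i}"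
          using sets.sets_into_space[OF a(2)] by auto
        ultimately show ?thesis by simp
      qed
      have "M.prob {w\<in>A \<inter> E. \<forall>i\<in>I. X k w i} = M.prob {w\<in>A. \<forall>i\<in>I. X k w i} * M.prob E" for k
      proof -
        have "{w\<in>A \<inter> E. \<forall>i\<in>I. X k w i} = {w\<in>A. \<forall>i\<in>I. X k w i} \<inter> E" by auto
        moreover have "M.prob ({w\<in>A. \<forall>i\<in>I. X k w i} \<inter> E) = M.prob {w\<in>A. \<forall>i\<in>I. X k w i} * M.prob E"
          by (rule M.indep_setD[OF ind AI]) (use b(2) in \<open>auto simp: E_def\<close>)
        ultimately show ?thesis by simp
      qed
      then have "(\<lambda>k. M.prob {w\<in>A. \<forall>i\<in>I. X k w i} * M.prob E) \<longlonglongrightarrow> Q.prob (a \<inter> b)"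
        using rectangle_conv[OF sets.Int[OF A E] a(3)] unfolding ab by simp
      moreover have "(\<lambda>k. M.prob {w\<in>A. \<forall>i\<in>I. X k w i} * M.prob E) \<longlonglongrightarrow> Q.prob a * M.prob E"
        unfolding a(1) by (intro tendsto_mult_right rectangle_conv A a(3))
      moreover have "M.prob E = Q.prob b"
        using rectangle_conv[OF E, of "{}"] unfolding bE by (simp add: tendsto_const_iff)
      ultimately show "Q.prob (a \<inter> b) = Q.prob a * Q.prob b" using LIMSEQ_unique by fastforce
    qed (rule RQ)
    moreover have "Int_stable ?R"
    proof (rule Int_stableI)
      fix a b assume "a \<in> ?R" "b \<in> ?R"
      then obtain A I A' I' where a: "a = rectangle A I" "A \<in> sets (F t)" "finite I" "\<forall>i\<in>I. \<tau> i \<le> t"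
        and b: "b = rectangle A' I'" "A' \<in> sets (F t)" "finite I'" "\<forall>i\<in>I'. \<tau> i \<le> t" by auto
      have "a \<inter> b = rectangle (A \<inter> A') (I \<union> I')" unfolding a(1) b(1) by auto
      moreover have "A \<inter> A' \<in> sets (F t)" "finite (I \<union> I')" "\<forall>i\<in>I \<union> I'. \<tau> i \<le> t" using a b by auto
      ultimately show "a \<inter> b \<in> ?R" by blast
    qed
    moreover have "Int_stable ?S"
    proof (rule Int_stableI)
      fix a b assume "a \<in> ?S" "b \<in> ?S"
      then obtain B B' where "a = (\<lambda>z. ?D (fst z)) -` B \<inter> space Q" "B \<in> sets borel"
        "b = (\<lambda>z. ?D (fst z)) -` B' \<inter> space Q" "B' \<in> sets borel" by auto
      then have "a \<inter> b = (\<lambda>z. ?D (fst z)) -` (B \<inter> B') \<inter> space Q" "B \<inter> B' \<in> sets borel" by auto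
      then show "a \<inter> b \<in> ?S" by blast
    qed
    ultimately have "Q.indep_set (sigma_sets (space Q) ?R) (sigma_sets (space Q) ?S)"
      by (rule Q.indep_set_sigma_sets)
    then show "Q.indep_set (sets (extended_filtration F \<tau> t)) ?S"
      unfolding efl(2)[OF st(2)] Q.indep_sets2_eq by (auto intro: sigma_sets.Basic)
  qed
qed

end

section \<open>Decoding Lipschitz paths\<close>

text \<open>The triple \<open>(m, j, k)\<close> addresses the \<open>k\<close>-th binary digit of the value at time \<open>j / 2\<^sup>m\<close>.\<close>

type_synonym path_code = "nat \<times> nat \<times> nat \<Rightarrow> bool"

text \<open>A path with Lipschitz constant \<open>C\<close> and initial value bounded by \<open>B\<close> stays below \<open>B + C * t\<close>;
  the summand 1 makes the bound strict, as the expansion into digits requires.\<close>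

definition value_bound :: "real \<Rightarrow> real \<Rightarrow> nat \<Rightarrow> nat \<Rightarrow> real" where
  "value_bound B C m j = B + C * (real j / 2 ^ m) + 1"

definition encode_path :: "real \<Rightarrow> real \<Rightarrow> (real \<Rightarrow> real) \<Rightarrow> path_code" where
  "encode_path B C f = (\<lambda>(m, j, k). digit (value_bound B C m j) (f (real j / 2 ^ m)) k)"

definition dyadic_value :: "real \<Rightarrow> real \<Rightarrow> nat \<Rightarrow> nat \<Rightarrow> path_code \<Rightarrow> real" where
  "dyadic_value B C m j c = decode (value_bound B C m j) (\<lambda>k. c (m, j, k))"

definition lipschitz_code :: "real \<Rightarrow> real \<Rightarrow> path_code \<Rightarrow> bool" where
  "lipschitz_code B C c \<longleftrightarrow> (\<forall>m j m' j'.
     \<bar>dyadic_value B C m j c - dyadic_value B C m' j' c\<bar> \<le> C * \<bar>real j / 2 ^ m - real j' / 2 ^ m'\<bar>)"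

definition grid_value :: "real \<Rightarrow> real \<Rightarrow> nat \<Rightarrow> real \<Rightarrow> path_code \<Rightarrow> real" where
  "grid_value B C m t c = dyadic_value B C m (nat \<lfloor>2 ^ m * t\<rfloor>) c"

text \<open>Only grid times up to \<open>t\<close> enter the value at time \<open>t\<close>, so the decoded path is adapted for every
  code, not only for codes of Lipschitz paths.\<close>

definition decoded_path :: "real \<Rightarrow> real \<Rightarrow> real \<Rightarrow> path_code \<Rightarrow> real" where
  "decoded_path B C t c = lim (\<lambda>m. grid_value B C m t c)"

lemma dyadic_value_measurable:
  assumes "\<And>k. {z\<in>space N. g z (m, j, k)} \<in> sets N"
  shows "(\<lambda>z. dyadic_value B C m j (g z)) \<in> borel_measurable N"
proof -
  have [measurable]: "Measurable.pred N (\<lambda>z. g z (m, j, k))" for k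
    using assms[of k] by (simp add: pred_def)
  show ?thesis unfolding dyadic_value_def decode_def by measurable
qed

lemma decoded_path_measurable:
  assumes t: "t \<ge> 0" and g: "\<And>m j k. real j / 2 ^ m \<le> t \<Longrightarrow> {z\<in>space N. g z (m, j, k)} \<in> sets N"
  shows "(\<lambda>z. decoded_path B C t (g z)) \<in> borel_measurable N"
  unfolding decoded_path_def grid_value_def
  by (intro borel_measurable_lim_metric dyadic_value_measurable g dyadic_below(1)[OF t])

lemma decoded_path_jointly_measurable:
  assumes g: "\<And>i. {z\<in>space N. g z i} \<in> sets N"
  shows "(\<lambda>y. decoded_path B C (fst y) (g (snd y))) \<in> borel_measurable (borel \<Otimes>\<^sub>M N)"
  unfolding decoded_path_def grid_value_def
proof (rule borel_measurable_lim_metric)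
  fix m
  let ?f = "\<lambda>j (y :: real \<times> 'a). dyadic_value B C m j (g (snd y))"
  show "(\<lambda>y. ?f (nat \<lfloor>2 ^ m * fst y\<rfloor>) y) \<in> borel_measurable (borel \<Otimes>\<^sub>M N)"
  proof (rule measurable_compose_countable[where f = ?f and g = "\<lambda>y :: real \<times> 'a. nat \<lfloor>2 ^ m * fst y\<rfloor>"])
    show "?f j \<in> borel_measurable (borel \<Otimes>\<^sub>M N)" for j
      by (rule measurable_compose[OF measurable_snd dyadic_value_measurable]) (rule g)
  qed measurable
qed

context
  fixes B C :: real
  assumes BC: "B \<ge> 0" "C \<ge> 0"
begin

lemma value_bound_nonneg: "value_bound B C m j \<ge> 0"
  using BC by (simp add: value_bound_def)

lemma cylinder_continuous_grid_value: "cylinder_continuous (grid_value B C m t)"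
  unfolding grid_value_def dyadic_value_def by (rule cylinder_continuous_decode[OF value_bound_nonneg])

lemma cylinder_continuous_dyadic_value: "cylinder_continuous (dyadic_value B C m j)"
  unfolding dyadic_value_def by (rule cylinder_continuous_decode[OF value_bound_nonneg])

lemma grid_value_bound:
  assumes "t \<ge> 0"
  shows "\<bar>grid_value B C m t c\<bar> \<le> B + C * t + 1"
proof -
  have "\<bar>grid_value B C m t c\<bar> \<le> value_bound B C m (nat \<lfloor>2 ^ m * t\<rfloor>)"
    unfolding grid_value_def dyadic_value_def by (rule decode_bound[OF value_bound_nonneg])
  also have "\<dots> \<le> B + C * t + 1"
    unfolding value_bound_def using BC dyadic_below(1)[OF assms, of m]
    by (intro add_mono mult_left_mono) auto
  finally show ?thesis .
qed

lemma grid_value_convergent: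
  assumes c: "lipschitz_code B C c" and t: "t \<ge> 0"
  shows "(\<lambda>m. grid_value B C m t c) \<longlonglongrightarrow> decoded_path B C t c"
proof -
  let ?g = "\<lambda>m. real (nat \<lfloor>2 ^ m * t\<rfloor>) / 2 ^ m"
  have d: "dist (grid_value B C m t c) (grid_value B C m' t c) \<le> C * dist (?g m) (?g m')" for m m'
    using c unfolding lipschitz_code_def grid_value_def dist_real_def by blast
  have "Cauchy (\<lambda>m. grid_value B C m t c)"
  proof (rule metric_CauchyI)
    fix e :: real assume e: "e > 0"
    have "Cauchy ?g" using dyadic_below_tendsto[OF t] by (intro convergent_Cauchy convergentI)
    then obtain m0 where m0: "\<And>m m'. m \<ge> m0 \<Longrightarrow> m' \<ge> m0 \<Longrightarrow> dist (?g m) (?g m') < e / (C + 1)"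
      using metric_CauchyD[of ?g "e / (C + 1)"] e BC by auto
    have "dist (grid_value B C m t c) (grid_value B C m' t c) < e" if "m \<ge> m0" "m' \<ge> m0" for m m'
    proof -
      have "C * dist (?g m) (?g m') \<le> (C + 1) * dist (?g m) (?g m')" by (intro mult_right_mono) auto
      also have "\<dots> < (C + 1) * (e / (C + 1))" using m0[OF that] BC by (intro mult_strict_left_mono) auto
      also have "\<dots> = e" using BC by simp
      finally show ?thesis using d[of m m'] by linarith
    qed
    then show "\<exists>M. \<forall>m\<ge>M. \<forall>m'\<ge>M. dist (grid_value B C m t c) (grid_value B C m' t c) < e" by blast
  qed
  then show ?thesis unfolding decoded_path_def by (simp add: Cauchy_convergent_iff convergent_LIMSEQ_iff)
qed

lemma decoded_path_grid_close:
  assumes c: "lipschitz_code B C c" and t: "t \<ge> 0"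
  shows "\<bar>decoded_path B C t c - grid_value B C m t c\<bar> \<le> C * (1/2) ^ m"
proof -
  let ?g = "\<lambda>m. real (nat \<lfloor>2 ^ m * t\<rfloor>) / 2 ^ m"
  have "\<bar>decoded_path B C t c - grid_value B C m t c\<bar> \<le> C * \<bar>t - ?g m\<bar>"
  proof (rule LIMSEQ_le)
    show "(\<lambda>m'. \<bar>grid_value B C m' t c - grid_value B C m t c\<bar>) \<longlonglongrightarrow> \<bar>decoded_path B C t c - grid_value B C m t c\<bar>"
      by (intro tendsto_intros grid_value_convergent c t)
    show "(\<lambda>m'. C * \<bar>?g m' - ?g m\<bar>) \<longlonglongrightarrow> C * \<bar>t - ?g m\<bar>"
      by (intro tendsto_intros dyadic_below_tendsto t)
    show "\<exists>N. \<forall>m'\<ge>N. \<bar>grid_value B C m' t c - grid_value B C m t c\<bar> \<le> C * \<bar>?g m' - ?g m\<bar>"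
      using c unfolding lipschitz_code_def grid_value_def by blast
  qed
  also have "\<dots> \<le> C * (1/2) ^ m"
    using dyadic_below[OF t, of m] BC by (intro mult_left_mono) auto
  finally show ?thesis .
qed

lemma decoded_path_lipschitz:
  assumes c: "lipschitz_code B C c" and st: "s \<ge> 0" "t \<ge> 0"
  shows "\<bar>decoded_path B C t c - decoded_path B C s c\<bar> \<le> C * \<bar>t - s\<bar>"
proof (rule LIMSEQ_le)
  let ?g = "\<lambda>t m. real (nat \<lfloor>2 ^ m * t\<rfloor>) / 2 ^ m"
  show "(\<lambda>m. \<bar>grid_value B C m t c - grid_value B C m s c\<bar>) \<longlonglongrightarrow> \<bar>decoded_path B C t c - decoded_path B C s c\<bar>"
    by (intro tendsto_intros grid_value_convergent c st)
  show "(\<lambda>m. C * \<bar>?g t m - ?g s m\<bar>) \<longlonglongrightarrow> C * \<bar>t - s\<bar>"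
    by (intro tendsto_intros dyadic_below_tendsto st)
  show "\<exists>N. \<forall>m\<ge>N. \<bar>grid_value B C m t c - grid_value B C m s c\<bar> \<le> C * \<bar>?g t m - ?g s m\<bar>"
    using c unfolding lipschitz_code_def grid_value_def by blast
qed

lemma decoded_path_bound:
  assumes c: "lipschitz_code B C c" and t: "t \<ge> 0"
  shows "\<bar>decoded_path B C t c\<bar> \<le> B + C * t + 1"
  by (rule LIMSEQ_le_const2[OF tendsto_rabs[OF grid_value_convergent[OF c t]]])
    (use grid_value_bound[OF t] in blast)

lemma decoded_path_code:
  assumes lip: "\<And>s t. s \<ge> 0 \<Longrightarrow> t \<ge> 0 \<Longrightarrow> \<bar>f t - f s\<bar> \<le> C * \<bar>t - s\<bar>"
    and bnd: "\<And>t. t \<ge> 0 \<Longrightarrow> \<bar>f t\<bar> \<le> B + C * t"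
  shows "lipschitz_code B C (encode_path B C f)"
    and "\<And>t. t \<ge> 0 \<Longrightarrow> decoded_path B C t (encode_path B C f) = f t"
proof -
  have val: "dyadic_value B C m j (encode_path B C f) = f (real j / 2 ^ m)" for m j
  proof -
    have "\<bar>f (real j / 2 ^ m)\<bar> < value_bound B C m j"
      using bnd[of "real j / 2 ^ m"] by (simp add: value_bound_def)
    then show ?thesis unfolding dyadic_value_def encode_path_def by (simp add: decode_digit)
  qed
  show lc: "lipschitz_code B C (encode_path B C f)"
    unfolding lipschitz_code_def val by (intro allI lip) auto
  fix t :: real assume t: "t \<ge> 0"
  let ?g = "\<lambda>m. real (nat \<lfloor>2 ^ m * t\<rfloor>) / 2 ^ m"
  have "(\<lambda>m. f (?g m)) \<longlonglongrightarrow> f t" by (rule lipschitz_dyadic_limit[OF lip t])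
  moreover have "(\<lambda>m. f (?g m)) \<longlonglongrightarrow> decoded_path B C t (encode_path B C f)"
    using grid_value_convergent[OF lc t] unfolding grid_value_def val .
  ultimately show "decoded_path B C t (encode_path B C f) = f t" using LIMSEQ_unique by blast
qed

end

section \<open>Time integrals\<close>

lemma integral_of_bounded_is_lipschitz:
  fixes g :: "real \<Rightarrow> real"
  assumes i: "\<And>T. T > 0 \<Longrightarrow> set_integrable lborel {0..T} g" and g: "\<And>s. \<bar>g s\<bar> \<le> C"
    and st: "0 \<le> s" "0 \<le> t"
  shows "\<bar>(LBINT u:{0..t}. g u) - (LBINT u:{0..s}. g u)\<bar> \<le> C * \<bar>t - s\<bar>"
proof -
  have main: "\<bar>(LBINT u:{0..t}. g u) - (LBINT u:{0..s}. g u)\<bar> \<le> C * (t - s)"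
    if st: "0 \<le> s" "s \<le> t" for s t
  proof -
    have it: "set_integrable lborel {0..t + 1} g" using st by (intro i) auto
    have is': "set_integrable lborel S g" if "S \<in> sets lborel" "S \<subseteq> {0..t + 1}" for S
      by (rule set_integrable_subset[OF it that])
    have "(LBINT u:{0..t}. g u) = (LBINT u:{0..s} \<union> {s<..t}. g u)"
      using st by (intro arg_cong[where f = "\<lambda>S. LBINT u:S. g u"]) auto
    also have "\<dots> = (LBINT u:{0..s}. g u) + (LBINT u:{s<..t}. g u)"
      using st by (intro set_integral_Un is') auto
    finally have "(LBINT u:{0..t}. g u) - (LBINT u:{0..s}. g u) = (LBINT u:{s<..t}. g u)" by simp
    moreover have "norm (LBINT u:{s<..t}. g u) \<le> (LBINT u:{s<..t}. C)"
    proof -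
      have "norm (LBINT u:{s<..t}. g u) \<le> (LBINT u:{s<..t}. norm (g u))"
        by (rule set_integral_norm_bound) (use st in \<open>auto intro!: is'\<close>)
      also have "\<dots> \<le> (LBINT u:{s<..t}. C)"
      proof (rule set_integral_mono)
        show "set_integrable lborel {s<..t} (\<lambda>u. norm (g u))"
          by (rule set_integrable_norm) (use st in \<open>auto intro!: is'\<close>)
        show "set_integrable lborel {s<..t} (\<lambda>u. C)"
          unfolding set_integrable_def using st by (simp add: mult.commute)
      qed (use g in simp)
      finally show ?thesis .
    qed
    moreover have "(LBINT u:{s<..t}. C) = C * (t - s)"
      using st by (simp add: set_integral_const mult.commute)
    ultimately show ?thesis by simp
  qed
  show ?thesis
    using main[of s t] main[of t s] st by (cases "s \<le> t") (auto simp: abs_minus_commute)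
qed

lemma integral_of_bounded_le:
  fixes g :: "real \<Rightarrow> real"
  assumes "\<And>T. T > 0 \<Longrightarrow> set_integrable lborel {0..T} g" "\<And>s. \<bar>g s\<bar> \<le> C" and t: "t \<ge> 0"
  shows "\<bar>LBINT s:{0..t}. g s\<bar> \<le> C * t"
proof -
  have "(LBINT s:{0..0}. g s) = 0"
    unfolding set_lebesgue_integral_def
    by (rule integral_eq_zero_AE, rule eventually_mono[OF AE_lborel_singleton[of "0::real"]]) simp
  then show ?thesis using integral_of_bounded_is_lipschitz[OF assms(1,2), of 0 t] t by simp
qed

text \<open>The conditional expression confines joint measurability to nonnegative times, since the values
  of a process at negative times are arbitrary.\<close>

lemma time_integral_fubini:
  fixes Y :: "real \<Rightarrow> 'b \<Rightarrow> real" and b :: "real \<Rightarrow> real"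
  assumes N: "prob_space N"
    and Y: "(\<lambda>y. if fst y \<ge> 0 then Y (fst y) (snd y) else 0) \<in> borel_measurable (borel \<Otimes>\<^sub>M N)"
    and b[measurable]: "b \<in> borel_measurable borel" and bC: "\<And>y. \<bar>b y\<bar> \<le> C"
  shows "\<And>z T. z \<in> space N \<Longrightarrow> set_integrable lborel {0..T} (\<lambda>s. b (Y s z))"
    and "\<And>t. t \<ge> 0 \<Longrightarrow> (\<lambda>z. LBINT s:{0..t}. b (Y s z)) \<in> borel_measurable N"
    and "\<And>g t. g \<in> borel_measurable N \<Longrightarrow> (\<And>z. \<bar>g z\<bar> \<le> 1) \<Longrightarrow>
      (\<lambda>s. indicator {0..t} s * (\<integral>z. g z * b (Y s z) \<partial>N)) \<in> borel_measurable lborel"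
    and "\<And>g t. g \<in> borel_measurable N \<Longrightarrow> (\<And>z. \<bar>g z\<bar> \<le> 1) \<Longrightarrow>
      (\<integral>z. g z * (LBINT s:{0..t}. b (Y s z)) \<partial>N) = (LBINT s:{0..t}. (\<integral>z. g z * b (Y s z) \<partial>N))"
proof -
  interpret N: prob_space N by fact
  interpret pair_sigma_finite lborel N
    unfolding pair_sigma_finite_def using lborel.sigma_finite_measure_axioms N.sigma_finite_measure_axioms by blast
  have Y'[measurable]: "(\<lambda>y. if fst y \<ge> 0 then Y (fst y) (snd y) else 0) \<in> borel_measurable (lborel \<Otimes>\<^sub>M N)"
    using Y by simp
  have J: "(\<lambda>y. indicator {0..t} (fst y) * b (Y (fst y) (snd y))) \<in> borel_measurable (lborel \<Otimes>\<^sub>M N)" for t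
  proof -
    have "(\<lambda>y. indicator {0..t} (fst y) * b (if fst y \<ge> 0 then Y (fst y) (snd y) else 0)) \<in> borel_measurable (lborel \<Otimes>\<^sub>M N)"
      by measurable
    moreover have "(\<lambda>y. indicator {0..t} (fst y) * b (if fst y \<ge> 0 then Y (fst y) (snd y) else 0)) =
        (\<lambda>y. indicator {0..t} (fst y) * b (Y (fst y) (snd y)))"
      by (auto simp: indicator_def)
    ultimately show ?thesis by simp
  qed
  have C: "C \<ge> 0" using bC[of 0] by linarith
  have Ji: "integrable lborel (\<lambda>s. C * indicator {0..t} s)" for t :: real
    by (intro integrable_mult_right integrable_real_indicator) (auto simp: emeasure_lborel_Icc_eq)
  show si: "set_integrable lborel {0..T} (\<lambda>s. b (Y s z))" if z: "z \<in> space N" for z T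
    unfolding set_integrable_def real_scaleR_def
  proof (rule Bochner_Integration.integrable_bound[OF Ji[of T]])
    show "(\<lambda>s. indicator {0..T} s * b (Y s z)) \<in> borel_measurable lborel"
      using measurable_compose[OF measurable_Pair2'[OF z] J[of T]] by simp
    show "AE s in lborel. norm (indicator {0..T} s * b (Y s z)) \<le> norm (C * indicator {0..T} s)"
      using bC C by (intro AE_I2) (auto simp: indicator_def)
  qed
  show "(\<lambda>z. LBINT s:{0..t}. b (Y s z)) \<in> borel_measurable N" if t: "t \<ge> 0" for t
  proof -
    have "(\<lambda>z. \<integral>s. indicator {0..t} s * b (Y s z) \<partial>lborel) \<in> borel_measurable N"
      using measurable_compose[OF measurable_pair_swap' J[of t]]
      by (intro lborel.borel_measurable_lebesgue_integral) (simp add: case_prod_unfold)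
    then show ?thesis by (simp add: set_lebesgue_integral_def)
  qed
  fix g :: "'b \<Rightarrow> real" and t :: real
  assume g[measurable]: "g \<in> borel_measurable N" and g1: "\<And>z. \<bar>g z\<bar> \<le> 1"
  define h where "h = (\<lambda>(s, z). indicator {0..t} s * (g z * b (Y s z)))"
  have hm: "h \<in> borel_measurable (lborel \<Otimes>\<^sub>M N)"
  proof -
    have "(\<lambda>y. g (snd y) * (indicator {0..t} (fst y) * b (Y (fst y) (snd y)))) \<in> borel_measurable (lborel \<Otimes>\<^sub>M N)"
      using J[of t] by measurable
    then show ?thesis by (simp add: h_def case_prod_unfold mult.left_commute)
  qed
  have gb: "\<bar>g z * b y\<bar> \<le> C" for z y
    unfolding abs_mult using mult_mono[OF g1[of z] bC[of y]] by simp
  have hb: "\<bar>h (s, z)\<bar> \<le> C * indicator {0..t} s" for s z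
  proof (cases "s \<in> {0..t}")
    case True
    then show ?thesis using gb[of z "Y s z"] by (simp add: h_def)
  next
    case False
    then show ?thesis by (simp add: h_def)
  qed
  have hs: "integrable N (\<lambda>z. h (s, z))" for s
  proof (rule N.integrable_const_bound[where B = "C * indicator {0..t} s"])
    show "AE z in N. norm (h (s, z)) \<le> C * indicator {0..t} s" using hb by simp
    have "Pair s \<in> measurable N (lborel \<Otimes>\<^sub>M N)" by simp
    from measurable_compose[OF this hm] show "(\<lambda>z. h (s, z)) \<in> borel_measurable N" .
  qed
  have hi: "integrable (lborel \<Otimes>\<^sub>M N) h"
  proof (rule Fubini_integrable[OF hm])
    have 1: "(\<lambda>s. \<integral>z. norm (h (s, z)) \<partial>N) \<in> borel_measurable lborel"
      using hm by (intro N.borel_measurable_lebesgue_integral) simp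
    have 2: "norm (\<integral>z. norm (h (s, z)) \<partial>N) \<le> norm (C * indicator {0..t} s)" for s
    proof -
      have "(\<integral>z. norm (h (s, z)) \<partial>N) \<le> (\<integral>z. C * indicator {0..t} s \<partial>N)"
        by (rule integral_mono[OF integrable_norm[OF hs]]) (use hb in simp_all)
      then have "(\<integral>z. norm (h (s, z)) \<partial>N) \<le> C * indicator {0..t} s" by (simp add: N.prob_space)
      moreover have "0 \<le> (\<integral>z. norm (h (s, z)) \<partial>N)" by (rule Bochner_Integration.integral_nonneg) simp
      ultimately show ?thesis by simp
    qed
    show "integrable lborel (\<lambda>s. \<integral>z. norm (h (s, z)) \<partial>N)"
      by (rule Bochner_Integration.integrable_bound[OF Ji[of t] 1]) (use 2 in simp)
    show "AE s in lborel. integrable N (\<lambda>z. h (s, z))"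
      using hs by simp
  qed
  have h1: "(\<integral>z. h (s, z) \<partial>N) = indicator {0..t} s * (\<integral>z. g z * b (Y s z) \<partial>N)" for s
    by (simp add: h_def)
  have h2: "(\<integral>s. h (s, z) \<partial>lborel) = g z * (LBINT s:{0..t}. b (Y s z))" for z
    by (simp add: h_def set_lebesgue_integral_def mult.left_commute[of _ "g z"])
  show "(\<lambda>s. indicator {0..t} s * (\<integral>z. g z * b (Y s z) \<partial>N)) \<in> borel_measurable lborel"
    unfolding h1[symmetric] using hm by (intro N.borel_measurable_lebesgue_integral) simp
  have "(\<integral>z. (\<integral>s. h (s, z) \<partial>lborel) \<partial>N) = (\<integral>s. (\<integral>z. h (s, z) \<partial>N) \<partial>lborel)"
    by (rule Fubini_integral) (use hi in simp)
  then show "(\<integral>z. g z * (LBINT s:{0..t}. b (Y s z)) \<partial>N) = (LBINT s:{0..t}. (\<integral>z. g z * b (Y s z) \<partial>N))"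
    unfolding h1 h2 by (simp add: set_lebesgue_integral_def)
qed

section \<open>The sequence of equations\<close>

text \<open>The hypotheses are in a form that is inherited by subsequences: the densities are replaced by
  uniform absolute continuity of the laws, and the limit data do not belong to the sequences. Uniqueness
  is required on the space that will carry the limit measure.\<close>

locale converging_drifts =
  fixes M :: "'a measure" and F :: "real \<Rightarrow> 'a measure" and Z :: "real \<Rightarrow> 'a \<Rightarrow> real"
    and x :: "nat \<Rightarrow> real" and a :: "nat \<Rightarrow> real \<Rightarrow> real" and \<xi> :: "nat \<Rightarrow> real \<Rightarrow> 'a \<Rightarrow> real"
    and x0 :: real and a0 :: "real \<Rightarrow> real" and \<xi>0 :: "real \<Rightarrow> 'a \<Rightarrow> real"
    and \<mu> :: "real measure" and B C :: real
  assumes fps: "filtered_prob_space M F"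
    and levy: "levy_process M F Z"
    and a_measurable: "\<And>n. a n \<in> borel_measurable borel" "a0 \<in> borel_measurable borel"
    and a_bound: "\<And>n y. \<bar>a n y\<bar> \<le> C" "\<And>y. \<bar>a0 y\<bar> \<le> C"
    and x_bound: "\<And>n. \<bar>x n\<bar> \<le> B"
    and solution: "\<And>n. is_solution M F Z (x n) (a n) (\<xi> n)" "is_solution M F Z x0 a0 \<xi>0"
    and x_tendsto: "x \<longlonglongrightarrow> x0"
    and mu: "finite_measure \<mu>" "sets \<mu> = sets borel"
    and laws_small: "AE t in lborel. t \<ge> 0 \<longrightarrow> (\<forall>e>0. \<exists>d>0. \<forall>S\<in>sets borel. measure \<mu> S < d \<longrightarrow>
      (\<forall>n. measure M {w\<in>space M. \<xi> n t w \<in> S} \<le> e))"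
    and a_tendsto: "\<And>e. e > 0 \<Longrightarrow> (\<lambda>n. measure \<mu> {y. \<bar>a n y - a0 y\<bar> > e}) \<longlonglongrightarrow> 0"
    and unique: "pathwise_unique TYPE('a \<times> path_code) (process_law M Z) x0 a0"
begin

definition code :: "nat \<Rightarrow> 'a \<Rightarrow> path_code" where
  "code n w = encode_path B C (\<lambda>t. \<xi> n t w - Z t w)"

definition time :: "nat \<times> nat \<times> nat \<Rightarrow> real" where
  "time = (\<lambda>(m, j, k). real j / 2 ^ m)"

abbreviation path_coded :: "nat \<Rightarrow> 'a \<Rightarrow> bool" where
  "path_coded n w \<equiv> lipschitz_code B C (code n w) \<and>
     (\<forall>t\<ge>0. decoded_path B C t (code n w) = \<xi> n t w - Z t w \<and>
       \<xi> n t w - Z t w = x n + (LBINT s:{0..t}. a n (\<xi> n s w)))"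

lemma BC: "B \<ge> 0" "C \<ge> 0"
  using x_bound[of 0] a_bound(2)[of 0] by linarith+

lemma adapted: "adapted_process F Z" "adapted_process F (\<xi> n)" "adapted_process F \<xi>0"
  using levy solution by (auto simp: levy_process_def is_solution_def)

lemma measurable_adapted:
  assumes "adapted_process F Y" "t \<ge> 0"
  shows "Y t \<in> borel_measurable M"
  by (rule measurable_from_subalg[of M "F t"])
    (use assms fps in \<open>auto simp: filtered_prob_space_def adapted_process_def\<close>)

lemma Z_measurable: "t \<ge> 0 \<Longrightarrow> Z t \<in> borel_measurable M"
  and \<xi>_measurable: "t \<ge> 0 \<Longrightarrow> \<xi> n t \<in> borel_measurable M"
  and \<xi>0_measurable: "t \<ge> 0 \<Longrightarrow> \<xi>0 t \<in> borel_measurable M"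
  using measurable_adapted adapted by blast+

lemma code_adapted:
  assumes t: "t \<ge> 0" "time i \<le> t"
  shows "{w\<in>space M. code n w i} \<in> sets (F t)"
proof -
  obtain m j k where i: "i = (m, j, k)" by (cases i) auto
  let ?s = "real j / 2 ^ m"
  have s: "0 \<le> ?s" "?s \<le> t" using t by (auto simp: i time_def)
  have sp: "space (F ?s) = space M" using fps s(1) by (auto simp: filtered_prob_space_def subalgebra_def)
  have "(\<lambda>w. \<xi> n ?s w - Z ?s w) \<in> borel_measurable (F ?s)"
    using adapted(1) adapted(2)[of n] s(1) unfolding adapted_process_def by (intro borel_measurable_diff) blast+
  from digit_sets[OF this] have "{w\<in>space M. code n w i} \<in> sets (F ?s)"
    by (simp add: code_def encode_path_def i sp)
  then show ?thesis using fps s unfolding filtered_prob_space_def by blast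
qed

lemma code_measurable: "{w\<in>space M. code n w i} \<in> sets M"
proof -
  have "time i \<ge> 0" by (cases i) (simp add: time_def)
  from code_adapted[OF this order_refl, of n] fps this show ?thesis
    by (auto simp: filtered_prob_space_def subalgebra_def)
qed

text \<open>The drift part of a solution is recovered from its code. Where joint measurability in time and
  sample point matters, the decoded path plus the noise takes the place of the solution, which is
  regular outside a null set only.\<close>

lemma solution_path:
  "AE w in M. \<forall>n. path_coded n w"
  unfolding AE_all_countable
proof
  fix n
  have "AE w in M. (\<forall>T>0. set_integrable lborel {0..T} (\<lambda>s. a n (\<xi> n s w))) \<and>
        (\<forall>t\<ge>0. \<xi> n t w = x n + (LBINT s:{0..t}. a n (\<xi> n s w)) + Z t w)"
    using solution(1)[of n] by (simp add: is_solution_def)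
  then show "AE w in M. path_coded n w"
  proof (rule AE_mp, intro AE_I2 impI)
    fix w assume w: "(\<forall>T>0. set_integrable lborel {0..T} (\<lambda>s. a n (\<xi> n s w))) \<and>
        (\<forall>t\<ge>0. \<xi> n t w = x n + (LBINT s:{0..t}. a n (\<xi> n s w)) + Z t w)"
    let ?I = "\<lambda>t. LBINT s:{0..t}. a n (\<xi> n s w)"
    have eq: "\<xi> n t w - Z t w = x n + ?I t" if "t \<ge> 0" for t
      using w that by simp
    have lipI: "\<bar>?I t - ?I s\<bar> \<le> C * \<bar>t - s\<bar>" if "s \<ge> 0" "t \<ge> 0" for s t
      by (rule integral_of_bounded_is_lipschitz) (use w a_bound that in auto)
    have lip: "\<bar>(\<xi> n t w - Z t w) - (\<xi> n s w - Z s w)\<bar> \<le> C * \<bar>t - s\<bar>" if "s \<ge> 0" "t \<ge> 0" for s t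
      using lipI[OF that] by (simp add: eq[OF that(1)] eq[OF that(2)])
    have bnd: "\<bar>\<xi> n t w - Z t w\<bar> \<le> B + C * t" if "t \<ge> 0" for t
    proof -
      have "\<bar>?I t\<bar> \<le> C * t" by (rule integral_of_bounded_le) (use w a_bound that in auto)
      then show ?thesis using x_bound[of n] by (simp add: eq[OF that])
    qed
    show "path_coded n w"
      unfolding code_def using decoded_path_code[OF BC, of "\<lambda>t. \<xi> n t w - Z t w", OF lip bnd] eq by simp
  qed
qed

end

section \<open>The limit equation\<close>

locale converging_drifts_limit = converging_drifts M F Z x a \<xi> x0 a0 \<xi>0 \<mu> B C +
    stable_limit M "converging_drifts.code Z \<xi> B C" Q
  for M :: "'a measure" and F Z x a \<xi> x0 a0 \<xi>0 \<mu> B C Q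
begin

definition limit_path :: "real \<Rightarrow> 'a \<times> path_code \<Rightarrow> real" where
  "limit_path t z = decoded_path B C t (snd z) + Z t (fst z)"

definition weight :: "'a set \<Rightarrow> (nat \<times> nat \<times> nat) set \<Rightarrow> nat \<Rightarrow> 'a \<Rightarrow> real" where
  "weight A I k w = indicator A w * of_bool (\<forall>i\<in>I. code k w i)"

definition limit_weight :: "'a set \<Rightarrow> (nat \<times> nat \<times> nat) set \<Rightarrow> 'a \<times> path_code \<Rightarrow> real" where
  "limit_weight A I z = indicator A (fst z) * of_bool (\<forall>i\<in>I. snd z i)"

lemma weight_range: "0 \<le> weight A I k w" "weight A I k w \<le> 1" "\<bar>weight A I k w\<bar> \<le> 1"
  "0 \<le> limit_weight A I z" "limit_weight A I z \<le> 1" "\<bar>limit_weight A I z\<bar> \<le> 1"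
  by (auto simp: weight_def limit_weight_def indicator_def)

lemma weight_measurable:
  assumes A: "A \<in> sets M" and I: "finite I"
  shows "weight A I k \<in> borel_measurable M" "limit_weight A I \<in> borel_measurable Q"
proof -
  have "Measurable.pred M (\<lambda>w. \<forall>i\<in>I. code k w i)"
    unfolding pred_def by (rule sets.sets_Collect_finite_All[OF X I])
  then show "weight A I k \<in> borel_measurable M"
    unfolding weight_def using A by measurable
  have "Measurable.pred Q (\<lambda>z. \<forall>i\<in>I. snd z i)"
    unfolding pred_def by (rule sets.sets_Collect_finite_All[OF coordinate_sets I])
  then show "limit_weight A I \<in> borel_measurable Q"
    unfolding limit_weight_def using A measurable_compose[OF measurable_fst_Q borel_measurable_indicator[OF A]] by measurable
qed

lemma decoded_path_measurable_M: "t \<ge> 0 \<Longrightarrow> (\<lambda>w. decoded_path B C t (code k w)) \<in> borel_measurable M"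
  by (erule decoded_path_measurable) (rule X)

lemma decoded_path_measurable_Q: "t \<ge> 0 \<Longrightarrow> (\<lambda>z. decoded_path B C t (snd z)) \<in> borel_measurable Q"
  by (erule decoded_path_measurable) (rule coordinate_sets)

lemma limit_path_measurable: "t \<ge> 0 \<Longrightarrow> limit_path t \<in> borel_measurable Q"
  unfolding limit_path_def
  by (intro borel_measurable_add decoded_path_measurable_Q measurable_compose[OF measurable_fst_Q Z_measurable])

text \<open>The Lipschitz condition consists of countably many closed conditions, each of which holds almost
  surely before the limit.\<close>

lemma AE_lipschitz_code: "AE z in Q. lipschitz_code B C (snd z)"
  unfolding lipschitz_code_def AE_all_countable
proof (intro allI)
  fix m j m' j'
  define K where "K = C * \<bar>real j / 2 ^ m - real j' / 2 ^ m'\<bar>"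
  \<comment> \<open>A bounded continuous function that vanishes exactly where the condition holds.\<close>
  define H where "H w u v = min 1 (max 0 (\<bar>u - v\<bar> - K))" for w :: 'a and u v :: real
  define \<Phi> where "\<Phi> z = indicator (space M) (fst z) * of_bool (\<forall>i\<in>{}. snd z i) *
      H (fst z) (dyadic_value B C m j (snd z)) (dyadic_value B C m' j' (snd z))" for z
  have HL: "\<bar>H w u v - H w u' v'\<bar> \<le> 1 * (\<bar>u - u'\<bar> + \<bar>v - v'\<bar>)" for w u v u' v'
  proof -
    have "\<bar>min 1 (max 0 p) - min 1 (max 0 q)\<bar> \<le> \<bar>p - q\<bar>" for p q :: real by linarith
    moreover have "\<bar>(\<bar>u - v\<bar> - K) - (\<bar>u' - v'\<bar> - K)\<bar> \<le> \<bar>u - u'\<bar> + \<bar>v - v'\<bar>" by linarith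
    ultimately show ?thesis unfolding H_def mult_1 by (rule order_trans)
  qed
  have HB: "\<bar>H w u v\<bar> \<le> 1" "H w u v \<ge> 0" for w u v unfolding H_def by auto
  have Hm: "(\<lambda>w. H w u v) \<in> borel_measurable M" for u v unfolding H_def by simp
  note T = stable_test_function[where A = "space M" and I = "{}" and d = "dyadic_value B C m j"
      and d' = "dyadic_value B C m' j'" and H = H and B = 1 and L = 1,
      OF sets.top finite.emptyI cylinder_continuous_dyadic_value[OF BC] cylinder_continuous_dyadic_value[OF BC] Hm HB(1) HL]
  have \<Phi>m: "\<Phi> \<in> borel_measurable Q" unfolding \<Phi>_def[abs_def] by (rule T(1))
  have \<Phi>c: "(\<lambda>k. \<integral>w. \<Phi> (w, code k w) \<partial>M) \<longlonglongrightarrow> (\<integral>z. \<Phi> z \<partial>Q)"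
    unfolding \<Phi>_def by (rule T(3))
  have "(\<integral>w. \<Phi> (w, code k w) \<partial>M) = 0" for k
  proof (rule integral_eq_zero_AE)
    show "AE w in M. \<Phi> (w, code k w) = 0"
      using solution_path
    proof (rule eventually_mono)
      fix w assume "\<forall>n. path_coded n w"
      then have "lipschitz_code B C (code k w)" by blast
      then have "\<bar>dyadic_value B C m j (code k w) - dyadic_value B C m' j' (code k w)\<bar> \<le> K"
        unfolding lipschitz_code_def K_def by blast
      then show "\<Phi> (w, code k w) = 0" by (simp add: \<Phi>_def H_def)
    qed
  qed
  then have "(\<integral>z. \<Phi> z \<partial>Q) = 0" using \<Phi>c by (simp add: LIMSEQ_const_iff)
  moreover have "integrable Q \<Phi>"
    by (rule Q.integrable_const_bound[where B = 1])
      (use HB \<Phi>m in \<open>auto simp: \<Phi>_def abs_mult indicator_def\<close>)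
  moreover have "\<Phi> z \<ge> 0" for z using HB by (simp add: \<Phi>_def)
  ultimately have "AE z in Q. \<Phi> z = 0" using integral_nonneg_eq_0_iff_AE[of Q \<Phi>] by simp
  then show "AE z in Q. \<bar>dyadic_value B C m j (snd z) - dyadic_value B C m' j' (snd z)\<bar> \<le> C * \<bar>real j / 2 ^ m - real j' / 2 ^ m'\<bar>"
    unfolding K_def[symmetric]
  proof (rule AE_mp, intro AE_I2 impI)
    fix z assume "z \<in> space Q" "\<Phi> z = 0"
    then show "\<bar>dyadic_value B C m j (snd z) - dyadic_value B C m' j' (snd z)\<bar> \<le> K"
      by (auto simp: \<Phi>_def H_def space_Q min_def max_def split: if_splits)
  qed
qed

text \<open>The value of the path at a real time is a limit of values on the grid, with an error that is
  uniform in the path. So it may be replaced by a grid value, which is a continuous function of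
  the code, before and after the limit.\<close>

lemma path_functional_conv:
  fixes H :: "'a \<Rightarrow> real \<Rightarrow> real"
  assumes A: "A \<in> sets M" and I: "finite I" and t: "t \<ge> 0"
    and Hm: "(\<lambda>(w, u). H w u) \<in> borel_measurable (M \<Otimes>\<^sub>M borel)"
    and HB: "\<And>w u. \<bar>H w u\<bar> \<le> K"
    and HL: "\<And>w u u'. \<bar>H w u - H w u'\<bar> \<le> L * \<bar>u - u'\<bar>" and L: "L \<ge> 0"
  shows "(\<lambda>k. \<integral>w. weight A I k w * H w (\<xi> k t w - Z t w) \<partial>M) \<longlonglongrightarrow>
    (\<integral>z. limit_weight A I z * H (fst z) (decoded_path B C t (snd z)) \<partial>Q)"
proof (rule tendsto_by_approximation)
  fix e :: real assume e: "e > 0"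
  have K: "K \<ge> 0" using HB[of undefined 0] by linarith
  have "(\<lambda>m. L * (C * (1/2) ^ m)) \<longlonglongrightarrow> L * (C * 0)" by (intro tendsto_intros LIMSEQ_power_zero) simp
  then have "eventually (\<lambda>m. L * (C * (1/2) ^ m) < e) sequentially"
    using e by (intro order_tendstoD(2)) auto
  then obtain m where m: "L * (C * (1/2) ^ m) < e" by (auto simp: eventually_sequentially)
  let ?d = "grid_value B C m t"
  define \<Phi> where "\<Phi> z = indicator A (fst z) * of_bool (\<forall>i\<in>I. snd z i) * H (fst z) (?d (snd z))" for z
  have Hu: "(\<lambda>w. H w u) \<in> borel_measurable M" for u
    using measurable_compose[OF measurable_Pair2' Hm, of u] by simp
  have HL': "\<bar>H w u - H w u'\<bar> \<le> L * (\<bar>u - u'\<bar> + \<bar>v - v'\<bar>)" for w u v u' v'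
    using HL[of w u u'] mult_left_mono[of "\<bar>u - u'\<bar>" "\<bar>u - u'\<bar> + \<bar>v - v'\<bar>" L] L by simp
  note T = stable_test_function[where A = A and I = I and d = ?d and d' = ?d and H = "\<lambda>w u v. H w u" and B = K and L = L,
      OF A I cylinder_continuous_grid_value[OF BC] cylinder_continuous_grid_value[OF BC] Hu HB HL']
  have \<Phi>: "\<Phi> \<in> borel_measurable Q" "\<And>k. (\<lambda>w. \<Phi> (w, code k w)) \<in> borel_measurable M"
    "(\<lambda>k. \<integral>w. \<Phi> (w, code k w) \<partial>M) \<longlonglongrightarrow> (\<integral>z. \<Phi> z \<partial>Q)"
    unfolding \<Phi>_def[abs_def] by (rule T)+
  have near: "\<bar>H w u - H w u'\<bar> \<le> e" if "\<bar>u - u'\<bar> \<le> C * (1/2) ^ m" for w u u'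
    using HL[of w u u'] mult_left_mono[OF that L] m by linarith
  have w1: "\<bar>g * h\<bar> \<le> b" if "\<bar>g\<bar> \<le> 1" "\<bar>h\<bar> \<le> b" for g h b :: real
    using mult_mono[OF that] by (simp add: abs_mult)
  have 1: "\<bar>(\<integral>w. weight A I k w * H w (\<xi> k t w - Z t w) \<partial>M) - (\<integral>w. \<Phi> (w, code k w) \<partial>M)\<bar> \<le> e" for k
  proof (rule M.integral_AE_close)
    show "(\<lambda>w. weight A I k w * H w (\<xi> k t w - Z t w)) \<in> borel_measurable M"
    proof (rule borel_measurable_times[OF weight_measurable(1)[OF A I]])
      have "(\<lambda>w. (w, \<xi> k t w - Z t w)) \<in> measurable M (M \<Otimes>\<^sub>M borel)"
        using \<xi>_measurable[OF t, of k] Z_measurable[OF t] by measurable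
      from measurable_compose[OF this Hm] show "(\<lambda>w. H w (\<xi> k t w - Z t w)) \<in> borel_measurable M" by simp
    qed
    show "AE w in M. \<bar>weight A I k w * H w (\<xi> k t w - Z t w)\<bar> \<le> K"
      by (intro AE_I2 w1 weight_range HB)
    show "AE w in M. \<bar>\<Phi> (w, code k w)\<bar> \<le> K"
      using w1[OF weight_range(3) HB] unfolding \<Phi>_def weight_def by (intro AE_I2) simp
    show "AE w in M. \<bar>weight A I k w * H w (\<xi> k t w - Z t w) - \<Phi> (w, code k w)\<bar> \<le> e"
      using solution_path
    proof (rule eventually_mono)
      fix w assume "\<forall>n. path_coded n w"
      then have c: "lipschitz_code B C (code k w)" "decoded_path B C t (code k w) = \<xi> k t w - Z t w"
        using t by blast+
      have "\<bar>H w (\<xi> k t w - Z t w) - H w (?d (code k w))\<bar> \<le> e"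
        using near[OF decoded_path_grid_close[OF BC c(1) t, of m]] unfolding c(2) .
      from w1[OF weight_range(3)[of A I k w] this]
      show "\<bar>weight A I k w * H w (\<xi> k t w - Z t w) - \<Phi> (w, code k w)\<bar> \<le> e"
        unfolding \<Phi>_def weight_def by (simp add: right_diff_distrib)
    qed
  qed (rule \<Phi>(2))
  have 2: "\<bar>(\<integral>z. limit_weight A I z * H (fst z) (decoded_path B C t (snd z)) \<partial>Q) - (\<integral>z. \<Phi> z \<partial>Q)\<bar> \<le> e"
  proof (rule Q.integral_AE_close)
    show "(\<lambda>z. limit_weight A I z * H (fst z) (decoded_path B C t (snd z))) \<in> borel_measurable Q"
    proof (rule borel_measurable_times[OF weight_measurable(2)[OF A I]])
      have "(\<lambda>z. (fst z, decoded_path B C t (snd z))) \<in> measurable Q (M \<Otimes>\<^sub>M borel)"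
        using decoded_path_measurable_Q[OF t] by measurable
      from measurable_compose[OF this Hm] show "(\<lambda>z. H (fst z) (decoded_path B C t (snd z))) \<in> borel_measurable Q" by simp
    qed
    show "AE z in Q. \<bar>limit_weight A I z * H (fst z) (decoded_path B C t (snd z))\<bar> \<le> K"
      by (intro AE_I2 w1 weight_range HB)
    show "AE z in Q. \<bar>\<Phi> z\<bar> \<le> K"
      using w1[OF weight_range(6) HB] unfolding \<Phi>_def limit_weight_def by (intro AE_I2) simp
    show "AE z in Q. \<bar>limit_weight A I z * H (fst z) (decoded_path B C t (snd z)) - \<Phi> z\<bar> \<le> e"
      using AE_lipschitz_code
    proof (rule eventually_mono)
      fix z :: "'a \<times> path_code" assume c: "lipschitz_code B C (snd z)"
      have "\<bar>H (fst z) (decoded_path B C t (snd z)) - H (fst z) (?d (snd z))\<bar> \<le> e"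
        using near[OF decoded_path_grid_close[OF BC c t, of m]] .
      from w1[OF weight_range(6)[of A I z] this]
      show "\<bar>limit_weight A I z * H (fst z) (decoded_path B C t (snd z)) - \<Phi> z\<bar> \<le> e"
        unfolding \<Phi>_def limit_weight_def by (simp add: right_diff_distrib)
    qed
  qed (rule \<Phi>(1))
  show "\<exists>y l. y \<longlonglongrightarrow> l \<and> (\<forall>k. \<bar>(\<integral>w. weight A I k w * H w (\<xi> k t w - Z t w) \<partial>M) - y k\<bar> \<le> e) \<and>
      \<bar>(\<integral>z. limit_weight A I z * H (fst z) (decoded_path B C t (snd z)) \<partial>Q) - l\<bar> \<le> e"
    by (intro exI[of _ "\<lambda>k. \<integral>w. \<Phi> (w, code k w) \<partial>M"] exI[of _ "\<integral>z. \<Phi> z \<partial>Q"] conjI allI \<Phi>(3) 1 2)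
qed

text \<open>For almost every time the laws of \<open>\<xi> k t\<close>, restricted to a rectangle, converge weakly by stable
  convergence and are uniformly absolutely continuous by assumption.\<close>

lemma drift_conv:
  "AE t in lborel. t \<ge> 0 \<longrightarrow> (\<forall>A\<in>sets M. \<forall>I. finite I \<longrightarrow>
     (\<lambda>k. \<integral>w. weight A I k w * a k (\<xi> k t w) \<partial>M) \<longlonglongrightarrow> (\<integral>z. limit_weight A I z * a0 (limit_path t z) \<partial>Q))"
  using laws_small
proof (rule eventually_mono, intro impI ballI allI)
  fix t A I
  assume *: "t \<ge> 0 \<longrightarrow> (\<forall>e>0. \<exists>d>0. \<forall>S\<in>sets borel. measure \<mu> S < d \<longrightarrow>
      (\<forall>n. M.prob {w\<in>space M. \<xi> n t w \<in> S} \<le> e))" and t: "t \<ge> 0"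
    and A: "A \<in> sets M" and I: "finite (I :: (nat \<times> nat \<times> nat) set)"
  note small = *[THEN mp, OF t]
  define \<nu> where "\<nu> k = distr (density M (\<lambda>w. ennreal (weight A I k w))) borel (\<xi> k t)" for k
  define \<nu>0 where "\<nu>0 = distr (density Q (\<lambda>z. ennreal (limit_weight A I z))) borel (limit_path t)"
  have N: "finite_measure (\<nu> k)" "sets (\<nu> k) = sets borel" "measure (\<nu> k) UNIV \<le> 1"
    "\<And>S. S \<in> sets borel \<Longrightarrow> measure (\<nu> k) S \<le> M.prob {w\<in>space M. \<xi> k t w \<in> S}"
    "\<And>f. f \<in> borel_measurable borel \<Longrightarrow> (\<integral>y. f y \<partial>\<nu> k) = (\<integral>w. weight A I k w * f (\<xi> k t w) \<partial>M)" for k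
    unfolding \<nu>_def
    by (rule M.weighted_law[OF weight_measurable(1)[OF A I, of k] weight_range(1,2) \<xi>_measurable[OF t, of k]]; assumption)+
  note N0 = Q.weighted_law[OF weight_measurable(2)[OF A I] weight_range(4,5) limit_path_measurable[OF t], folded \<nu>0_def]
  have "(\<lambda>k. \<integral>y. a k y \<partial>\<nu> k) \<longlonglongrightarrow> (\<integral>y. a0 y \<partial>\<nu>0)"
  proof (rule tendsto_integral_uniformly_continuous[OF N(1,2,3) N0(1,2,3) mu])
    fix f :: "real \<Rightarrow> real" and L K
    assume fL: "\<And>x y. \<bar>f x - f y\<bar> \<le> L * \<bar>x - y\<bar>" and fK: "\<And>x. \<bar>f x\<bar> \<le> K"
    have L: "L \<ge> 0" using fL[of 1 0] by (simp add: order_trans[OF abs_ge_zero])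
    have "L-lipschitz_on UNIV f"
      using fL L by (intro lipschitz_onI) (auto simp: dist_real_def)
    then have fm[measurable]: "f \<in> borel_measurable borel"
      by (intro borel_measurable_continuous_onI lipschitz_on_continuous_on)
    have Zt[measurable]: "Z t \<in> borel_measurable M" by (rule Z_measurable[OF t])
    have "(\<lambda>k. \<integral>w. weight A I k w * f ((\<xi> k t w - Z t w) + Z t w) \<partial>M) \<longlonglongrightarrow>
        (\<integral>z. limit_weight A I z * f (decoded_path B C t (snd z) + Z t (fst z)) \<partial>Q)"
    proof (rule path_functional_conv[OF A I t, where H = "\<lambda>w u. f (u + Z t w)" and K = K and L = L])
      show "(\<lambda>(w, u). f (u + Z t w)) \<in> borel_measurable (M \<Otimes>\<^sub>M borel)" by measurable
      show "\<bar>f (u + Z t w) - f (u' + Z t w)\<bar> \<le> L * \<bar>u - u'\<bar>" for w u u'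
        using fL[of "u + Z t w" "u' + Z t w"] by simp
    qed (use fK L in auto)
    then show "(\<lambda>k. \<integral>y. f y \<partial>\<nu> k) \<longlonglongrightarrow> (\<integral>y. f y \<partial>\<nu>0)"
      unfolding N(5)[OF fm] N0(5)[OF fm] by (simp add: limit_path_def)
  next
    fix e :: real assume e: "e > 0"
    obtain d where "d > 0" "\<forall>S\<in>sets borel. measure \<mu> S < d \<longrightarrow> (\<forall>n. M.prob {w\<in>space M. \<xi> n t w \<in> S} \<le> e)"
      using small[THEN spec, THEN mp, OF e] by (elim exE conjE) (rule that)
    then have d: "d > 0" "\<And>S n. S \<in> sets borel \<Longrightarrow> measure \<mu> S < d \<Longrightarrow> M.prob {w\<in>space M. \<xi> n t w \<in> S} \<le> e"
      by simp_all
    have "measure (\<nu> n) S \<le> e" if "S \<in> sets borel" "measure \<mu> S < d" for S n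
      by (rule order_trans[OF N(4)[OF that(1)] d(2)[OF that]])
    then show "\<exists>d>0. \<forall>S\<in>sets borel. measure \<mu> S < d \<longrightarrow> (\<forall>n. measure (\<nu> n) S \<le> e)"
      using d(1) by (intro exI[of _ d]) simp
  qed (fact a_measurable a_bound a_tendsto)+
  then show "(\<lambda>k. \<integral>w. weight A I k w * a k (\<xi> k t w) \<partial>M) \<longlonglongrightarrow> (\<integral>z. limit_weight A I z * a0 (limit_path t z) \<partial>Q)"
    unfolding N(5)[OF a_measurable(1)] N0(5)[OF a_measurable(2)] .
qed

definition coded_solution :: "nat \<Rightarrow> real \<Rightarrow> 'a \<Rightarrow> real" where
  "coded_solution k t w = decoded_path B C t (code k w) + Z t w"

lemma Z_jointly_measurable:
  "(\<lambda>y. if fst y \<ge> 0 then Z (fst y) (snd y) else 0) \<in> borel_measurable (borel \<Otimes>\<^sub>M M)"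
  by (rule right_continuous_jointly_measurable[OF Z_measurable])
    (use levy in \<open>auto simp: levy_process_def cadlag_path_def\<close>)

lemma coded_solution_jointly_measurable:
  "(\<lambda>y. if fst y \<ge> 0 then coded_solution k (fst y) (snd y) else 0) \<in> borel_measurable (borel \<Otimes>\<^sub>M M)"
proof -
  have [measurable]: "(\<lambda>y. decoded_path B C (fst y) (code k (snd y))) \<in> borel_measurable (borel \<Otimes>\<^sub>M M)"
    by (rule decoded_path_jointly_measurable) (rule X)
  note Z_jointly_measurable[measurable]
  have "(\<lambda>y. indicator {0..} (fst y) * decoded_path B C (fst y) (code k (snd y)) +
      (if fst y \<ge> 0 then Z (fst y) (snd y) else 0)) \<in> borel_measurable (borel \<Otimes>\<^sub>M M)"
    by measurable
  moreover have "(\<lambda>y. indicator {0..} (fst y) * decoded_path B C (fst y) (code k (snd y)) +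
      (if fst y \<ge> 0 then Z (fst y) (snd y) else 0)) = (\<lambda>y. if fst y \<ge> 0 then coded_solution k (fst y) (snd y) else 0)"
    by (auto simp: coded_solution_def indicator_def)
  ultimately show ?thesis by simp
qed

lemma limit_path_jointly_measurable:
  "(\<lambda>y. if fst y \<ge> 0 then limit_path (fst y) (snd y) else 0) \<in> borel_measurable (borel \<Otimes>\<^sub>M Q)"
proof -
  have [measurable]: "(\<lambda>y. decoded_path B C (fst y) (snd (snd y))) \<in> borel_measurable (borel \<Otimes>\<^sub>M Q)"
    by (rule decoded_path_jointly_measurable) (rule coordinate_sets)
  have "(\<lambda>y. (fst y, fst (snd y))) \<in> measurable ((borel :: real measure) \<Otimes>\<^sub>M Q) (borel \<Otimes>\<^sub>M M)"
    by measurable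
  from measurable_compose[OF this Z_jointly_measurable]
  have [measurable]: "(\<lambda>y. if fst y \<ge> 0 then Z (fst y) (fst (snd y)) else 0) \<in> borel_measurable (borel \<Otimes>\<^sub>M Q)"
    unfolding fst_conv snd_conv .
  have "(\<lambda>y. indicator {0..} (fst y) * decoded_path B C (fst y) (snd (snd y)) +
      (if fst y \<ge> 0 then Z (fst y) (fst (snd y)) else 0)) \<in> borel_measurable (borel \<Otimes>\<^sub>M Q)"
    by measurable
  moreover have "(\<lambda>y. indicator {0..} (fst y) * decoded_path B C (fst y) (snd (snd y)) +
      (if fst y \<ge> 0 then Z (fst y) (fst (snd y)) else 0)) = (\<lambda>y. if fst y \<ge> 0 then limit_path (fst y) (snd y) else 0)"
    by (auto simp: limit_path_def indicator_def)
  ultimately show ?thesis by simp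
qed

lemma coded_solution_AE:
  "AE w in M. \<forall>k. (\<forall>t\<ge>0. coded_solution k t w = \<xi> k t w) \<and> lipschitz_code B C (code k w) \<and>
     (\<forall>t\<ge>0. \<xi> k t w - Z t w = x k + (LBINT s:{0..t}. a k (coded_solution k s w)))"
  using solution_path
proof (rule eventually_mono, intro allI)
  fix w k assume w: "\<forall>n. path_coded n w"
  have eq: "coded_solution k t w = \<xi> k t w" if "t \<ge> 0" for t
  proof -
    have "decoded_path B C t (code k w) = \<xi> k t w - Z t w" using w that by blast
    then show ?thesis by (simp add: coded_solution_def)
  qed
  have "(LBINT s:{0..t}. a k (coded_solution k s w)) = (LBINT s:{0..t}. a k (\<xi> k s w))" for t
    by (rule set_lebesgue_integral_cong) (simp_all add: eq)
  then show "(\<forall>t\<ge>0. coded_solution k t w = \<xi> k t w) \<and> lipschitz_code B C (code k w) \<and>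
     (\<forall>t\<ge>0. \<xi> k t w - Z t w = x k + (LBINT s:{0..t}. a k (coded_solution k s w)))"
    using w eq by simp
qed

lemmas coded_fubini = time_integral_fubini[OF prob_M coded_solution_jointly_measurable a_measurable(1) a_bound(1)]
lemmas limit_fubini = time_integral_fubini[OF prob_Q limit_path_jointly_measurable a_measurable(2) a_bound(2)]

lemma drift_integral_conv:
  assumes A: "A \<in> sets M" and I: "finite I"
  shows "(\<lambda>k. LBINT s:{0..t}. (\<integral>w. weight A I k w * a k (coded_solution k s w) \<partial>M)) \<longlonglongrightarrow>
    (LBINT s:{0..t}. (\<integral>z. limit_weight A I z * a0 (limit_path s z) \<partial>Q))"
proof -
  define u where "u k s = (\<integral>w. weight A I k w * a k (coded_solution k s w) \<partial>M)" for k s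
  define v where "v s = (\<integral>z. limit_weight A I z * a0 (limit_path s z) \<partial>Q)" for s
  have "(\<lambda>k. \<integral>s. indicator {0..t} s *\<^sub>R u k s \<partial>lborel) \<longlonglongrightarrow> (\<integral>s. indicator {0..t} s *\<^sub>R v s \<partial>lborel)"
  proof (rule integral_dominated_convergence[where w = "\<lambda>s. C * indicator {0..t} s"])
    show "(\<lambda>s. indicator {0..t} s *\<^sub>R v s) \<in> borel_measurable lborel"
      using limit_fubini(3)[OF weight_measurable(2)[OF A I] weight_range(6)] by (simp add: v_def)
    show "(\<lambda>s. indicator {0..t} s *\<^sub>R u k s) \<in> borel_measurable lborel" for k
      unfolding u_def real_scaleR_def by (rule coded_fubini(3)[OF weight_measurable(1)[OF A I] weight_range(3)])
    show "integrable lborel (\<lambda>s. C * indicator {0..t} s)"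
      by (intro integrable_mult_right integrable_real_indicator) (auto simp: emeasure_lborel_Icc_eq)
    have uC: "\<bar>u k s\<bar> \<le> C" for k s
    proof -
      let ?f = "\<lambda>w. weight A I k w * a k (coded_solution k s w)"
      have "\<bar>u k s\<bar> \<le> (\<integral>w. \<bar>?f w\<bar> \<partial>M)"
        unfolding u_def using integral_norm_bound[of M ?f] by simp
      also have "\<dots> \<le> (\<integral>w. C \<partial>M)"
      proof (rule integral_mono')
        show "\<bar>?f w\<bar> \<le> C" for w
          using mult_mono[OF weight_range(3)[of A I k w] a_bound(1)[of k "coded_solution k s w"]] by (simp add: abs_mult)
      qed (use BC in simp_all)
      finally have "\<bar>u k s\<bar> \<le> (\<integral>w. C \<partial>M)" .
      then show ?thesis by (simp add: M.prob_space)
    qed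
    show "AE s in lborel. norm (indicator {0..t} s *\<^sub>R u k s) \<le> C * indicator {0..t} s" for k
      using uC by (intro AE_I2) (simp add: indicator_def)
    show "AE s in lborel. (\<lambda>k. indicator {0..t} s *\<^sub>R u k s) \<longlonglongrightarrow> indicator {0..t} s *\<^sub>R v s"
      using drift_conv
    proof (rule eventually_mono)
      fix s assume s: "s \<ge> 0 \<longrightarrow> (\<forall>A\<in>sets M. \<forall>I. finite I \<longrightarrow>
       (\<lambda>k. \<integral>w. weight A I k w * a k (\<xi> k s w) \<partial>M) \<longlonglongrightarrow> (\<integral>z. limit_weight A I z * a0 (limit_path s z) \<partial>Q))"
      show "(\<lambda>k. indicator {0..t} s *\<^sub>R u k s) \<longlonglongrightarrow> indicator {0..t} s *\<^sub>R v s"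
      proof (cases "s \<ge> 0")
        case True
        have Xm: "coded_solution k s \<in> borel_measurable M" for k
          unfolding coded_solution_def
          by (intro borel_measurable_add decoded_path_measurable_M Z_measurable True)
        have "u k s = (\<integral>w. weight A I k w * a k (\<xi> k s w) \<partial>M)" for k
          unfolding u_def
        proof (rule integral_cong_AE)
          show "AE w in M. weight A I k w * a k (coded_solution k s w) = weight A I k w * a k (\<xi> k s w)"
            using coded_solution_AE by (rule eventually_mono) (use True in simp)
        qed (intro borel_measurable_times weight_measurable(1)[OF A I] measurable_compose[OF _ a_measurable(1)] Xm \<xi>_measurable True)+
        then have "(\<lambda>k. u k s) \<longlonglongrightarrow> v s" using s True A I by (simp add: v_def)
        then show ?thesis by (intro tendsto_scaleR tendsto_const)
      next
        case False
        then show ?thesis by simp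
      qed
    qed
  qed
  then show ?thesis unfolding set_lebesgue_integral_def u_def v_def .
qed

text \<open>Each equation of the sequence is multiplied by the indicator of a rectangle and integrated. All
  terms converge, which gives the limit equation tested with the same indicator.\<close>

lemma limit_equation_at:
  assumes t: "t \<ge> 0"
  shows "AE z in Q. decoded_path B C t (snd z) = x0 + (LBINT s:{0..t}. a0 (limit_path s z))"
proof -
  define R where "R = B + C * t + 1"
  \<comment> \<open>The identity is not bounded; decoded paths stay in the interval from -R to R, where clipping has no effect.\<close>
  define clip where "clip u = max (- R) (min R u)" for u
  have R: "R \<ge> 0" using BC t by (simp add: R_def)
  have clip_id: "clip u = u" if "\<bar>u\<bar> \<le> R" for u using that by (auto simp: clip_def)
  have clipR: "\<bar>clip u\<bar> \<le> R" for u using R by (auto simp: clip_def)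
  have clipL: "\<bar>clip u - clip v\<bar> \<le> 1 * \<bar>u - v\<bar>" for u v unfolding clip_def mult_1 by linarith
  have clipm[measurable]: "clip \<in> borel_measurable borel" unfolding clip_def[abs_def] by measurable
  define J where "J z = (LBINT s:{0..t}. a0 (limit_path s z))" for z
  have Jm: "J \<in> borel_measurable Q" unfolding J_def[abs_def] by (rule limit_fubini(2)[OF t])
  have JB: "\<bar>J z\<bar> \<le> C * t" if "z \<in> space Q" for z
    unfolding J_def using limit_fubini(1)[OF that] a_bound(2) t by (intro integral_of_bounded_le)
  have dm: "(\<lambda>z. decoded_path B C t (snd z)) \<in> borel_measurable Q" by (rule decoded_path_measurable_Q[OF t])
  have dR: "AE z in Q. \<bar>decoded_path B C t (snd z)\<bar> \<le> R"
    using AE_lipschitz_code by (rule eventually_mono) (simp add: R_def decoded_path_bound[OF BC _ t])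
  have "AE z in Q. decoded_path B C t (snd z) - x0 - J z = 0"
  proof (rule AE_zero_by_rectangles)
    show "(\<lambda>z. decoded_path B C t (snd z) - x0 - J z) \<in> borel_measurable Q"
      using dm Jm by simp
    show "AE z in Q. \<bar>decoded_path B C t (snd z) - x0 - J z\<bar> \<le> R + \<bar>x0\<bar> + C * t"
      using dR AE_space
    proof eventually_elim
      case (elim z)
      then show ?case using JB[of z] by linarith
    qed
    fix A and I :: "(nat \<times> nat \<times> nat) set" assume A: "A \<in> sets M" and I: "finite I"
    let ?w = "weight A I" and ?v = "limit_weight A I"
    have wm: "?w k \<in> borel_measurable M" and vm: "?v \<in> borel_measurable Q" for k
      using weight_measurable[OF A I] by blast+
    have c1: "(\<lambda>k. \<integral>w. ?w k w * clip (\<xi> k t w - Z t w) \<partial>M) \<longlonglongrightarrow> (\<integral>z. ?v z * clip (decoded_path B C t (snd z)) \<partial>Q)"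
      by (rule path_functional_conv[OF A I t, where H = "\<lambda>w u. clip u" and K = R and L = 1])
        (use clipR clipL in simp_all)
    have "(\<lambda>k. \<integral>w. ?w k w * 1 \<partial>M) \<longlonglongrightarrow> (\<integral>z. ?v z * 1 \<partial>Q)"
      by (rule path_functional_conv[OF A I t, where H = "\<lambda>w u. 1" and K = 1 and L = 0]) simp_all
    then have c2: "(\<lambda>k. x k * (\<integral>w. ?w k w \<partial>M)) \<longlonglongrightarrow> x0 * (\<integral>z. ?v z \<partial>Q)"
      by (intro tendsto_mult x_tendsto) simp
    have wi: "integrable M (?w k)" for k
      by (rule M.integrable_const_bound[where B = 1]) (use weight_range wm in simp_all)
    have vi: "integrable Q ?v"
      by (rule Q.integrable_const_bound[where B = 1]) (use weight_range vm in simp_all)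
    have id: "(\<integral>w. ?w k w * clip (\<xi> k t w - Z t w) \<partial>M) = x k * (\<integral>w. ?w k w \<partial>M) +
        (LBINT s:{0..t}. (\<integral>w. ?w k w * a k (coded_solution k s w) \<partial>M))" for k
    proof -
      let ?J = "\<lambda>w. LBINT s:{0..t}. a k (coded_solution k s w)"
      have Jkm: "?J \<in> borel_measurable M" by (rule coded_fubini(2)[OF t])
      have JkB: "\<bar>?J w\<bar> \<le> C * t" if "w \<in> space M" for w
        using coded_fubini(1)[OF that] a_bound(1) t by (intro integral_of_bounded_le)
      have wJ: "integrable M (\<lambda>w. ?w k w * ?J w)"
        by (rule M.integrable_weighted[OF wm Jkm weight_range(3) JkB])
      have "(\<integral>w. ?w k w * clip (\<xi> k t w - Z t w) \<partial>M) = (\<integral>w. x k * ?w k w + ?w k w * ?J w \<partial>M)"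
      proof (rule integral_cong_AE)
        show "(\<lambda>w. ?w k w * clip (\<xi> k t w - Z t w)) \<in> borel_measurable M"
          using wm \<xi>_measurable[OF t] Z_measurable[OF t] by measurable
        show "(\<lambda>w. x k * ?w k w + ?w k w * ?J w) \<in> borel_measurable M" using wm Jkm by simp
        show "AE w in M. ?w k w * clip (\<xi> k t w - Z t w) = x k * ?w k w + ?w k w * ?J w"
          using coded_solution_AE
        proof (rule eventually_mono)
          fix w assume w: "\<forall>k. (\<forall>t\<ge>0. coded_solution k t w = \<xi> k t w) \<and> lipschitz_code B C (code k w) \<and>
            (\<forall>t\<ge>0. \<xi> k t w - Z t w = x k + (LBINT s:{0..t}. a k (coded_solution k s w)))"
          have "\<xi> k t w - Z t w = decoded_path B C t (code k w)"
            using w t unfolding coded_solution_def by (metis add_diff_cancel_right')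
          then have "\<bar>\<xi> k t w - Z t w\<bar> \<le> R" using decoded_path_bound[OF BC _ t] w by (simp add: R_def)
          then have "clip (\<xi> k t w - Z t w) = x k + ?J w" using clip_id w t by simp
          then show "?w k w * clip (\<xi> k t w - Z t w) = x k * ?w k w + ?w k w * ?J w"
            by (simp add: algebra_simps)
        qed
      qed
      also have "\<dots> = x k * (\<integral>w. ?w k w \<partial>M) + (\<integral>w. ?w k w * ?J w \<partial>M)"
        using wi wJ by simp
      also have "(\<integral>w. ?w k w * ?J w \<partial>M) = (LBINT s:{0..t}. (\<integral>w. ?w k w * a k (coded_solution k s w) \<partial>M))"
        by (rule coded_fubini(4)[OF wm weight_range(3)])
      finally show ?thesis .
    qed
    have eq: "(\<integral>z. ?v z * clip (decoded_path B C t (snd z)) \<partial>Q) = x0 * (\<integral>z. ?v z \<partial>Q) + (\<integral>z. ?v z * J z \<partial>Q)"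
    proof (rule LIMSEQ_unique[OF c1])
      have "(\<integral>z. ?v z * J z \<partial>Q) = (LBINT s:{0..t}. (\<integral>z. ?v z * a0 (limit_path s z) \<partial>Q))"
        unfolding J_def by (rule limit_fubini(4)[OF vm weight_range(6)])
      then show "(\<lambda>k. \<integral>w. ?w k w * clip (\<xi> k t w - Z t w) \<partial>M) \<longlonglongrightarrow> x0 * (\<integral>z. ?v z \<partial>Q) + (\<integral>z. ?v z * J z \<partial>Q)"
        unfolding id using tendsto_add[OF c2 drift_integral_conv[OF A I, of t]] by simp
    qed
    have vJ: "integrable Q (\<lambda>z. ?v z * J z)"
      by (rule Q.integrable_weighted[OF vm Jm weight_range(6) JB])
    have vc: "integrable Q (\<lambda>z. ?v z * clip (decoded_path B C t (snd z)))"
      by (rule Q.integrable_weighted[OF vm measurable_compose[OF dm clipm] weight_range(6) clipR])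
    have "(\<integral>z. indicator A (fst z) * of_bool (\<forall>i\<in>I. snd z i) * (decoded_path B C t (snd z) - x0 - J z) \<partial>Q) =
        (\<integral>z. ?v z * clip (decoded_path B C t (snd z)) - x0 * ?v z - ?v z * J z \<partial>Q)"
    proof (rule integral_cong_AE)
      show "(\<lambda>z. indicator A (fst z) * of_bool (\<forall>i\<in>I. snd z i) * (decoded_path B C t (snd z) - x0 - J z)) \<in> borel_measurable Q"
        using vm dm Jm unfolding limit_weight_def by measurable
      show "(\<lambda>z. ?v z * clip (decoded_path B C t (snd z)) - x0 * ?v z - ?v z * J z) \<in> borel_measurable Q"
        using vm dm Jm by measurable
      show "AE z in Q. indicator A (fst z) * of_bool (\<forall>i\<in>I. snd z i) * (decoded_path B C t (snd z) - x0 - J z) =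
          ?v z * clip (decoded_path B C t (snd z)) - x0 * ?v z - ?v z * J z"
        using dR by (rule eventually_mono) (simp add: clip_id limit_weight_def algebra_simps)
    qed
    also have "\<dots> = (\<integral>z. ?v z * clip (decoded_path B C t (snd z)) \<partial>Q) - x0 * (\<integral>z. ?v z \<partial>Q) - (\<integral>z. ?v z * J z \<partial>Q)"
      using vi vJ vc by simp
    also have "\<dots> = 0" unfolding eq by simp
    finally show "(\<integral>z. indicator A (fst z) * of_bool (\<forall>i\<in>I. snd z i) * (decoded_path B C t (snd z) - x0 - J z) \<partial>Q) = 0" .
  qed
  then show ?thesis by (rule eventually_mono) (simp add: J_def)
qed

text \<open>Both sides are continuous in time, so dyadic times suffice for an exceptional set that does not
  depend on time.\<close>

lemma limit_equation:
  "AE z in Q. \<forall>t\<ge>0. limit_path t z = x0 + (LBINT s:{0..t}. a0 (limit_path s z)) + Z t (fst z)"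
proof -
  have "AE z in Q. \<forall>m j. decoded_path B C (real j / 2 ^ m) (snd z) = x0 + (LBINT s:{0..real j / 2 ^ m}. a0 (limit_path s z))"
    unfolding AE_all_countable by (intro allI limit_equation_at) simp
  then show ?thesis using AE_lipschitz_code AE_space
  proof eventually_elim
    case (elim z)
    let ?I = "\<lambda>t. LBINT s:{0..t}. a0 (limit_path s z)"
    have lipI: "\<bar>?I t - ?I s\<bar> \<le> C * \<bar>t - s\<bar>" if "s \<ge> 0" "t \<ge> 0" for s t
      by (rule integral_of_bounded_is_lipschitz[OF limit_fubini(1)[OF elim(3)] a_bound(2) that])
    have "decoded_path B C t (snd z) = x0 + ?I t" if t: "t \<ge> 0" for t
    proof -
      let ?g = "\<lambda>m. real (nat \<lfloor>2 ^ m * t\<rfloor>) / 2 ^ m"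
      have 1: "(\<lambda>m. decoded_path B C (?g m) (snd z)) \<longlonglongrightarrow> decoded_path B C t (snd z)"
        by (rule lipschitz_dyadic_limit[OF _ t]) (rule decoded_path_lipschitz[OF BC elim(2)])
      have 2: "(\<lambda>m. x0 + ?I (?g m)) \<longlonglongrightarrow> x0 + ?I t"
        by (rule lipschitz_dyadic_limit[OF _ t]) (use lipI in simp)
      have "decoded_path B C (?g m) (snd z) = x0 + ?I (?g m)" for m using elim(1) by blast
      then show ?thesis using 1 2 LIMSEQ_unique by simp
    qed
    then show ?case by (simp add: limit_path_def)
  qed
qed

abbreviation extended :: "real \<Rightarrow> ('a \<times> path_code) measure" where
  "extended \<equiv> extended_filtration F time"

lemma limit_path_solution: "is_solution Q extended (\<lambda>t z. Z t (fst z)) x0 a0 limit_path"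
  unfolding is_solution_def
proof
  note ext = extended_filtration[OF fps, where \<tau> = time]
  show "adapted_process extended limit_path"
    unfolding adapted_process_def
  proof (intro allI impI)
    fix t :: real assume t: "t \<ge> 0"
    have "(\<lambda>z. decoded_path B C t (snd z)) \<in> borel_measurable (extended t)"
      by (rule decoded_path_measurable[OF t]) (rule ext(5)[OF t], simp add: time_def)
    moreover have "(\<lambda>z. Z t (fst z)) \<in> borel_measurable (extended t)"
      using adapted(1) t by (intro measurable_compose[OF ext(4)[OF t]]) (simp add: adapted_process_def)
    ultimately show "limit_path t \<in> borel_measurable (extended t)"
      unfolding limit_path_def[abs_def] by (rule borel_measurable_add)
  qed
  show "AE z in Q. (\<forall>T>0. set_integrable lborel {0..T} (\<lambda>s. a0 (limit_path s z))) \<and>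
        (\<forall>t\<ge>0. limit_path t z = x0 + (LBINT s:{0..t}. a0 (limit_path s z)) + Z t (fst z))"
    using limit_equation AE_space
  proof eventually_elim
    case (elim z)
    then show ?case using limit_fubini(1)[OF elim(2)] by simp
  qed
qed

lemma original_solution: "is_solution Q extended (\<lambda>t z. Z t (fst z)) x0 a0 (\<lambda>t z. \<xi>0 t (fst z))"
  unfolding is_solution_def
proof
  show "adapted_process extended (\<lambda>t z. \<xi>0 t (fst z))"
    unfolding adapted_process_def
    using adapted(3) measurable_compose[OF extended_filtration(4)[OF fps, where \<tau> = time]]
    unfolding adapted_process_def by blast
  have "AE w in M. (\<forall>T>0. set_integrable lborel {0..T} (\<lambda>s. a0 (\<xi>0 s w))) \<and>
        (\<forall>t\<ge>0. \<xi>0 t w = x0 + (LBINT s:{0..t}. a0 (\<xi>0 s w)) + Z t w)"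
    using solution(2) by (simp add: is_solution_def)
  from AE_fst[OF this]
  show "AE z in Q. (\<forall>T>0. set_integrable lborel {0..T} (\<lambda>s. a0 (\<xi>0 s (fst z)))) \<and>
        (\<forall>t\<ge>0. \<xi>0 t (fst z) = x0 + (LBINT s:{0..t}. a0 (\<xi>0 s (fst z))) + Z t (fst z))" .
qed

text \<open>Both processes solve the limit equation on the enlarged space with respect to the enlarged
  filtration, so pathwise uniqueness applies.\<close>

lemma limit_path_eq: "AE z in Q. \<forall>t\<ge>0. limit_path t z = \<xi>0 t (fst z)"
  using unique[unfolded pathwise_unique_def, THEN spec, THEN spec, THEN spec, THEN spec, THEN spec,
      THEN mp, THEN mp, THEN mp, THEN mp, THEN mp,
      OF extended_filtration(3)[OF fps] extended_levy_process(1)[OF fps levy code_adapted]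
        extended_levy_process(2)[OF fps levy code_adapted] limit_path_solution original_solution] .

text \<open>The function \<open>min 1 \<bar>u + Z t - \<xi>0 t\<bar>\<close> of the drift part \<open>u\<close> involves the given solution as a
  function of the sample point, which stable convergence admits. Its limit expectation vanishes by
  uniqueness.\<close>

lemma fixed_time_conv:
  assumes t: "t \<ge> 0"
  shows "(\<lambda>k. \<integral>w. min 1 \<bar>\<xi> k t w - \<xi>0 t w\<bar> \<partial>M) \<longlonglongrightarrow> 0"
proof -
  let ?H = "\<lambda>w u. min 1 \<bar>u + Z t w - \<xi>0 t w\<bar>"
  have [measurable]: "Z t \<in> borel_measurable M" "\<xi>0 t \<in> borel_measurable M"
    by (rule Z_measurable[OF t], rule \<xi>0_measurable[OF t])
  have "(\<lambda>k. \<integral>w. weight (space M) {} k w * ?H w (\<xi> k t w - Z t w) \<partial>M) \<longlonglongrightarrow>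
      (\<integral>z. limit_weight (space M) {} z * ?H (fst z) (decoded_path B C t (snd z)) \<partial>Q)"
  proof (rule path_functional_conv[OF sets.top finite.emptyI t, where H = ?H and K = 1 and L = 1])
    show "(\<lambda>(w, u). ?H w u) \<in> borel_measurable (M \<Otimes>\<^sub>M borel)" by measurable
    show "\<bar>?H w u - ?H w u'\<bar> \<le> 1 * \<bar>u - u'\<bar>" for w u u' unfolding mult_1 by linarith
  qed auto
  moreover have "(\<integral>w. weight (space M) {} k w * ?H w (\<xi> k t w - Z t w) \<partial>M) = (\<integral>w. min 1 \<bar>\<xi> k t w - \<xi>0 t w\<bar> \<partial>M)" for k
    by (rule Bochner_Integration.integral_cong) (simp_all add: weight_def)
  moreover have "(\<integral>z. limit_weight (space M) {} z * ?H (fst z) (decoded_path B C t (snd z)) \<partial>Q) = 0"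
  proof (rule integral_eq_zero_AE)
    show "AE z in Q. limit_weight (space M) {} z * ?H (fst z) (decoded_path B C t (snd z)) = 0"
      using limit_path_eq by (rule eventually_mono) (use t in \<open>simp add: limit_path_def\<close>)
  qed
  ultimately show ?thesis by simp
qed

end

section \<open>Convergence in probability, uniformly in time\<close>

lemma solution_minus_noise_lipschitz:
  assumes sol: "is_solution M F Z x a \<xi>" and a: "\<And>y. \<bar>a y\<bar> \<le> C"
  shows "AE w in M. C-lipschitz_on {0..} (\<lambda>t. \<xi> t w - Z t w)"
proof -
  have "AE w in M. (\<forall>T>0. set_integrable lborel {0..T} (\<lambda>s. a (\<xi> s w))) \<and>
        (\<forall>t\<ge>0. \<xi> t w = x + (LBINT s:{0..t}. a (\<xi> s w)) + Z t w)"
    using sol by (simp add: is_solution_def)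
  then show ?thesis
  proof (rule eventually_mono)
    fix w
    assume w: "(\<forall>T>0. set_integrable lborel {0..T} (\<lambda>s. a (\<xi> s w))) \<and>
        (\<forall>t\<ge>0. \<xi> t w = x + (LBINT s:{0..t}. a (\<xi> s w)) + Z t w)"
    show "C-lipschitz_on {0..} (\<lambda>t. \<xi> t w - Z t w)"
    proof (rule lipschitz_onI)
      fix t s :: real assume st: "t \<in> {0..}" "s \<in> {0..}"
      have "\<bar>(LBINT u:{0..t}. a (\<xi> u w)) - (LBINT u:{0..s}. a (\<xi> u w))\<bar> \<le> C * \<bar>t - s\<bar>"
        by (rule integral_of_bounded_is_lipschitz) (use w a st in auto)
      moreover have "\<xi> r w - Z r w = x + (LBINT u:{0..r}. a (\<xi> u w))" if "r \<ge> 0" for r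
        using w that by simp
      ultimately show "dist (\<xi> t w - Z t w) (\<xi> s w - Z s w) \<le> C * dist t s"
        using st by (simp add: dist_real_def)
    qed (use a[of 0] in linarith)
  qed
qed

lemma outer_measure_of_le: "A \<subseteq> S \<Longrightarrow> S \<in> sets M \<Longrightarrow> outer_measure_of M A \<le> emeasure M S"
  unfolding outer_measure_of_def by (rule INF_lower) simp

lemma (in prob_space) truncated_markov:
  assumes Y[measurable]: "Y \<in> borel_measurable M" and d: "d > 0"
  shows "prob {w\<in>space M. \<bar>Y w\<bar> > d} \<le> (\<integral>w. min 1 \<bar>Y w\<bar> \<partial>M) / min 1 d"
proof -
  let ?S = "{w\<in>space M. \<bar>Y w\<bar> > d}"
  have S: "?S \<in> sets M" by measurable
  have i: "integrable M (\<lambda>w. min 1 \<bar>Y w\<bar>)"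
    by (rule integrable_const_bound[where B = 1]) auto
  have j: "integrable M (\<lambda>w. min 1 d * indicator ?S w)"
    by (rule integrable_const_bound[where B = "min 1 d"]) (use d S in \<open>auto simp: indicator_def\<close>)
  have "(\<integral>w. min 1 d * indicator ?S w \<partial>M) \<le> (\<integral>w. min 1 \<bar>Y w\<bar> \<partial>M)"
    by (rule integral_mono[OF j i]) (use d in \<open>auto simp: indicator_def\<close>)
  moreover have "(\<integral>w. min 1 d * indicator ?S w \<partial>M) = min 1 d * prob ?S"
    using S by (simp add: Int_absorb1)
  ultimately show ?thesis using d by (simp add: field_simps)
qed

context converging_drifts
begin

lemma prob_M: "prob_space M" using fps by (simp add: filtered_prob_space_def)

lemma subsequence:
  assumes r: "strict_mono (r :: nat \<Rightarrow> nat)"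
  shows "converging_drifts M F Z (\<lambda>k. x (r k)) (\<lambda>k. a (r k)) (\<lambda>k. \<xi> (r k)) x0 a0 \<xi>0 \<mu> B C"
proof (rule converging_drifts.intro)
  show "(\<lambda>k. x (r k)) \<longlonglongrightarrow> x0"
    using LIMSEQ_subseq_LIMSEQ[OF x_tendsto r] by (simp add: comp_def)
  show "(\<lambda>n. measure \<mu> {y. e < \<bar>a (r n) y - a0 y\<bar>}) \<longlonglongrightarrow> 0" if "e > 0" for e
    using LIMSEQ_subseq_LIMSEQ[OF a_tendsto[OF that] r] by (simp add: comp_def)
  show "AE t in lborel. t \<ge> 0 \<longrightarrow> (\<forall>e>0. \<exists>d>0. \<forall>S\<in>sets borel. measure \<mu> S < d \<longrightarrow>
      (\<forall>n. measure M {w\<in>space M. \<xi> (r n) t w \<in> S} \<le> e))"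
    using laws_small by (rule eventually_mono) meson
qed (fact fps levy a_measurable a_bound x_bound solution mu unique)+

lemma fixed_time_convergent_subsequence:
  obtains r :: "nat \<Rightarrow> nat" where "strict_mono r"
    "\<forall>t\<ge>0. (\<lambda>k. \<integral>w. min 1 \<bar>\<xi> (r k) t w - \<xi>0 t w\<bar> \<partial>M) \<longlonglongrightarrow> 0"
proof -
  obtain r :: "nat \<Rightarrow> nat" and Q where r: "strict_mono r" and Q: "prob_space Q" "space Q = space M \<times> UNIV"
    "sets Q = sigma_sets (space M \<times> UNIV) (cylinder_algebra M)"
    "\<And>D. D \<in> cylinder_algebra M \<Longrightarrow> (\<lambda>k. measure M {w\<in>space M. (w, code (r k) w) \<in> D}) \<longlonglongrightarrow> measure Q D"
    using stable_limit_measure[where X = code, OF prob_M code_measurable] by blast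
  interpret S: converging_drifts M F Z "\<lambda>k. x (r k)" "\<lambda>k. a (r k)" "\<lambda>k. \<xi> (r k)" x0 a0 \<xi>0 \<mu> B C
    by (rule subsequence[OF r])
  have code: "S.code = (\<lambda>k. code (r k))"
    by (intro ext) (simp add: S.code_def code_def)
  interpret L: converging_drifts_limit M F Z "\<lambda>k. x (r k)" "\<lambda>k. a (r k)" "\<lambda>k. \<xi> (r k)" x0 a0 \<xi>0 \<mu> B C Q
  proof (intro converging_drifts_limit.intro S.converging_drifts_axioms stable_limit.intro)
    show "{w\<in>space M. S.code k w i} \<in> sets M" for k i by (rule S.code_measurable)
    show "(\<lambda>k. measure M {w\<in>space M. (w, S.code k w) \<in> D}) \<longlonglongrightarrow> measure Q D" if "D \<in> cylinder_algebra M" for D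
      unfolding code by (rule Q(4)[OF that])
  qed (fact prob_M Q)+
  show ?thesis using that[OF r] L.fixed_time_conv by blast
qed

text \<open>The noise cancels in \<open>\<xi> k - \<xi>0\<close>, which is therefore Lipschitz with constant \<open>2 * C\<close>, and a
  finite grid of times controls the supremum. The event that the supremum is large need not be
  measurable; it is covered by finitely many measurable events and a null set.\<close>

lemma uniform_convergence_in_probability:
  assumes conv: "\<And>t. t \<ge> 0 \<Longrightarrow> (\<lambda>k. \<integral>w. min 1 \<bar>\<xi> k t w - \<xi>0 t w\<bar> \<partial>M) \<longlonglongrightarrow> 0"
    and T: "T > 0" and e: "e > 0"
  shows "(\<lambda>k. outer_measure_of M {w\<in>space M. (SUP t\<in>{0..T}. ennreal \<bar>\<xi> k t w - \<xi>0 t w\<bar>) > ennreal e}) \<longlonglongrightarrow> 0"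
proof -
  interpret M: prob_space M by (rule prob_M)
  let ?G = "\<lambda>k. {w\<in>space M. (SUP t\<in>{0..T}. ennreal \<bar>\<xi> k t w - \<xi>0 t w\<bar>) > ennreal e}"
  let ?L = "\<lambda>f w. C-lipschitz_on {0..} (\<lambda>t. f t w - Z t w)"
  have "AE w in M. (\<forall>n. ?L (\<xi> n) w) \<and> ?L \<xi>0 w"
    unfolding AE_conj_iff AE_all_countable
    using solution_minus_noise_lipschitz[OF solution(1) a_bound(1)]
      solution_minus_noise_lipschitz[OF solution(2) a_bound(2)] by blast
  then obtain N where N: "{w\<in>space M. \<not> ((\<forall>n. ?L (\<xi> n) w) \<and> ?L \<xi>0 w)} \<subseteq> N" "N \<in> sets M" "emeasure M N = 0"
    by (rule AE_E)
  have "(\<lambda>m. 2 * C * (1/2) ^ m) \<longlonglongrightarrow> 2 * C * 0" by (intro tendsto_intros LIMSEQ_power_zero) simp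
  then have "eventually (\<lambda>m. 2 * C * (1/2) ^ m < e / 2) sequentially"
    using e by (intro order_tendstoD(2)) auto
  then obtain m where m: "2 * C * (1/2) ^ m < e / 2" by (auto simp: eventually_sequentially)
  define J where "J = nat \<lfloor>2 ^ m * T\<rfloor>"
  define E where "E k j = {w\<in>space M. \<bar>\<xi> k (real j / 2 ^ m) w - \<xi>0 (real j / 2 ^ m) w\<bar> > e / 2}" for k j
  have dm: "(\<lambda>w. \<xi> k (real j / 2 ^ m) w - \<xi>0 (real j / 2 ^ m) w) \<in> borel_measurable M" for k j
    by (intro borel_measurable_diff \<xi>_measurable \<xi>0_measurable) auto
  have Em: "E k j \<in> sets M" for k j
    unfolding E_def using dm[of k j] by measurable
  have sub: "?G k \<subseteq> (\<Union>j\<le>J. E k j) \<union> N" for k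
  proof
    fix w assume w: "w \<in> ?G k"
    show "w \<in> (\<Union>j\<le>J. E k j) \<union> N"
    proof (rule ccontr)
      assume notin: "w \<notin> (\<Union>j\<le>J. E k j) \<union> N"
      have "w \<notin> N" "w \<in> space M" using notin w by auto
      then have L: "?L (\<xi> k) w" "?L \<xi>0 w" using N(1) by blast+
      have "\<bar>\<xi> k t w - \<xi>0 t w\<bar> \<le> e" if t: "t \<in> {0..T}" for t
      proof -
        define j where "j = nat \<lfloor>2 ^ m * t\<rfloor>"
        let ?s = "real j / 2 ^ m"
        have "2 ^ m * t \<le> 2 ^ m * T" using t by simp
        then have j: "j \<le> J" unfolding j_def J_def by (intro nat_mono floor_mono)
        then have 1: "\<bar>\<xi> k ?s w - \<xi>0 ?s w\<bar> \<le> e / 2" using notin w by (auto simp: E_def not_less)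
        have t0: "t \<ge> 0" using t by simp
        have ts: "\<bar>t - ?s\<bar> \<le> (1/2) ^ m" using dyadic_below[OF t0, of m] unfolding j_def by linarith
        have 2: "\<bar>(\<xi> k t w - Z t w) - (\<xi> k ?s w - Z ?s w)\<bar> \<le> C * \<bar>t - ?s\<bar>"
          "\<bar>(\<xi>0 t w - Z t w) - (\<xi>0 ?s w - Z ?s w)\<bar> \<le> C * \<bar>t - ?s\<bar>"
          using lipschitz_onD[OF L(1), of t ?s] lipschitz_onD[OF L(2), of t ?s] t0
          by (simp_all add: dist_real_def)
        have "C * \<bar>t - ?s\<bar> \<le> C * (1/2) ^ m" using ts BC(2) by (rule mult_left_mono)
        then show ?thesis using 1 2 m by linarith
      qed
      then have "(SUP t\<in>{0..T}. ennreal \<bar>\<xi> k t w - \<xi>0 t w\<bar>) \<le> ennreal e"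
        by (intro SUP_least ennreal_leI)
      with w show False by (auto dest: leD)
    qed
  qed
  define b where "b k = (\<Sum>j\<le>J. (\<integral>w. min 1 \<bar>\<xi> k (real j / 2 ^ m) w - \<xi>0 (real j / 2 ^ m) w\<bar> \<partial>M) / min 1 (e / 2))" for k
  have le: "outer_measure_of M (?G k) \<le> ennreal (b k)" for k
  proof -
    have "outer_measure_of M (?G k) \<le> emeasure M ((\<Union>j\<le>J. E k j) \<union> N)"
      by (rule outer_measure_of_le[OF sub]) (use Em N(2) in auto)
    also have "\<dots> = emeasure M (\<Union>j\<le>J. E k j)"
      by (rule emeasure_Un_null_set) (use Em N in auto)
    also have "\<dots> = ennreal (M.prob (\<Union>j\<le>J. E k j))" by (rule M.emeasure_eq_measure)
    also have "M.prob (\<Union>j\<le>J. E k j) \<le> (\<Sum>j\<le>J. M.prob (E k j))"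
      by (rule M.finite_measure_subadditive_finite) (use Em in auto)
    also have "\<dots> \<le> b k"
      unfolding b_def E_def using e by (intro sum_mono M.truncated_markov dm) auto
    finally show ?thesis by (simp add: ennreal_leI)
  qed
  have "b \<longlonglongrightarrow> (\<Sum>j\<le>J. 0 / min 1 (e / 2))"
    unfolding b_def[abs_def] by (intro tendsto_sum tendsto_divide tendsto_const conv) (use e in auto)
  then have b0: "(\<lambda>k. ennreal (b k)) \<longlonglongrightarrow> 0"
    using tendsto_ennrealI[of b 0 sequentially] by simp
  show ?thesis
  proof (rule tendsto_sandwich[OF _ _ tendsto_const b0])
    show "\<forall>\<^sub>F k in sequentially. outer_measure_of M (?G k) \<le> ennreal (b k)"
      using le by (rule always_eventually[OF allI])
  qed simp
qed

end

theorem theorem2p1: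
  fixes M :: "'a measure" and F :: "real \<Rightarrow> 'a measure" and Z :: "real \<Rightarrow> 'a \<Rightarrow> real"
    and x :: "nat \<Rightarrow> real" and a :: "nat \<Rightarrow> real \<Rightarrow> real"
    and \<xi> :: "nat \<Rightarrow> real \<Rightarrow> 'a \<Rightarrow> real"
    and \<mu> :: "real measure" and p :: "nat \<Rightarrow> real \<Rightarrow> real \<Rightarrow> real"
  assumes space: "filtered_prob_space M F"
    and levy: "levy_process M F Z"
    and a_measurable: "\<And>n. a n \<in> borel_measurable borel"
    and solution: "\<And>n. is_solution M F Z (x n) (a n) (\<xi> n)"
    and x_tendsto: "x \<longlonglongrightarrow> x 0"
    and a_bounded: "(SUP n. SUP y. ennreal \<bar>a n y\<bar>) < \<infinity>"
    and mu: "finite_measure \<mu>" "sets \<mu> = sets borel"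
    and density: "\<And>n. n \<ge> 1 \<Longrightarrow> AE t in lborel. t \<ge> 0 \<longrightarrow>
          (\<forall>y. 0 \<le> p n t y) \<and> distributed M \<mu> (\<xi> n t) (\<lambda>y. ennreal (p n t y))"
    and a_tendsto: "converges_in_measure \<mu> a (a 0)"
    and unif_int: "AE t in lborel. t \<ge> 0 \<longrightarrow> uniformly_integrable \<mu> {1..} (\<lambda>n. p n t)"
    and unique: "pathwise_unique TYPE(path3) (process_law M Z) (x 0) (a 0)"
  shows "\<forall>T>0. tendsto_0_in_prob M (\<lambda>n \<omega>. SUP t\<in>{0..T}. ennreal \<bar>\<xi> n t \<omega> - \<xi> 0 t \<omega>\<bar>)"
  unfolding tendsto_0_in_prob_def
proof (intro allI impI)
  fix T e :: real assume T: "T > 0" and e: "e > 0"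
  interpret \<mu>: finite_measure \<mu> by fact
  have prob_M: "prob_space M" using space by (simp add: filtered_prob_space_def)
  define S where "S = (SUP n. SUP y. ennreal \<bar>a n y\<bar>)"
  have a_le: "\<bar>a n y\<bar> \<le> enn2real S" for n y
  proof -
    have "ennreal \<bar>a n y\<bar> \<le> S"
      unfolding S_def by (rule SUP_upper2[of n]) (auto intro: SUP_upper)
    moreover have "S < top" using a_bounded by (simp add: S_def)
    ultimately show ?thesis by (metis abs_ge_zero enn2real_ennreal enn2real_mono)
  qed
  have "Bseq x" using x_tendsto by (intro convergent_imp_Bseq convergentI)
  then obtain B where B: "\<And>n. \<bar>x n\<bar> \<le> B" by (auto simp: Bseq_def)
  have sp: "space \<mu> = UNIV" using sets_eq_imp_space_eq[OF mu(2)] by simp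
  have a_conv: "(\<lambda>n. measure \<mu> {y. \<bar>a n y - a 0 y\<bar> > d}) \<longlonglongrightarrow> 0" if "d > 0" for d
  proof -
    have "(\<lambda>n. emeasure \<mu> {y. \<bar>a n y - a 0 y\<bar> > d}) \<longlonglongrightarrow> 0"
      using a_tendsto that by (simp add: converges_in_measure_def sp)
    then have "(\<lambda>n. enn2real (emeasure \<mu> {y. \<bar>a n y - a 0 y\<bar> > d})) \<longlonglongrightarrow> enn2real 0"
      by (intro tendsto_enn2real) auto
    then show ?thesis by (simp add: measure_def)
  qed
  have small: "AE t in lborel. t \<ge> 0 \<longrightarrow> (\<forall>d>0. \<exists>c>0. \<forall>S\<in>sets borel. measure \<mu> S < c \<longrightarrow>
      (\<forall>n\<in>{1..}. measure M {w\<in>space M. \<xi> n t w \<in> S} \<le> d))"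
  proof -
    have "AE t in lborel. \<forall>n. n \<ge> 1 \<longrightarrow> t \<ge> 0 \<longrightarrow>
          (\<forall>y. 0 \<le> p n t y) \<and> distributed M \<mu> (\<xi> n t) (\<lambda>y. ennreal (p n t y))"
      unfolding AE_all_countable using density by (auto intro: eventually_mono)
    with unif_int show ?thesis
    proof eventually_elim
      case (elim t)
      show ?case
      proof (intro impI allI)
        fix d :: real assume t: "t \<ge> 0" and d: "d > 0"
        show "\<exists>c>0. \<forall>S\<in>sets borel. measure \<mu> S < c \<longrightarrow> (\<forall>n\<in>{1..}. measure M {w\<in>space M. \<xi> n t w \<in> S} \<le> d)"
          by (rule uniformly_integrable_densities_small[OF prob_M mu, where p = "\<lambda>n. p n t"])
            (use elim t d in auto)
      qed
    qed
  qed
  show "(\<lambda>n. outer_measure_of M {\<omega>\<in>Sigma_Algebra.space M. (SUP t\<in>{0..T}. ennreal \<bar>\<xi> n t \<omega> - \<xi> 0 t \<omega>\<bar>) > ennreal e}) \<longlonglongrightarrow> 0"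
  proof (rule tendsto_0_by_subsequences)
    fix r :: "nat \<Rightarrow> nat" assume r: "strict_mono r"
    \<comment> \<open>The laws of the solutions are controlled for positive indices only; shifting a subsequence avoids the index 0.\<close>
    define s where "s k = r (Suc k)" for k
    have s: "strict_mono s" using r by (simp add: s_def strict_mono_def)
    have s1: "s k \<in> {1..}" for k
      using strict_mono_imp_increasing[OF r, of "Suc k"] by (simp add: s_def)
    interpret converging_drifts M F Z "\<lambda>k. x (s k)" "\<lambda>k. a (s k)" "\<lambda>k. \<xi> (s k)" "x 0" "a 0" "\<xi> 0" \<mu> B "enn2real S"
    proof (rule converging_drifts.intro)
      show "(\<lambda>k. x (s k)) \<longlonglongrightarrow> x 0"
        using LIMSEQ_subseq_LIMSEQ[OF x_tendsto s] by (simp add: comp_def)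
      show "(\<lambda>k. measure \<mu> {y. d < \<bar>a (s k) y - a 0 y\<bar>}) \<longlonglongrightarrow> 0" if "d > 0" for d
        using LIMSEQ_subseq_LIMSEQ[OF a_conv[OF that] s] by (simp add: comp_def)
      show "AE t in lborel. t \<ge> 0 \<longrightarrow> (\<forall>d>0. \<exists>c>0. \<forall>S\<in>sets borel. measure \<mu> S < c \<longrightarrow>
          (\<forall>k. measure M {w\<in>Sigma_Algebra.space M. \<xi> (s k) t w \<in> S} \<le> d))"
        using small by (rule eventually_mono) (meson s1)
      show "pathwise_unique TYPE('a \<times> path_code) (process_law M Z) (x 0) (a 0)"
        by (rule pathwise_unique_path3[OF unique])
    qed (fact space levy a_measurable a_le B solution mu)+
    obtain q :: "nat \<Rightarrow> nat" where q: "strict_mono q"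
      "\<forall>t\<ge>0. (\<lambda>k. \<integral>w. min 1 \<bar>\<xi> (s (q k)) t w - \<xi> 0 t w\<bar> \<partial>M) \<longlonglongrightarrow> 0"
      by (rule fixed_time_convergent_subsequence)
    interpret sub: converging_drifts M F Z "\<lambda>k. x (s (q k))" "\<lambda>k. a (s (q k))" "\<lambda>k. \<xi> (s (q k))" "x 0" "a 0" "\<xi> 0" \<mu> B "enn2real S"
      by (rule subsequence[OF q(1)])
    have "(\<lambda>k. outer_measure_of M {\<omega>\<in>Sigma_Algebra.space M. (SUP t\<in>{0..T}. ennreal \<bar>\<xi> (s (q k)) t \<omega> - \<xi> 0 t \<omega>\<bar>) > ennreal e}) \<longlonglongrightarrow> 0"
      by (rule sub.uniform_convergence_in_probability[OF _ T e]) (use q(2) in blast)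
    moreover have "strict_mono (\<lambda>k. Suc (q k))" using q(1) by (simp add: strict_mono_def)
    ultimately show "\<exists>q. strict_mono q \<and> (\<lambda>k. outer_measure_of M {\<omega>\<in>Sigma_Algebra.space M. (SUP t\<in>{0..T}. ennreal \<bar>\<xi> (r (q k)) t \<omega> - \<xi> 0 t \<omega>\<bar>) > ennreal e}) \<longlonglongrightarrow> 0"
      by (intro exI[of _ "\<lambda>k. Suc (q k)"]) (simp add: s_def)
  qed
qed

end
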